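(* Let $m,n$ be natural numbers, $X=\mathbb R^n$, $U=\mathbb R^m$, $\mathcal U=L^\infty(\mathbb R_+,\mathbb R^m)$, and let $f:\mathbb R^n\times\mathbb R^m\to\mathbb R^n$ be such that for each $C>0$ there exists $L_C>0$ with $$\|f(x_1,u_1)-f(x_2,u_2)\|\le L_C\big(\|x_1-x_2\|+\|u_1-u_2\|\big)\quad\text{for all } x_1,x_2\in B_C,\ u_1,u_2\in B_{C,U}.$$ Consider the ODE system $\dot x(t)=f(x(t),u(t))$, $t\ge0$, with inputs $u\in\mathcal U$, and let $\Sigma=(X,\mathcal U,\phi)$ be the control system where $\phi(\cdot,x,u)$ is the maximal (Carathéodory) solution with initial condition $x$ and input $u$. The following statements are equivalent: (i) $\Sigma$ is forward complete. (ii) $\Sigma$ has bounded reachability sets (BRS). (iii) There exists a (continuous) BRS Lyapunov function for $\Sigma$. (iv) There exists a BRS Lyapunov function for $\Sigma$ that is Lipschitz continuous on bounded sets. (v) $\Sigma$ is robustly forward complete with respect to trajectory-dominated inputs.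
   Context: Notation: $\mathbb R_+=[0,\infty)$; $\mathcal K_\infty$ is the set of continuous, strictly increasing, unbounded $\gamma:\mathbb R_+\to\mathbb R_+$ with $\gamma(0)=0$; $B_C$, $B_{C,U}$ are the open balls of radius $C$ around $0$ in $X$ and $U$; $\|\cdot\|_{\mathcal U}$ is the essential supremum norm. Forward complete: $\phi(t,x,u)$ is defined for all $t\ge0$, $x\in X$, $u\in\mathcal U$. BRS: forward complete and for all $C>0$, $\tau\ge0$: $\sup\{\|\phi(t,x,u)\|:\|x\|<C,\ \|u\|_{\mathcal U}<C,\ t<\tau\}<\infty$. Trajectory-dominated inputs (for forward complete $\Sigma$): for $\eta\in\mathcal K_\infty$, $x\in X$, $\mathcal U_x^\eta=\{v\in\mathcal U:\|v(\theta)\|\le\eta(\|\phi(\theta,x,v)\|)\text{ for a.e. }\theta\ge0\}$. Robust forward completeness with respect to trajectory-dominated inputs: forward complete and there is $\eta\in\mathcal K_\infty$ such that for all $C>0$, $\tau\ge0$: $\sup\{\|\phi(t,x,u)\|:\|x\|<C,\ u\in\mathcal U_x^\eta,\ t<\tau\}<\infty$. Lie derivative: $\dot V_u(x)=\limsup_{s\to0^+}\frac1s\big(V(\phi(s,x,u))-V(x)\big)$. BRS Lyapunov function: a continuous $V:X\to\mathbb R_+$ such that (a) there are $\alpha_1,\alpha_2\in\mathcal K_\infty$ and $C\ge0$ with $\alpha_1(\|x\|)\le V(x)\le\alpha_2(\|x\|)+C$ for all $x\in X$; (b) there is $\chi\in\mathcal K_\infty$ such that for all $x\in X$, $u\in\mathcal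 U$: $\chi(\|u\|_{\mathcal U})\le\|x\|$ implies $\dot V_u(x)\le V(x)$. Lipschitz continuous on bounded sets: for each $C>0$ there is $L_C>0$ with $|V(x_1)-V(x_2)|\le L_C\|x_1-x_2\|$ for all $x_1,x_2\in B_C$. *)

theory Defs
  imports "HOL-Analysis.Analysis" "HOL-Probability.Essential_Supremum"
begin

section \<open>Comparison functions and inputs\<close>

text \<open>Functions on the half-line \<open>[0, \<infinity>)\<close> are modelled by functions on \<open>real\<close> of which only
  the restriction to \<open>{0..}\<close> matters. Nonnegativity on \<open>{0..}\<close> follows from the value at 0
  and monotonicity.\<close>

definition class_K_inf :: "(real \<Rightarrow> real) set" where
  "class_K_inf = {\<gamma>. continuous_on {0..} \<gamma> \<and> strict_mono_on {0..} \<gamma> \<and>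
                     \<not> bdd_above (\<gamma> ` {0..}) \<and> \<gamma> 0 = 0}"

text \<open>Elements of \<open>L\<^sup>\<infinity>\<close> are represented by functions rather than by classes of functions modulo
  null sets; every notion below is invariant under changing an input on a null set.\<close>

definition ess_norm :: "(real \<Rightarrow> 'u::euclidean_space) \<Rightarrow> ereal" where
  "ess_norm u = esssup (lebesgue_on {0..}) (\<lambda>t. ereal (norm (u t)))"

definition Linf_inputs :: "(real \<Rightarrow> 'u::euclidean_space) set" where
  "Linf_inputs = {u. u \<in> borel_measurable (lebesgue_on {0..}) \<and> ess_norm u < \<infinity>}"

definition input_norm :: "(real \<Rightarrow> 'u::euclidean_space) \<Rightarrow> real" where
  "input_norm u = real_of_ereal (ess_norm u)"


section \<open>Maximal Caratheodory solutions\<close>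

text \<open>The members of \<open>d\<close> are finitely many closed intervals \<open>[a, b]\<close> (with \<open>a = Inf k\<close>,
  \<open>b = Sup k\<close>) contained in \<open>S\<close> with pairwise disjoint interiors, so this is the usual
  \<open>\<epsilon>\<close>-\<open>\<delta>\<close> definition. It is unrelated to the library constant \<open>absolutely_continuous\<close>, which
  is about measures.\<close>

definition abs_continuous_on :: "real set \<Rightarrow> (real \<Rightarrow> 'x::real_normed_vector) \<Rightarrow> bool" where
  "abs_continuous_on S \<xi> \<longleftrightarrow>
     (\<forall>\<epsilon>>0. \<exists>\<delta>>0. \<forall>d t. d division_of t \<and> t \<subseteq> S \<and> (\<Sum>k\<in>d. Sup k - Inf k) < \<delta> \<longrightarrow>
        (\<Sum>k\<in>d. norm (\<xi> (Sup k) - \<xi> (Inf k))) < \<epsilon>)"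

definition caratheodory_solution ::
  "('x::euclidean_space \<Rightarrow> 'u::euclidean_space \<Rightarrow> 'x) \<Rightarrow> 'x \<Rightarrow> (real \<Rightarrow> 'u) \<Rightarrow> real set
     \<Rightarrow> (real \<Rightarrow> 'x) \<Rightarrow> bool" where
  "caratheodory_solution f x u J \<xi> \<longleftrightarrow>
     is_interval J \<and> J \<subseteq> {0..} \<and> 0 \<in> J \<and> \<xi> 0 = x \<and>
     (\<forall>T\<in>J. abs_continuous_on {0..T} \<xi>) \<and>
     (AE t in lebesgue_on J. (\<xi> has_vector_derivative f (\<xi> t) (u t)) (at t within J))"

definition maximal_solution ::
  "('x::euclidean_space \<Rightarrow> 'u::euclidean_space \<Rightarrow> 'x) \<Rightarrow> 'x \<Rightarrow> (real \<Rightarrow> 'u) \<Rightarrow> real set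
     \<Rightarrow> (real \<Rightarrow> 'x) \<Rightarrow> bool" where
  "maximal_solution f x u J \<xi> \<longleftrightarrow>
     caratheodory_solution f x u J \<xi> \<and>
     (\<forall>J' \<xi>'. caratheodory_solution f x u J' \<xi>' \<and> J \<subseteq> J' \<and> (\<forall>t\<in>J. \<xi>' t = \<xi> t) \<longrightarrow> J' = J)"

text \<open>Transition maps are partial: \<open>\<phi> t x u = None\<close> means that \<open>\<phi>\<close> is undefined at \<open>(t, x, u)\<close>.
  For the right-hand sides considered here the maximal solution is unique on its interval of
  existence, so the description operator below is well-defined.\<close>

type_synonym ('x, 'u) transition_map = "real \<Rightarrow> 'x \<Rightarrow> (real \<Rightarrow> 'u) \<Rightarrow> 'x option"

definition ode_flow ::
  "('x::euclidean_space \<Rightarrow> 'u::euclidean_space \<Rightarrow> 'x) \<Rightarrow> ('x, 'u) transition_map" where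
  "ode_flow f t x u =
     (if \<exists>J \<xi>. maximal_solution f x u J \<xi> \<and> t \<in> J
      then Some (THE y. \<exists>J \<xi>. maximal_solution f x u J \<xi> \<and> t \<in> J \<and> y = \<xi> t)
      else None)"


section \<open>Properties of control systems with inputs in \<open>L\<^sup>\<infinity>\<close>\<close>

definition forward_complete ::
  "('x::euclidean_space, 'u::euclidean_space) transition_map \<Rightarrow> bool" where
  "forward_complete \<phi> \<longleftrightarrow> (\<forall>t\<ge>0. \<forall>x. \<forall>u\<in>Linf_inputs. \<phi> t x u \<noteq> None)"

definition bounded_reachability_sets ::
  "('x::euclidean_space, 'u::euclidean_space) transition_map \<Rightarrow> bool" where
  "bounded_reachability_sets \<phi> \<longleftrightarrow>
     forward_complete \<phi> \<and>
     (\<forall>C>0. \<forall>\<tau>\<ge>0.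
        bdd_above {norm (the (\<phi> t x u)) | t x u.
          norm x < C \<and> u \<in> Linf_inputs \<and> input_norm u < C \<and> 0 \<le> t \<and> t < \<tau>})"

definition dominated_inputs ::
  "('x::euclidean_space, 'u::euclidean_space) transition_map \<Rightarrow> (real \<Rightarrow> real) \<Rightarrow> 'x
     \<Rightarrow> (real \<Rightarrow> 'u) set" where
  "dominated_inputs \<phi> \<eta> x =
     {v \<in> Linf_inputs. AE \<theta> in lebesgue_on {0..}. norm (v \<theta>) \<le> \<eta> (norm (the (\<phi> \<theta> x v)))}"

definition robustly_forward_complete ::
  "('x::euclidean_space, 'u::euclidean_space) transition_map \<Rightarrow> bool" where
  "robustly_forward_complete \<phi> \<longleftrightarrow>
     forward_complete \<phi> \<and>
     (\<exists>\<eta>\<in>class_K_inf. \<forall>C>0. \<forall>\<tau>\<ge>0.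
        bdd_above {norm (the (\<phi> t x u)) | t x u.
          norm x < C \<and> u \<in> dominated_inputs \<phi> \<eta> x \<and> 0 \<le> t \<and> t < \<tau>})"

text \<open>The upper limit may be infinite, hence \<open>ereal\<close>. Only arbitrarily small \<open>s > 0\<close> matter,
  and for these \<open>\<phi> s x u\<close> is defined by local existence of solutions.\<close>

definition lie_derivative ::
  "('x::euclidean_space, 'u::euclidean_space) transition_map \<Rightarrow> ('x \<Rightarrow> real) \<Rightarrow> (real \<Rightarrow> 'u) \<Rightarrow> 'x
     \<Rightarrow> ereal" where
  "lie_derivative \<phi> V u x =
     Limsup (at_right 0) (\<lambda>s. ereal (1 / s * (V (the (\<phi> s x u)) - V x)))"

definition BRS_Lyapunov_function ::
  "('x::euclidean_space, 'u::euclidean_space) transition_map \<Rightarrow> ('x \<Rightarrow> real) \<Rightarrow> bool" where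
  "BRS_Lyapunov_function \<phi> V \<longleftrightarrow>
     continuous_on UNIV V \<and> (\<forall>x. 0 \<le> V x) \<and>
     (\<exists>\<alpha>\<^sub>1\<in>class_K_inf. \<exists>\<alpha>\<^sub>2\<in>class_K_inf. \<exists>C\<ge>0. \<forall>x.
        \<alpha>\<^sub>1 (norm x) \<le> V x \<and> V x \<le> \<alpha>\<^sub>2 (norm x) + C) \<and>
     (\<exists>\<kappa>\<in>class_K_inf. \<forall>x. \<forall>u\<in>Linf_inputs.
        \<kappa> (input_norm u) \<le> norm x \<longrightarrow> lie_derivative \<phi> V u x \<le> ereal (V x))"

definition lipschitz_on_bounded_sets :: "('x::euclidean_space \<Rightarrow> real) \<Rightarrow> bool" where
  "lipschitz_on_bounded_sets V \<longleftrightarrow>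
     (\<forall>C>0. \<exists>L>0. \<forall>x\<^sub>1\<in>ball 0 C. \<forall>x\<^sub>2\<in>ball 0 C. \<bar>V x\<^sub>1 - V x\<^sub>2\<bar> \<le> L * norm (x\<^sub>1 - x\<^sub>2))"

end

theory Submission
  imports Defs
begin

text \<open>Forward completeness implies bounded reachability: otherwise some point is explosive (arbitrarily
  large states are reachable from it in bounded time), and following almost escaping trajectories one finds
  explosive points on ever larger spheres. These are only approximately reachable, but solving backwards in time
  they become exactly reachable after arbitrarily small corrections of the initial value; the corrected
  initial values converge and the concatenated inputs make the limit trajectory unbounded in finite time.

  Bounds \<open>B n\<close> on the states reached from the ball of radius \<open>n\<close> within time \<open>n\<close> by inputs of norm at most
  \<open>n\<close> yield a slowly growing gain \<open>\<eta>\<close> for which the same bounds hold under \<open>\<eta>\<close>-dominated inputs. A discounted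
  supremum of \<open>1 + \<eta> (norm (\<psi> t))\<close> over all dominated trajectories \<open>\<psi>\<close> starting in \<open>x\<close> is then a locally
  Lipschitz Lyapunov function. Conversely, a Lyapunov function bounds every solution
  by a Dini derivative comparison, so that no solution blows up.\<close>

section \<open>Absolutely continuous functions\<close>

text \<open>Compactness is available for states but not, in a usable form, for inputs:
  \<open>f\<close> is not assumed affine or convex in the input, so a weak limit of inputs need not
  drive the limit of the trajectories. This is why explosiveness is a property of points, and why a
  near miss of an explosive point is repaired by moving the initial value while the input is kept.

  All trajectories are treated as solutions of integral equations, for which shift, concatenation
  and time reversal are simple; the Caratheodory definition is translated once.

  The gain has to meet opposite demands: small enough that dominated inputs cannot break the bounds
  \<open>B n\<close>, but of class \<open>class_K_inf\<close>, so that at large states it exceeds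
  any given input norm and bounds the Lyapunov function from below. Requiring
  \<open>\<eta> \<le> n\<close> up to \<open>B n\<close> makes the gain along dominated trajectories
  grow at most linearly in time and in the norm of the initial value, however fast \<open>B\<close>
  grows. A factor \<open>exp (- t)\<close> then suffices for a finite supremum, and its rate 1 is
  exactly the growth rate allowed in the Lie derivative condition.\<close>

lemma abs_continuous_on_imp_continuous_on:
  fixes \<xi> :: "real \<Rightarrow> 'a::real_normed_vector"
  assumes "abs_continuous_on {a..b} \<xi>"
  shows "continuous_on {a..b} \<xi>"
proof (clarsimp simp: continuous_on_iff)
  fix x e :: real
  assume x: "a \<le> x" "x \<le> b" and "0 < e"
  then obtain \<delta> where "\<delta> > 0" and \<delta>: "\<And>d t. \<lbrakk>d division_of t; t \<subseteq> {a..b}; (\<Sum>k\<in>d. Sup k - Inf k) < \<delta>\<rbrakk>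
      \<Longrightarrow> (\<Sum>k\<in>d. norm (\<xi> (Sup k) - \<xi> (Inf k))) < e"
    using assms unfolding abs_continuous_on_def by meson
  have *: "norm (\<xi> v - \<xi> u) < e" if "u \<le> v" "u \<in> {a..b}" "v \<in> {a..b}" "v - u < \<delta>" for u v
    using \<delta>[OF division_of_self[of u v]] that by auto
  show "\<exists>d>0. \<forall>x'\<in>{a..b}. dist x' x < d \<longrightarrow> dist (\<xi> x') (\<xi> x) < e"
  proof (intro exI conjI ballI impI)
    fix y assume y: "y \<in> {a..b}" "dist y x < \<delta>"
    show "dist (\<xi> y) (\<xi> x) < e"
    proof (cases "x \<le> y")
      case True
      then show ?thesis using *[of x y] x y by (simp add: dist_norm)
    next
      case False
      then show ?thesis using *[of y x] x y by (simp add: dist_norm norm_minus_commute)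
    qed
  qed (use \<open>\<delta> > 0\<close> in auto)
qed

lemma lipschitz_imp_abs_continuous_on:
  fixes \<xi> :: "real \<Rightarrow> 'a::real_normed_vector"
  assumes lip: "\<And>s t. \<lbrakk>a \<le> s; s \<le> t; t \<le> b\<rbrakk> \<Longrightarrow> norm (\<xi> t - \<xi> s) \<le> K * (t - s)"
  shows "abs_continuous_on {a..b} \<xi>"
  unfolding abs_continuous_on_def
proof (intro allI impI)
  fix \<epsilon> :: real assume "\<epsilon> > 0"
  define \<delta> where "\<delta> = \<epsilon> / (\<bar>K\<bar> + 1)"
  have "\<delta> > 0" using \<open>\<epsilon> > 0\<close> by (simp add: \<delta>_def)
  moreover have "(\<Sum>k\<in>d. norm (\<xi> (Sup k) - \<xi> (Inf k))) < \<epsilon>"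
    if d: "d division_of t" "t \<subseteq> {a..b}" "(\<Sum>k\<in>d. Sup k - Inf k) < \<delta>" for d t
  proof -
    have k: "norm (\<xi> (Sup k) - \<xi> (Inf k)) \<le> (\<bar>K\<bar> + 1) * (Sup k - Inf k)" if "k \<in> d" for k
    proof -
      obtain u v where uv: "k = cbox u v" "k \<noteq> {}" "k \<subseteq> t"
        using division_ofD(2-4)[OF d(1) \<open>k \<in> d\<close>] by metis
      then have "u \<le> v" "u \<in> k" "v \<in> k" by auto
      then have "u \<in> {a..b}" "v \<in> {a..b}" using uv d(2) by blast+
      then have "norm (\<xi> v - \<xi> u) \<le> K * (v - u)" using \<open>u \<le> v\<close> lip by auto
      also have "\<dots> \<le> (\<bar>K\<bar> + 1) * (v - u)" using \<open>u \<le> v\<close> by (intro mult_right_mono) auto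
      finally show ?thesis using \<open>u \<le> v\<close> uv by simp
    qed
    have "(\<Sum>k\<in>d. norm (\<xi> (Sup k) - \<xi> (Inf k))) \<le> (\<bar>K\<bar> + 1) * (\<Sum>k\<in>d. Sup k - Inf k)"
      unfolding sum_distrib_left by (intro sum_mono k)
    also have "\<dots> < (\<bar>K\<bar> + 1) * \<delta>" using d(3) by (intro mult_strict_left_mono) auto
    also have "\<dots> = \<epsilon>" by (simp add: \<delta>_def)
    finally show ?thesis .
  qed
  ultimately show "\<exists>\<delta>>0. \<forall>d t. d division_of t \<and> t \<subseteq> {a..b} \<and> (\<Sum>k\<in>d. Sup k - Inf k) < \<delta> \<longrightarrow>
      (\<Sum>k\<in>d. norm (\<xi> (Sup k) - \<xi> (Inf k))) < \<epsilon>"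
    by blast
qed

text \<open>A tag in the exceptional null set contributes nothing to the Riemann sum; the intervals carrying
  such tags lie in an open set of small measure, where absolute continuity controls the increments.\<close>

theorem fundamental_theorem_of_calculus_abs_continuous:
  fixes \<xi> :: "real \<Rightarrow> 'a::banach"
  assumes ac: "abs_continuous_on {a..b} \<xi>" and ab: "a \<le> b" and N: "negligible N"
    and der: "\<And>t. t \<in> {a..b} - N \<Longrightarrow> (\<xi> has_vector_derivative g t) (at t within {a..b})"
  shows "(g has_integral (\<xi> b - \<xi> a)) {a..b}"
proof -
  define g' where "g' t = (if t \<in> N then 0 else g t)" for t
  have "(g' has_integral (\<xi> b - \<xi> a)) {a..b}"
    unfolding has_integral_real
  proof (intro allI impI)
    fix e :: real assume e: "e > 0"
    \<comment> \<open>The summand 1 keeps the denominator positive when \<open>a = b\<close>. The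
      tags outside \<open>N\<close> receive the error budget \<open>e / 2\<close>, the tags in
      \<open>N\<close> the other half.\<close>
    define e' where "e' = e / (2 * (b - a + 1))"
    have e': "e' > 0" using e ab by (simp add: e'_def)
    obtain \<delta> where "\<delta> > 0" and \<delta>: "\<And>d t. \<lbrakk>d division_of t; t \<subseteq> {a..b}; (\<Sum>k\<in>d. Sup k - Inf k) < \<delta>\<rbrakk>
        \<Longrightarrow> (\<Sum>k\<in>d. norm (\<xi> (Sup k) - \<xi> (Inf k))) < e / 2"
      using ac e unfolding abs_continuous_on_def by (meson half_gt_zero)
    obtain T where T: "open T" "N \<subseteq> T" "T \<in> lmeasurable" "measure lebesgue T < \<delta>"
    proof -
      have N0: "N \<in> null_sets lebesgue" using N negligible_iff_null_sets by blast
      obtain T where T: "open T" "N \<subseteq> T" "T - N \<in> lmeasurable" "emeasure lebesgue (T - N) < ennreal \<delta>"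
        using sets_lebesgue_outer_open[of N \<delta>] N0 \<open>\<delta> > 0\<close> by blast
      have Ts: "T \<in> sets lebesgue" using T(1) by (simp add: borel_open)
      have eq: "emeasure lebesgue (T - N) = emeasure lebesgue T"
        using N0 Ts by (simp add: emeasure_Diff_null_set)
      then have lm: "T \<in> lmeasurable"
        using T(4) Ts by (auto simp: fmeasurable_def top.not_eq_extremum intro: order.strict_trans)
      have "measure lebesgue T < \<delta>"
        using T(4) eq lm \<open>\<delta> > 0\<close> by (simp add: emeasure_eq_measure2 ennreal_less_iff)
      with T lm that show ?thesis by blast
    qed
    have "\<forall>x. \<exists>d>0. x \<in> {a..b} - N \<longrightarrow>
         (\<forall>y\<in>{a..b}. norm (y-x) < d \<longrightarrow> norm (\<xi> y - \<xi> x - (y-x) *\<^sub>R g x) \<le> e' * norm (y-x))"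
      using der e' unfolding has_vector_derivative_def has_derivative_within_alt by (meson zero_less_one)
    then obtain d where d: "\<And>x. 0 < d x"
                 "\<And>x y. \<lbrakk>x \<in> {a..b} - N; y \<in> {a..b}; norm (y-x) < d x\<rbrakk>
                        \<Longrightarrow> norm (\<xi> y - \<xi> x - (y-x) *\<^sub>R g x) \<le> e' * norm (y-x)"
      by metis
    define \<gamma> where "\<gamma> x = (if x \<in> N then T else ball x (d x))" for x
    have gauge: "gauge \<gamma>"
      using T d(1) by (auto simp: gauge_def \<gamma>_def)
    have sums: "norm ((\<Sum>(x, K)\<in>p. measure lborel K *\<^sub>R g' x) - (\<xi> b - \<xi> a)) < e"
      if ptag: "p tagged_division_of {a..b}" and fine: "\<gamma> fine p" for p
    proof -
      have fin: "finite p" using ptag by (rule tagged_division_of_finite)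
      have ba: "b - a = (\<Sum>(x,K)\<in>p. Sup K - Inf K)" "\<xi> b - \<xi> a = (\<Sum>(x,K)\<in>p. \<xi>(Sup K) - \<xi>(Inf K))"
        using additive_tagged_division_1[where f= "\<lambda>x. x"] additive_tagged_division_1[where f= \<xi>]
              \<open>a \<le> b\<close> ptag by auto
      define q where "q = {z\<in>p. fst z \<in> N}"
      have q: "q \<subseteq> p" "finite q" using fin by (auto simp: q_def)
      have len: "Sup K - Inf K \<ge> 0" if "(x, K) \<in> p" for x K
        using tagged_division_ofD(2,4)[OF ptag that] by (auto simp: interval_bounds_real)
      have good: "norm (\<Sum>(x,K)\<in>p-q. measure lborel K *\<^sub>R g' x - (\<xi> (Sup K) - \<xi> (Inf K))) \<le> (\<Sum>(x,K)\<in>p-q. e' * (Sup K - Inf K))"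
      proof (rule sum_norm_le, safe)
        fix x K assume xK: "(x, K) \<in> p" "(x, K) \<notin> q"
        then obtain u v where k: "K = cbox u v" "x \<in> K" "K \<subseteq> {a..b}"
          using ptag by (meson tagged_division_ofD(2-4))
        have "x \<notin> N" using xK by (auto simp: q_def)
        then have x: "x \<in> {a..b} - N" "g' x = g x" using k by (auto simp: g'_def)
        have "u \<le> v" using k by auto
        have ball: "K \<subseteq> ball x (d x)" using fineD[OF fine xK(1)] \<open>x \<notin> N\<close> by (simp add: \<gamma>_def)
        have uv: "u \<in> K" "v \<in> K" using \<open>u \<le> v\<close> k by auto
        have "norm ((v - u) *\<^sub>R g x - (\<xi> v - \<xi> u)) = norm (\<xi> u - \<xi> x - (u - x) *\<^sub>R g x - (\<xi> v - \<xi> x - (v - x) *\<^sub>R g x))"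
          by (auto simp: algebra_simps)
        also have "\<dots> \<le> norm (\<xi> u - \<xi> x - (u - x) *\<^sub>R g x) + norm (\<xi> v - \<xi> x - (v - x) *\<^sub>R g x)"
          by (rule norm_triangle_ineq4)
        also have "\<dots> \<le> e' * norm (u - x) + e' * norm (v - x)"
          using uv ball k(3) x(1) by (intro add_mono d(2)) (auto simp: dist_norm norm_minus_commute subset_iff)
        also have "\<dots> \<le> e' * (v - u)" using k by (auto simp: algebra_simps)
        finally show "norm (measure lborel K *\<^sub>R g' x - (\<xi> (Sup K) - \<xi> (Inf K))) \<le> e' * (Sup K - Inf K)"
          using \<open>u \<le> v\<close> k x by simp
      qed
      also have "\<dots> \<le> (\<Sum>(x,K)\<in>p. e' * (Sup K - Inf K))"
        using len e' fin by (intro sum_mono2) auto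
      also have "\<dots> = e' * (b - a)" unfolding ba(1) by (simp add: sum_distrib_left split_def)
      also have "\<dots> \<le> e' * (b - a + 1)" using e' by simp
      also have "\<dots> = e / 2" using ab by (simp add: e'_def field_simps)
      finally have good': "norm (\<Sum>(x,K)\<in>p-q. measure lborel K *\<^sub>R g' x - (\<xi> (Sup K) - \<xi> (Inf K))) \<le> e / 2" .
      have qt: "q tagged_division_of (\<Union>(snd ` q))"
        using tagged_partial_division_of_Union_self tagged_partial_division_subset q(1) ptag
        by (metis tagged_division_of_def)
      have qd: "snd ` q division_of (\<Union>(snd ` q))" using division_of_tagged_division[OF qt] .
      have "(\<Sum>k\<in>snd ` q. norm (\<xi> (Sup k) - \<xi> (Inf k))) < e / 2"
      proof (rule \<delta>[OF qd])
        show "\<Union> (snd ` q) \<subseteq> {a..b}" using q(1) tagged_division_ofD(3)[OF ptag] by fastforce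
        have "(\<Sum>k\<in>snd ` q. Sup k - Inf k) = (\<Sum>k\<in>snd ` q. measure lebesgue k)"
        proof (rule sum.cong)
          fix k assume "k \<in> snd ` q"
          then obtain u v where "k = cbox u v" "k \<noteq> {}" using division_ofD(3,4)[OF qd] by metis
          then show "Sup k - Inf k = measure lebesgue k" by auto
        qed simp
        also have "\<dots> = measure lebesgue (\<Union>(snd ` q))"
          using content_division[OF qd] by simp
        also have "\<dots> \<le> measure lebesgue T"
        proof (rule measure_mono_fmeasurable)
          show "\<Union>(snd ` q) \<subseteq> T" using fine q(1) by (force simp: q_def fine_def \<gamma>_def)
          show "\<Union>(snd ` q) \<in> sets lebesgue" using lmeasurable_division[OF qd] by auto
        qed (use T in auto)
        finally show "(\<Sum>k\<in>snd ` q. Sup k - Inf k) < \<delta>" using T(4) by simp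
      qed
      moreover have "(\<Sum>(x,k)\<in>q. norm (\<xi> (Sup k) - \<xi> (Inf k))) = (\<Sum>k\<in>snd ` q. norm (\<xi> (Sup k) - \<xi> (Inf k)))"
      proof -
        \<comment> \<open>A degenerate interval can carry several tags. Passing from tagged pairs to
          intervals therefore needs a summand that vanishes on every interval with empty interior,
          including the empty set, where \<open>Sup\<close> and \<open>Inf\<close> have no useful
          value.\<close>
        define h where "h k = (if k = {} then 0 else norm (\<xi> (Sup k) - \<xi> (Inf k)))" for k
        have "(\<Sum>(x,k)\<in>q. h k) = (\<Sum>k\<in>snd ` q. h k)"
          by (rule sum.over_tagged_division_lemma[OF qt]) (auto simp: h_def interval_bounds_real)
        moreover have "(\<Sum>(x,k)\<in>q. h k) = (\<Sum>(x,k)\<in>q. norm (\<xi> (Sup k) - \<xi> (Inf k)))"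
          by (intro sum.cong) (auto simp: h_def dest!: tagged_division_ofD(2)[OF qt])
        moreover have "(\<Sum>k\<in>snd ` q. h k) = (\<Sum>k\<in>snd ` q. norm (\<xi> (Sup k) - \<xi> (Inf k)))"
          using division_ofD(3)[OF qd] by (intro sum.cong) (auto simp: h_def)
        ultimately show ?thesis by simp
      qed
      moreover have "norm (\<Sum>(x,K)\<in>q. measure lborel K *\<^sub>R g' x - (\<xi> (Sup K) - \<xi> (Inf K))) \<le> (\<Sum>(x,k)\<in>q. norm (\<xi> (Sup k) - \<xi> (Inf k)))"
        by (rule sum_norm_le) (auto simp: q_def g'_def norm_minus_commute)
      ultimately have bad: "norm (\<Sum>(x,K)\<in>q. measure lborel K *\<^sub>R g' x - (\<xi> (Sup K) - \<xi> (Inf K))) < e / 2" by simp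
      have "(\<Sum>(x, K)\<in>p. measure lborel K *\<^sub>R g' x) - (\<xi> b - \<xi> a) = (\<Sum>(x,K)\<in>p. measure lborel K *\<^sub>R g' x - (\<xi> (Sup K) - \<xi> (Inf K)))"
        by (simp add: ba(2) split_def sum_subtractf)
      also have "\<dots> = (\<Sum>(x,K)\<in>p-q. measure lborel K *\<^sub>R g' x - (\<xi> (Sup K) - \<xi> (Inf K))) + (\<Sum>(x,K)\<in>q. measure lborel K *\<^sub>R g' x - (\<xi> (Sup K) - \<xi> (Inf K)))"
        using q fin by (simp add: sum.subset_diff)
      finally have "norm ((\<Sum>(x, K)\<in>p. measure lborel K *\<^sub>R g' x) - (\<xi> b - \<xi> a))
        \<le> norm (\<Sum>(x,K)\<in>p-q. measure lborel K *\<^sub>R g' x - (\<xi> (Sup K) - \<xi> (Inf K)))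
          + norm (\<Sum>(x,K)\<in>q. measure lborel K *\<^sub>R g' x - (\<xi> (Sup K) - \<xi> (Inf K)))"
        by (rule ord_eq_le_trans[OF arg_cong[of _ _ norm] norm_triangle_ineq])
      then show ?thesis using good' bad by linarith
    qed
    show "\<exists>\<gamma>. gauge \<gamma> \<and> (\<forall>\<D>. \<D> tagged_division_of {a..b} \<and> \<gamma> fine \<D> \<longrightarrow>
        norm ((\<Sum>(x, k)\<in>\<D>. measure lborel k *\<^sub>R g' x) - (\<xi> b - \<xi> a)) < e)"
    proof (intro exI[of _ \<gamma>] conjI allI impI gauge)
      fix \<D> assume "\<D> tagged_division_of {a..b} \<and> \<gamma> fine \<D>"
      then show "norm ((\<Sum>(x, k)\<in>\<D>. measure lborel k *\<^sub>R g' x) - (\<xi> b - \<xi> a)) < e"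
        by (intro sums) simp_all
    qed
  qed
  then show ?thesis
    by (rule has_integral_spike[OF N, rotated]) (auto simp: g'_def)
qed

text \<open>Convergence of the averages over \<open>{x..x + r}\<close> is the right-hand derivative;
  the same theorem for the reflected function gives the left-hand one. Extending \<open>g\<close> by
  0 makes both applicable on the whole line, and outside the union of the two null sets the
  one-sided estimates combine.\<close>

lemma indefinite_integral_has_vector_derivative_AE:
  fixes g :: "real \<Rightarrow> 'a::euclidean_space"
  assumes g: "g integrable_on {a..b}"
  obtains N where "negligible N"
    "\<And>t. t \<in> {a..b} - N \<Longrightarrow> ((\<lambda>t. integral {a..t} g) has_vector_derivative g t) (at t within {a..b})"
proof -
  define h where "h t = (if t \<in> {a..b} then g t else 0)" for t
  have "h integrable_on UNIV" unfolding h_def using g integrable_restrict_UNIV[of "{a..b}" g] by simp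
  then have h: "h integrable_on cbox c d" for c d by (rule integrable_on_subcbox) auto
  have h': "(\<lambda>x. h (- x)) integrable_on cbox c d" for c d
    using h[of "-d" "-c"] integrable_reflect[of h "-c" "-d"] by simp
  obtain N1 where N1: "negligible N1" "\<And>x e. \<lbrakk>x \<notin> N1; 0 < e\<rbrakk> \<Longrightarrow>
      \<exists>d>0. \<forall>r. 0 < r \<and> r < d \<longrightarrow> norm (integral {x..x + r} h /\<^sub>R r - h x) < e"
  proof (rule integrable_ccontinuous_explicit[OF h])
    fix N assume "negligible N" "\<And>x e. \<lbrakk>x \<notin> N; 0 < e\<rbrakk> \<Longrightarrow> \<exists>d>0. \<forall>r. 0 < r \<and> r < d \<longrightarrow>
      norm (integral (cbox x (x + r *\<^sub>R One)) h /\<^sub>R r ^ DIM(real) - h x) < e"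
    then show ?thesis using that[of N] by simp
  qed
  obtain N2 where N2: "negligible N2" "\<And>x e. \<lbrakk>x \<notin> N2; 0 < e\<rbrakk> \<Longrightarrow>
      \<exists>d>0. \<forall>r. 0 < r \<and> r < d \<longrightarrow> norm (integral {x..x + r} (\<lambda>x. h (- x)) /\<^sub>R r - h (- x)) < e"
  proof (rule integrable_ccontinuous_explicit[OF h'])
    fix N assume "negligible N" "\<And>x e. \<lbrakk>x \<notin> N; 0 < e\<rbrakk> \<Longrightarrow> \<exists>d>0. \<forall>r. 0 < r \<and> r < d \<longrightarrow>
      norm (integral (cbox x (x + r *\<^sub>R One)) (\<lambda>x. h (- x)) /\<^sub>R r ^ DIM(real) - h (- x)) < e"
    then show ?thesis using that[of N] by simp
  qed
  define N where "N = N1 \<union> uminus ` N2"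
  have "negligible (uminus ` N2)"
    using N2(1) 
    by (intro negligible_differentiable_image_negligible) (auto intro!: derivative_intros simp: differentiable_on_def)
  then have "negligible N" using N1(1) by (simp add: N_def)
  moreover have "((\<lambda>t. integral {a..t} g) has_vector_derivative g t) (at t within {a..b})"
    if t: "t \<in> {a..b} - N" for t
    unfolding has_vector_derivative_def has_derivative_within_alt
  proof (intro conjI allI impI)
    fix e :: real assume e: "e > 0"
    have "t \<notin> N1" "- t \<notin> N2" using t imageI[of "- t" N2 uminus] by (auto simp: N_def)
    obtain d1 where d1: "d1 > 0" "\<And>r. \<lbrakk>0 < r; r < d1\<rbrakk> \<Longrightarrow> norm (integral {t..t + r} h /\<^sub>R r - h t) < e"
      using N1(2)[OF \<open>t \<notin> N1\<close> e] by blast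
    obtain d2 where d2: "d2 > 0" "\<And>r. \<lbrakk>0 < r; r < d2\<rbrakk> \<Longrightarrow> norm (integral {-t..-t + r} (\<lambda>x. h (- x)) /\<^sub>R r - h t) < e"
      using N2(2)[OF \<open>- t \<notin> N2\<close> e] by auto
    have scale: "norm (I - r *\<^sub>R v) \<le> e * r" if "norm (I /\<^sub>R r - v) < e" "r > 0" for I v :: 'a and r
    proof -
      have "I - r *\<^sub>R v = r *\<^sub>R (I /\<^sub>R r - v)" using that by (simp add: scaleR_diff_right)
      then have "norm (I - r *\<^sub>R v) = r * norm (I /\<^sub>R r - v)" using that by simp
      also have "\<dots> \<le> e * r" using that by (simp add: mult.commute)
      finally show ?thesis .
    qed
    have gh: "integral {c..d} g = integral {c..d} h" if "a \<le> c" "d \<le> b" for c d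
      by (rule integral_cong) (use that in \<open>auto simp: h_def\<close>)
    have ht: "h t = g t" using t by (simp add: h_def)
    have split: "integral {a..d} g - integral {a..c} g = integral {c..d} h" if "a \<le> c" "c \<le> d" "d \<le> b" for c d
    proof -
      have "g integrable_on {a..d}" using g that by (auto intro: integrable_on_subinterval)
      then have "integral {a..c} g + integral {c..d} g = integral {a..d} g"
        by (intro Henstock_Kurzweil_Integration.integral_combine that)
      then show ?thesis using gh[OF that(1,3)] by (metis add_diff_cancel_left')
    qed
    show "\<exists>d>0. \<forall>y\<in>{a..b}. norm (y - t) < d \<longrightarrow>
        norm (integral {a..y} g - integral {a..t} g - (y - t) *\<^sub>R g t) \<le> e * norm (y - t)"
    proof (intro exI conjI ballI impI)
      fix y assume y: "y \<in> {a..b}" "norm (y - t) < min d1 d2"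
      consider "y = t" | "y > t" | "y < t" by linarith
      then show "norm (integral {a..y} g - integral {a..t} g - (y - t) *\<^sub>R g t) \<le> e * norm (y - t)"
      proof cases
        case 2
        then show ?thesis using scale[OF d1(2)[of "y - t"]] y t split[of t y] by (simp add: ht)
      next
        case 3
        have "integral {-t..-y} (\<lambda>x. h (- x)) = integral {y..t} h" by simp
        then have "norm (integral {y..t} h - (t - y) *\<^sub>R g t) \<le> e * (t - y)"
          using scale[OF d2(2)[of "t - y"]] y 3 by (simp add: ht)
        moreover have "integral {a..y} g - integral {a..t} g - (y - t) *\<^sub>R g t = - (integral {y..t} h - (t - y) *\<^sub>R g t)"
          using split[of y t] 3 y t by (simp add: algebra_simps)
        ultimately show ?thesis using 3 by (simp only: norm_minus_cancel) simp
      qed simp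
    qed (use d1 d2 in auto)
  qed (simp add: bounded_linear_scaleR_left)
  ultimately show ?thesis using that by blast
qed

section \<open>Integral equations with Lipschitz right-hand side\<close>

text \<open>The initial value problem in integral form. It carries no derivative and no exceptional
  null set, and changing \<open>g\<close> on a null set of times preserves it.\<close>

definition solves :: "(real \<Rightarrow> 'a::euclidean_space \<Rightarrow> 'a) \<Rightarrow> 'a \<Rightarrow> real \<Rightarrow> (real \<Rightarrow> 'a) \<Rightarrow> bool" where
  "solves g x T \<xi> \<longleftrightarrow> continuous_on {0..T} \<xi> \<and>
     (\<forall>t\<in>{0..T}. ((\<lambda>s. g s (\<xi> s)) has_integral (\<xi> t - x)) {0..t})"

lemma solvesI:
  assumes "continuous_on {0..T} \<xi>"
    "\<And>t. \<lbrakk>0 \<le> t; t \<le> T\<rbrakk> \<Longrightarrow> ((\<lambda>s. g s (\<xi> s)) has_integral (\<xi> t - x)) {0..t}"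
  shows "solves g x T \<xi>"
  using assms by (auto simp: solves_def)

lemma solves_continuous_on: "solves g x T \<xi> \<Longrightarrow> continuous_on {0..T} \<xi>"
  by (simp add: solves_def)

lemma solves_initial: "solves g x T \<xi> \<Longrightarrow> 0 \<le> T \<Longrightarrow> \<xi> 0 = x"
proof -
  assume "solves g x T \<xi>" "0 \<le> T"
  then have "((\<lambda>s. g s (\<xi> s)) has_integral (\<xi> 0 - x)) {0..0}"
    unfolding solves_def by (metis atLeastAtMost_iff order_refl)
  then have "\<xi> 0 - x = 0" by (intro has_integral_unique[OF _ has_integral_refl(2)]) simp
  then show ?thesis by simp
qed

lemma solves_has_integral:
  assumes "solves g x T \<xi>" "0 \<le> a" "a \<le> b" "b \<le> T"
  shows "((\<lambda>s. g s (\<xi> s)) has_integral (\<xi> b - \<xi> a)) {a..b}"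
proof -
  have b: "((\<lambda>s. g s (\<xi> s)) has_integral (\<xi> b - x)) {0..b}"
    and a: "((\<lambda>s. g s (\<xi> s)) has_integral (\<xi> a - x)) {0..a}"
    using assms by (auto simp: solves_def)
  obtain J where J: "((\<lambda>s. g s (\<xi> s)) has_integral J) {a..b}"
    using b assms(2) by (metis atLeastatMost_subset_iff has_integral_integrable_integral
        integrable_on_subinterval order_refl)
  have "\<xi> a - x + J = \<xi> b - x"
    using has_integral_combine[OF assms(2,3) a J] b has_integral_unique by blast
  then have "J = \<xi> b - \<xi> a" by (simp add: algebra_simps)
  with J show ?thesis by simp
qed

lemma solves_subinterval: "solves g x T \<xi> \<Longrightarrow> T' \<le> T \<Longrightarrow> solves g x T' \<xi>"
  unfolding solves_def by (auto intro: continuous_on_subset)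

lemma solves_spike:
  assumes "solves g x T \<xi>" "negligible N"
    "\<And>t. \<lbrakk>0 \<le> t; t \<le> T; t \<notin> N\<rbrakk> \<Longrightarrow> g' t (\<xi> t) = g t (\<xi> t)"
  shows "solves g' x T \<xi>"
proof (rule solvesI)
  fix t assume t: "0 \<le> t" "t \<le> T"
  then have "((\<lambda>s. g s (\<xi> s)) has_integral (\<xi> t - x)) {0..t}" using assms(1) by (simp add: solves_def)
  then show "((\<lambda>s. g' s (\<xi> s)) has_integral (\<xi> t - x)) {0..t}"
    by (rule has_integral_spike[OF assms(2), rotated]) (use assms(3) t in auto)
qed (use assms(1) in \<open>rule solves_continuous_on\<close>)

lemma solves_cong:
  assumes "solves g x T \<xi>" "\<And>t. \<lbrakk>0 \<le> t; t \<le> T\<rbrakk> \<Longrightarrow> \<zeta> t = \<xi> t"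
    "\<And>t. \<lbrakk>0 \<le> t; t \<le> T\<rbrakk> \<Longrightarrow> g' t (\<xi> t) = g t (\<xi> t)"
  shows "solves g' x T \<zeta>"
proof (rule solvesI)
  show "continuous_on {0..T} \<zeta>"
    using solves_continuous_on[OF assms(1)] continuous_on_cong[of "{0..T}" "{0..T}" \<zeta> \<xi>] assms(2) by simp
  fix t assume t: "0 \<le> t" "t \<le> T"
  then have "((\<lambda>s. g s (\<xi> s)) has_integral (\<xi> t - x)) {0..t}" using assms(1) by (simp add: solves_def)
  then show "((\<lambda>s. g' s (\<zeta> s)) has_integral (\<zeta> t - x)) {0..t}"
    unfolding assms(2)[OF t] by (rule has_integral_eq[rotated]) (use assms(2,3) t in auto)
qed

lemma solves_shift:
  assumes "solves g x T \<xi>" "0 \<le> s" "s \<le> T"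
  shows "solves (\<lambda>t. g (s + t)) (\<xi> s) (T - s) (\<lambda>t. \<xi> (s + t))"
proof (rule solvesI)
  show "continuous_on {0..T - s} (\<lambda>t. \<xi> (s + t))"
    by (rule continuous_on_compose2[OF solves_continuous_on[OF assms(1)]])
      (use assms in \<open>auto intro!: continuous_intros\<close>)
  fix t assume t: "0 \<le> t" "t \<le> T - s"
  then have "((\<lambda>r. g r (\<xi> r)) has_integral (\<xi> (s + t) - \<xi> s)) {0 + s..t + s}"
    using solves_has_integral[OF assms(1,2), of "s + t"] by (simp add: add.commute)
  then show "((\<lambda>r. g (s + r) (\<xi> (s + r))) has_integral (\<xi> (s + t) - \<xi> s)) {0..t}"
    by (subst (asm) has_integral_shift_Icc_real[symmetric]) (simp add: o_def)
qed

lemma solves_concat: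
  assumes \<xi>: "solves g x S \<xi>" and \<zeta>: "solves h (\<xi> S) T \<zeta>" and S: "0 \<le> S" and T: "0 \<le> T"
  shows "solves (\<lambda>t. if t < S then g t else h (t - S)) x (S + T) (\<lambda>t. if t \<le> S then \<xi> t else \<zeta> (t - S))"
    (is "solves ?g x _ ?\<xi>")
proof (rule solvesI)
  have \<zeta>0: "\<zeta> 0 = \<xi> S" using solves_initial[OF \<zeta> T] .
  have "continuous_on ({0..S} \<union> {S..S+T}) ?\<xi>"
  proof (rule continuous_on_If)
    show "continuous_on {S..S+T} (\<lambda>t. \<zeta> (t - S))"
      by (rule continuous_on_compose2[OF solves_continuous_on[OF \<zeta>]]) (auto intro!: continuous_intros)
  qed (use solves_continuous_on[OF \<xi>] \<zeta>0 in auto)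
  moreover have "{0..S+T} = {0..S} \<union> {S..S+T}" using S T by auto
  ultimately show "continuous_on {0..S+T} ?\<xi>" by simp
  fix t assume t: "0 \<le> t" "t \<le> S + T"
  \<comment> \<open>The field switches with \<open>t < S\<close> but the state with
    \<open>t \<le> S\<close>. The mismatch is confined to the point \<open>S\<close>, a null set for
    the integral.\<close>
  have first: "((\<lambda>s. ?g s (?\<xi> s)) has_integral (\<xi> r - x)) {0..r}" if "0 \<le> r" "r \<le> S" for r
    by (rule has_integral_spike[of "{S}" _ _ "\<lambda>s. g s (\<xi> s)"])
      (use \<xi> that in \<open>auto simp: solves_def\<close>)
  show "((\<lambda>s. ?g s (?\<xi> s)) has_integral (?\<xi> t - x)) {0..t}"
  proof (cases "t \<le> S")
    case True
    with first[of t] t show ?thesis by simp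
  next
    case False
    have "((\<lambda>s. h s (\<zeta> s)) has_integral (\<zeta> (t - S) - \<xi> S)) {0..t - S}"
      using \<zeta> t False by (simp add: solves_def)
    then have "((\<lambda>s. h (s - S) (\<zeta> (s - S))) has_integral (\<zeta> (t - S) - \<xi> S)) {S..t}"
      using has_integral_shift_Icc_real[of "\<lambda>s. h (s - S) (\<zeta> (s - S))" S _ 0 "t - S"] by (simp add: o_def)
    then have "((\<lambda>s. ?g s (?\<xi> s)) has_integral (\<zeta> (t - S) - \<xi> S)) {S..t}"
      by (rule has_integral_spike[of "{S}", rotated 2]) auto
    then have "((\<lambda>s. ?g s (?\<xi> s)) has_integral ((\<xi> S - x) + (\<zeta> (t - S) - \<xi> S))) {0..t}"
      using False S by (intro has_integral_combine[OF _ _ first]) auto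
    then show ?thesis using False by (simp add: algebra_simps)
  qed
qed

text \<open>Turns a prescribed final value into an initial value; backward existence and the
  backward error bound are the forward results for the reversed field.\<close>

lemma solves_reverse:
  assumes "solves g x T \<xi>" "0 \<le> T"
  shows "solves (\<lambda>t z. - g (T - t) z) (\<xi> T) T (\<lambda>t. \<xi> (T - t))"
proof (rule solvesI)
  show "continuous_on {0..T} (\<lambda>t. \<xi> (T - t))"
    by (rule continuous_on_compose2[OF solves_continuous_on[OF assms(1)]])
      (use assms in \<open>auto intro!: continuous_intros\<close>)
  fix t assume t: "0 \<le> t" "t \<le> T"
  then have "((\<lambda>r. g r (\<xi> r)) has_integral (\<xi> T - \<xi> (T - t))) {T - t..T}"
    using solves_has_integral[OF assms(1), of "T - t" T] by simp
  then have "((\<lambda>r. g (- r) (\<xi> (- r))) has_integral (\<xi> T - \<xi> (T - t))) {- T..- (T - t)}"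
    by (subst has_integral_reflect_real)
  then have "((\<lambda>r. g (- (r - T)) (\<xi> (- (r - T)))) has_integral (\<xi> T - \<xi> (T - t))) {0..t}"
    using has_integral_shift_Icc_real[of "\<lambda>r. g (- (r - T)) (\<xi> (- (r - T)))" T _ "- T" "- (T - t)"] by (simp add: o_def)
  from has_integral_neg[OF this]
  show "((\<lambda>r. - g (T - r) (\<xi> (T - r))) has_integral (\<xi> (T - t) - \<xi> T)) {0..t}" by simp
qed

section \<open>Gronwall estimates and global existence for globally Lipschitz fields\<close>

lemma gronwall_integral_inequality:
  fixes \<phi> :: "real \<Rightarrow> real"
  assumes cont: "continuous_on {0..T} \<phi>" and L: "0 \<le> L"
    and bound: "\<And>t. \<lbrakk>0 \<le> t; t \<le> T\<rbrakk> \<Longrightarrow> \<phi> t \<le> a + L * integral {0..t} \<phi>"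
    and t: "0 \<le> t" "t \<le> T"
  shows "\<phi> t \<le> a * exp (L * t)"
proof -
  \<comment> \<open>The right-hand side \<open>y\<close> is differentiable even though
    \<open>\<phi>\<close> need not be, and \<open>y' = L * \<phi> \<le> L * y\<close>. Hence
    \<open>w\<close>, which is \<open>y\<close> divided by \<open>exp (L * t)\<close>, does not
    increase.\<close>
  define y where "y t = a + L * integral {0..t} \<phi>" for t
  define w where "w t = y t * exp (- (L * t))" for t
  have cy: "continuous_on {0..T} y"
    unfolding y_def by (intro continuous_intros indefinite_integral_continuous_1 integrable_continuous_real cont)
  have "w t \<le> w 0"
  proof (rule DERIV_nonpos_imp_decreasing_open[OF t(1)])
    show "continuous_on {0..t} w"
      unfolding w_def by (intro continuous_intros continuous_on_subset[OF cy]) (use t in auto)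
    fix s assume s: "0 < s" "s < t"
    have "((\<lambda>t. integral {0..t} \<phi>) has_real_derivative \<phi> s) (at s within {0..T})"
      using s t by (intro integral_has_real_derivative cont) auto
    then have "((\<lambda>t. integral {0..t} \<phi>) has_real_derivative \<phi> s) (at s)"
      using s t by (simp add: at_within_Icc_at)
    then have "(w has_real_derivative (L * \<phi> s - L * y s) * exp (- (L * s))) (at s)"
      unfolding w_def y_def by (auto intro!: derivative_eq_intros simp: algebra_simps)
    moreover have "L * \<phi> s \<le> L * y s" using bound[of s] s t L by (auto simp: y_def intro: mult_left_mono)
    ultimately show "\<exists>z. DERIV w s :> z \<and> z \<le> 0"
      by (intro exI[of _ "(L * \<phi> s - L * y s) * exp (- (L * s))"]) (simp add: mult_le_0_iff)
  qed
  then have "y t \<le> a * exp (L * t)" by (simp add: w_def y_def exp_minus field_simps)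
  with bound[OF t] show ?thesis by (simp add: y_def)
qed

text \<open>Regularity in time is demanded only as integrability along continuous curves, which is
  exactly what a Picard iteration evaluates. Merely measurable inputs are thereby covered.\<close>

locale lipschitz_field =
  fixes g :: "real \<Rightarrow> 'a::euclidean_space \<Rightarrow> 'a" and L :: real
  assumes L_nonneg: "0 \<le> L"
    and lipschitz: "norm (g t x - g t y) \<le> L * norm (x - y)"
    and integrable: "continuous_on {a..b} \<xi> \<Longrightarrow> (\<lambda>s. g s (\<xi> s)) integrable_on {a..b}"
begin

lemma solves_gronwall:
  assumes \<xi>: "solves g x T \<xi>" and \<zeta>: "solves g y T \<zeta>" and t: "0 \<le> t" "t \<le> T"
  shows "norm (\<xi> t - \<zeta> t) \<le> norm (x - y) * exp (L * t)"
proof (rule gronwall_integral_inequality[of T "\<lambda>t. norm (\<xi> t - \<zeta> t)"])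
  show c: "continuous_on {0..T} (\<lambda>t. norm (\<xi> t - \<zeta> t))"
    using \<xi> \<zeta> by (auto intro!: continuous_intros dest: solves_continuous_on)
  fix t assume t: "0 \<le> t" "t \<le> T"
  have i: "((\<lambda>s. g s (\<xi> s) - g s (\<zeta> s)) has_integral ((\<xi> t - x) - (\<zeta> t - y))) {0..t}"
    using \<xi> \<zeta> t by (auto simp: solves_def intro!: has_integral_diff)
  have n: "(\<lambda>s. L * norm (\<xi> s - \<zeta> s)) integrable_on {0..t}"
    using t by (intro integrable_continuous_real continuous_intros continuous_on_subset[OF c]) auto
  have "norm ((\<xi> t - x) - (\<zeta> t - y)) \<le> integral {0..t} (\<lambda>s. L * norm (\<xi> s - \<zeta> s))"
    using Henstock_Kurzweil_Integration.integral_norm_bound_integral[OF has_integral_integrable[OF i] n lipschitz]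
    by (simp add: integral_unique[OF i])
  moreover have "norm (\<xi> t - \<zeta> t) \<le> norm (x - y) + norm ((\<xi> t - x) - (\<zeta> t - y))"
    using norm_triangle_ineq[of "x - y" "(\<xi> t - x) - (\<zeta> t - y)"] by simp
  ultimately show "norm (\<xi> t - \<zeta> t) \<le> norm (x - y) + L * integral {0..t} (\<lambda>t. norm (\<xi> t - \<zeta> t))"
    by simp
qed (use t L_nonneg in auto)

lemma solves_unique:
  assumes "solves g x T \<xi>" "solves g x T \<zeta>" "0 \<le> t" "t \<le> T"
  shows "\<xi> t = \<zeta> t"
  using solves_gronwall[OF assms] by simp

text \<open>Weighting the uniform norm on \<open>{0..T}\<close> by \<open>exp (- (2 * L * t))\<close> makes the Picard operator a
  contraction on the whole interval, hence the substitution \<open>\<xi> t = exp (2 * L * t) * z t\<close>. Functions on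
  \<open>{0..T}\<close> are extended to all reals as constants outside.\<close>

lemma solves_exists:
  assumes T: "0 \<le> T"
  obtains \<xi> where "solves g x T \<xi>"
proof -
  define c where "c t = max 0 (min T t)" for t
  define E where "E t = exp (2 * L * c t)" for t
  have c: "c t \<in> {0..T}" "t \<in> {0..T} \<Longrightarrow> c t = t" "continuous_on A c" for t A
    using T by (auto simp: c_def[abs_def] intro!: continuous_intros)
  have E: "E t > 0" "continuous_on A E" for t A
    unfolding E_def by (auto intro!: continuous_intros c)
  define P where "P z t = (x + integral {0..c t} (\<lambda>s. g s (E s *\<^sub>R z s))) /\<^sub>R E t" for z t
  have int: "(\<lambda>s. g s (E s *\<^sub>R apply_bcontfun z s)) integrable_on {0..t}" for z t
    by (intro integrable continuous_on_scaleR E continuous_on_apply_bcontfun continuous_on_id)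
  have P: "P (apply_bcontfun z) \<in> bcontfun" for z
  proof -
    define p where "p t = (x + integral {0..t} (\<lambda>s. g s (E s *\<^sub>R apply_bcontfun z s))) /\<^sub>R E t" for t
    have cp: "continuous_on {0..T} p"
      unfolding p_def by (intro continuous_intros indefinite_integral_continuous_1 int E) (use E in \<open>auto simp: less_imp_neq[symmetric]\<close>)
    have "P (apply_bcontfun z) = p \<circ> c"
      using c by (auto simp: P_def p_def E_def fun_eq_iff)
    moreover have "continuous_on UNIV (p \<circ> c)"
      by (rule continuous_on_compose[OF c(3)]) (rule continuous_on_subset[OF cp], use c in auto)
    moreover have "bounded (range (p \<circ> c))"
      by (rule bounded_subset[OF compact_imp_bounded[OF compact_continuous_image[OF cp compact_Icc]]]) (use c in auto)
    ultimately show ?thesis by (simp add: bcontfun_def)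
  qed
  define F where "F z = Bcontfun (P (apply_bcontfun z))" for z
  have F: "apply_bcontfun (F z) = P (apply_bcontfun z)" for z
    unfolding F_def by (rule Bcontfun_inverse[OF P])
  have "dist (F z) (F w) \<le> 1 / 2 * dist z w" for z w
  proof (rule dist_bound)
    fix t
    define d where "d = dist z w"
    have d: "norm (apply_bcontfun z s - apply_bcontfun w s) \<le> d" "0 \<le> d" for s
      using dist_bounded[of z s w] by (auto simp: d_def dist_norm)
    \<comment> \<open>The weight integrates against \<open>L\<close> to less than
      \<open>E t / 2\<close>; dividing by \<open>E t\<close> leaves the contraction factor 1/2,
      whatever the length of the interval.\<close>
    have ex: "((\<lambda>s. L * exp (2 * L * s) * d) has_integral (exp (2 * L * c t) - 1) / 2 * d) {0..c t}"
    proof -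
      have "((\<lambda>s. L * exp (2 * L * s) * d) has_integral (exp (2 * L * c t) / 2 * d - exp (2 * L * 0) / 2 * d)) {0..c t}"
        by (rule fundamental_theorem_of_calculus)
          (use c(1)[of t] in \<open>auto intro!: derivative_eq_intros simp: has_real_derivative_iff_has_vector_derivative[symmetric]\<close>)
      then show ?thesis by (simp add: algebra_simps diff_divide_distrib)
    qed
    let ?D = "\<lambda>s. g s (E s *\<^sub>R apply_bcontfun z s) - g s (E s *\<^sub>R apply_bcontfun w s)"
    have "norm (integral {0..c t} ?D) \<le> integral {0..c t} (\<lambda>s. L * exp (2 * L * s) * d)"
    proof (rule Henstock_Kurzweil_Integration.integral_norm_bound_integral)
      fix s assume s: "s \<in> {0..c t}"
      then have "c s = s" using c(1)[of t] c(2)[of s] by auto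
      have "norm (?D s) \<le> L * norm (E s *\<^sub>R apply_bcontfun z s - E s *\<^sub>R apply_bcontfun w s)" by (rule lipschitz)
      also have "\<dots> = L * (E s * norm (apply_bcontfun z s - apply_bcontfun w s))"
        using E(1)[of s] by (simp add: scaleR_diff_right[symmetric])
      also have "\<dots> \<le> L * (E s * d)" using d L_nonneg E(1)[of s] by (intro mult_left_mono) auto
      finally show "norm (?D s) \<le> L * exp (2 * L * s) * d" by (simp add: E_def \<open>c s = s\<close> mult.assoc)
    qed (use ex int in \<open>auto intro: integrable_diff\<close>)
    also have "\<dots> = (exp (2 * L * c t) - 1) / 2 * d" using ex by (rule integral_unique)
    also have "\<dots> \<le> E t / 2 * d" using d(2) by (intro mult_right_mono) (auto simp: E_def)
    finally have *: "norm (integral {0..c t} ?D) \<le> E t / 2 * d" .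
    have "P (apply_bcontfun z) t - P (apply_bcontfun w) t = integral {0..c t} ?D /\<^sub>R E t"
      unfolding P_def by (subst Henstock_Kurzweil_Integration.integral_diff[OF int int])
        (simp add: algebra_simps)
    then have "norm (P (apply_bcontfun z) t - P (apply_bcontfun w) t) = norm (integral {0..c t} ?D) / E t"
      using E(1)[of t] by (simp add: divide_inverse mult.commute)
    also have "\<dots> \<le> 1 / 2 * d" using * E(1)[of t] by (simp add: field_simps)
    finally show "dist (apply_bcontfun (F z) t) (apply_bcontfun (F w) t) \<le> 1 / 2 * dist z w"
      by (simp add: F dist_norm d_def)
  qed
  then obtain z where z: "F z = z"
    using banach_fix_type[of "1/2" F] by auto
  define \<xi> where "\<xi> t = E t *\<^sub>R apply_bcontfun z t" for t
  have fixpoint: "\<xi> t = x + integral {0..c t} (\<lambda>s. g s (\<xi> s))" for t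
  proof -
    have "apply_bcontfun z t = P (apply_bcontfun z) t" using F[of z] z by simp
    then have "E t *\<^sub>R apply_bcontfun z t = x + integral {0..c t} (\<lambda>s. g s (E s *\<^sub>R apply_bcontfun z s))"
      using E(1)[of t] by (simp only: P_def) simp
    then show ?thesis unfolding \<xi>_def .
  qed
  have eq: "\<xi> t = x + integral {0..t} (\<lambda>s. g s (\<xi> s))" if "t \<in> {0..T}" for t
    using fixpoint[of t] unfolding c(2)[OF that] .
  have int': "(\<lambda>s. g s (\<xi> s)) integrable_on {0..t}" for t
    unfolding \<xi>_def by (rule int)
  have "solves g x T \<xi>"
  proof (rule solvesI)
    show "continuous_on {0..T} \<xi>"
      unfolding \<xi>_def by (intro continuous_on_scaleR E continuous_on_apply_bcontfun continuous_on_id)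
    fix t assume "0 \<le> t" "t \<le> T"
    then have "integral {0..t} (\<lambda>s. g s (\<xi> s)) = \<xi> t - x" using eq[of t] by simp
    with int' show "((\<lambda>s. g s (\<xi> s)) has_integral (\<xi> t - x)) {0..t}"
      by (metis integrable_integral)
  qed
  then show ?thesis using that by blast
qed

lemma reverse: "lipschitz_field (\<lambda>t z. - g (T - t) z) L"
proof
  show "norm (- g (T - t) x - - g (T - t) y) \<le> L * norm (x - y)" for t x y
    using lipschitz[of "T - t" x y] by (simp add: norm_minus_commute)
  fix a b and \<xi> :: "real \<Rightarrow> 'a" assume "continuous_on {a..b} \<xi>"
  then have "continuous_on {T - b..T - a} (\<lambda>s. \<xi> (T - s))"
    by (rule continuous_on_compose2) (auto intro!: continuous_intros)
  then have "(\<lambda>s. g s (\<xi> (T - s))) integrable_on {T - b..T - a}" by (rule integrable)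
  then have "(\<lambda>s. g (- s) (\<xi> (T - - s))) integrable_on {- (T - a)..- (T - b)}"
    by (subst Henstock_Kurzweil_Integration.integrable_reflect_real)
  then have "((\<lambda>s. g (- (s - T)) (\<xi> (T - - (s - T)))) \<circ> (+) T) integrable_on {a - T..b - T}"
    by (simp add: o_def)
  then have "(\<lambda>s. g (- (s - T)) (\<xi> (T - - (s - T)))) integrable_on {a - T + T..b - T + T}"
    by (subst (asm) integrable_on_shift_Icc_real)
  then have "(\<lambda>s. g (T - s) (\<xi> s)) integrable_on {a..b}" by simp
  then show "(\<lambda>s. - g (T - s) (\<xi> s)) integrable_on {a..b}" by (rule integrable_neg)
qed (rule L_nonneg)

lemma solves_gronwall_backward:
  assumes \<xi>: "solves g x T \<xi>" and \<zeta>: "solves g y T \<zeta>" and t: "0 \<le> t" "t \<le> T"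
  shows "norm (\<xi> t - \<zeta> t) \<le> norm (\<xi> T - \<zeta> T) * exp (L * (T - t))"
  using lipschitz_field.solves_gronwall[OF reverse solves_reverse[OF \<xi>] solves_reverse[OF \<zeta>], of "T - t"] t
  by simp

lemma solves_exists_backward:
  assumes T: "0 \<le> T"
  obtains \<xi> where "solves g (\<xi> 0) T \<xi>" "\<xi> T = y"
proof -
  obtain \<zeta> where \<zeta>: "solves (\<lambda>t z. - g (T - t) z) y T \<zeta>"
    using lipschitz_field.solves_exists[OF reverse T] by blast
  have "solves g (\<zeta> T) T (\<lambda>t. \<zeta> (T - t))"
    using solves_reverse[OF \<zeta> T] by simp
  then show ?thesis using that[of "\<lambda>t. \<zeta> (T - t)"] solves_initial[OF \<zeta> T] by simp
qed

end

section \<open>Trajectories of a locally Lipschitz control system\<close>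

definition lipschitz_on_balls :: "('x::euclidean_space \<Rightarrow> 'u::euclidean_space \<Rightarrow> 'x) \<Rightarrow> bool" where
  "lipschitz_on_balls f \<longleftrightarrow> (\<forall>C>0. \<exists>L>0. \<forall>x\<^sub>1\<in>ball 0 C. \<forall>x\<^sub>2\<in>ball 0 C. \<forall>u\<^sub>1\<in>ball 0 C. \<forall>u\<^sub>2\<in>ball 0 C.
     norm (f x\<^sub>1 u\<^sub>1 - f x\<^sub>2 u\<^sub>2) \<le> L * (norm (x\<^sub>1 - x\<^sub>2) + norm (u\<^sub>1 - u\<^sub>2)))"

text \<open>The bound holds at every time and measurability on the whole line, so shifts and
  concatenations stay in the class without bookkeeping of null sets. Every essentially bounded input
  agrees almost everywhere on the half-line with such an input.\<close>

definition bounded_input :: "real \<Rightarrow> (real \<Rightarrow> 'u::euclidean_space) \<Rightarrow> bool" where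
  "bounded_input M u \<longleftrightarrow> u \<in> borel_measurable lebesgue \<and> (\<forall>t. norm (u t) \<le> M)"

abbreviation trajectory ::
  "('x::euclidean_space \<Rightarrow> 'u::euclidean_space \<Rightarrow> 'x) \<Rightarrow> (real \<Rightarrow> 'u) \<Rightarrow> 'x \<Rightarrow> real \<Rightarrow> (real \<Rightarrow> 'x) \<Rightarrow> bool" where
  "trajectory f u \<equiv> solves (\<lambda>t y. f y (u t))"

text \<open>Projecting the state to a ball makes a locally Lipschitz field globally Lipschitz in the
  state and leaves it unchanged inside the ball.\<close>

definition cutoff :: "real \<Rightarrow> ('x::euclidean_space \<Rightarrow> 'u::euclidean_space \<Rightarrow> 'x) \<Rightarrow> 'x \<Rightarrow> 'u \<Rightarrow> 'x" where
  "cutoff R f x u = f (closest_point (cball 0 R) x) u"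

lemma bounded_inputD: "bounded_input M u \<Longrightarrow> norm (u t) \<le> M"
  by (simp add: bounded_input_def)

lemma bounded_input_nonneg: "bounded_input M u \<Longrightarrow> 0 \<le> M"
  using norm_ge_zero order_trans unfolding bounded_input_def by blast

lemma bounded_input_shift:
  assumes "bounded_input M u"
  shows "bounded_input M (\<lambda>t. u (s + t))"
proof -
  have "(\<lambda>t. s + t) \<in> lebesgue \<rightarrow>\<^sub>M lebesgue"
    using lebesgue_affine_measurable[where c = "\<lambda>_::real. 1" and t = s] by simp
  from measurable_compose[OF this, of u borel] show ?thesis
    using assms by (simp add: bounded_input_def)
qed

lemma bounded_input_concat:
  assumes "bounded_input M u" "bounded_input M v"
  shows "bounded_input M (\<lambda>t. if t < S then u t else v (t - S))"
proof -
  have "(\<lambda>t. v (t - S)) \<in> borel_measurable lebesgue"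
    using bounded_input_shift[OF assms(2), of "- S"] by (simp add: bounded_input_def)
  then show ?thesis
    using assms by (auto simp: bounded_input_def intro!: measurable_If)
qed

lemma continuous_on_lipschitz_on_balls:
  assumes "lipschitz_on_balls f"
  shows "continuous_on UNIV (\<lambda>(x, u). f x u)"
proof (clarsimp simp: continuous_on_eq_continuous_at)
  fix x :: 'a and u :: 'b
  define C where "C = norm x + norm u + 1"
  have C: "C > 0" by (simp add: C_def add_nonneg_pos)
  then obtain L where L: "\<forall>x\<^sub>1\<in>ball 0 C. \<forall>x\<^sub>2\<in>ball 0 C. \<forall>u\<^sub>1\<in>ball 0 C. \<forall>u\<^sub>2\<in>ball 0 C.
     norm (f x\<^sub>1 u\<^sub>1 - f x\<^sub>2 u\<^sub>2) \<le> L * (norm (x\<^sub>1 - x\<^sub>2) + norm (u\<^sub>1 - u\<^sub>2))"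
    using assms unfolding lipschitz_on_balls_def by blast
  have xu: "x \<in> ball 0 C" "u \<in> ball 0 C"
    by (auto simp: C_def add_strict_increasing2 add_nonneg_pos add.commute add_strict_increasing)
  have "((\<lambda>p. (\<lambda>(x, u). f x u) p - f x u) \<longlongrightarrow> 0) (at (x, u))"
  proof (rule Lim_null_comparison)
    have "\<forall>\<^sub>F p in at (x, u). p \<in> ball 0 C \<times> ball 0 C"
      by (rule eventually_at_in_open') (use xu in \<open>auto intro: open_Times\<close>)
    then show "\<forall>\<^sub>F p in at (x, u). norm ((\<lambda>(x, u). f x u) p - f x u) \<le> L * (norm (fst p - x) + norm (snd p - u))"
      by eventually_elim (use L xu in auto)
    have "((\<lambda>p. L * (norm (fst p - x) + norm (snd p - u))) \<longlongrightarrow> L * (norm (fst (x, u) - x) + norm (snd (x, u) - u))) (at (x, u))"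
      by (intro tendsto_intros)
    then show "((\<lambda>p. L * (norm (fst p - x) + norm (snd p - u))) \<longlongrightarrow> 0) (at (x, u))" by simp
  qed
  then show "isCont (\<lambda>(x, u). f x u) (x, u)"
    using LIM_zero_iff by (auto simp: isCont_def)
qed

lemma cutoff_eq: "norm x \<le> R \<Longrightarrow> cutoff R f x u = f x u"
  by (simp add: cutoff_def closest_point_self)

text \<open>The projection is 1-Lipschitz and its values have norm at most \<open>R\<close>, so the
  Lipschitz constant of \<open>f\<close> on a slightly larger open ball serves all inputs bounded by
  \<open>M\<close> at once. Comparison with \<open>f 0 0\<close> bounds the measurable integrand,
  hence it is integrable.\<close>

lemma cutoff_lipschitz_field:
  assumes f: "lipschitz_on_balls f" and R: "0 \<le> R"
  obtains L where "\<And>u. bounded_input M u \<Longrightarrow> lipschitz_field (\<lambda>t x. cutoff R f x (u t)) L"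
proof -
  define C where "C = R + \<bar>M\<bar> + 1"
  have C: "C > 0" using R by (simp add: C_def)
  then obtain L where L: "L > 0" "\<And>x\<^sub>1 x\<^sub>2 u\<^sub>1 u\<^sub>2. \<lbrakk>norm x\<^sub>1 < C; norm x\<^sub>2 < C; norm u\<^sub>1 < C; norm u\<^sub>2 < C\<rbrakk> \<Longrightarrow>
     norm (f x\<^sub>1 u\<^sub>1 - f x\<^sub>2 u\<^sub>2) \<le> L * (norm (x\<^sub>1 - x\<^sub>2) + norm (u\<^sub>1 - u\<^sub>2))"
    using f unfolding lipschitz_on_balls_def by (metis mem_ball_0)
  let ?p = "closest_point (cball (0::'a) R)"
  have p: "norm (?p x) \<le> R" for x
    using closest_point_in_set[of "cball (0::'a) R" x] R by simp
  then have pC: "norm (?p x) < C" for x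
    using le_less_trans[OF p, of C x] by (simp add: C_def)
  have "lipschitz_field (\<lambda>t x. cutoff R f x (u t)) L" if u: "bounded_input M u" for u
  proof
    have uC: "norm (u t) < C" for t
      using bounded_inputD[OF u, of t] R by (simp add: C_def)
    show "0 \<le> L" using L by simp
    show "norm (cutoff R f x (u t) - cutoff R f y (u t)) \<le> L * norm (x - y)" for t x y
    proof -
      have "norm (cutoff R f x (u t) - cutoff R f y (u t)) \<le> L * (norm (?p x - ?p y) + norm (u t - u t))"
        unfolding cutoff_def by (intro L(2) pC uC)
      also have "\<dots> \<le> L * norm (x - y)"
        using closest_point_lipschitz[of "cball (0::'a) R" x y] R L(1) by (simp add: dist_norm)
      finally show ?thesis .
    qed
    fix a b and \<xi> :: "real \<Rightarrow> 'a" assume \<xi>: "continuous_on {a..b} \<xi>"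
    have "continuous_on {a..b} (\<lambda>s. ?p (\<xi> s))"
      using R by (intro continuous_on_compose2[OF continuous_on_closest_point \<xi>]) auto
    then have "(\<lambda>s. ?p (\<xi> s)) \<in> borel_measurable (lebesgue_on {a..b})"
      by (intro continuous_imp_measurable_on_sets_lebesgue) auto
    moreover have "u \<in> borel_measurable (lebesgue_on {a..b})"
      using u by (auto simp: bounded_input_def intro: measurable_restrict_space1)
    ultimately have "(\<lambda>s. (?p (\<xi> s), u s)) \<in> borel_measurable (lebesgue_on {a..b})"
      by (rule borel_measurable_Pair)
    from measurable_compose[OF this borel_measurable_continuous_onI[OF continuous_on_lipschitz_on_balls[OF f]]]
    have "(\<lambda>s. cutoff R f (\<xi> s) (u s)) \<in> borel_measurable (lebesgue_on {a..b})"
      by (simp add: cutoff_def)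
    then show "(\<lambda>s. cutoff R f (\<xi> s) (u s)) integrable_on {a..b}"
    proof (rule measurable_bounded_by_integrable_imp_integrable)
      fix s
      have "norm (cutoff R f (\<xi> s) (u s) - f 0 0) \<le> L * (norm (?p (\<xi> s) - 0) + norm (u s - 0))"
        unfolding cutoff_def using C by (intro L(2) pC uC) auto
      also have "\<dots> \<le> L * (R + M)"
        using p[of "\<xi> s"] bounded_inputD[OF u, of s] L(1) by (intro mult_left_mono) auto
      finally show "norm (cutoff R f (\<xi> s) (u s)) \<le> norm (f 0 0) + L * (R + M)"
        by (smt (verit) norm_triangle_sub)
    qed auto
  qed
  then show ?thesis using that by blast
qed

lemma trajectory_cutoff:
  assumes "trajectory f u x T \<xi>" "\<And>t. \<lbrakk>0 \<le> t; t \<le> T\<rbrakk> \<Longrightarrow> norm (\<xi> t) \<le> R"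
  shows "trajectory (cutoff R f) u x T \<xi>"
  using assms(1) by (rule solves_cong) (simp_all add: cutoff_eq assms(2))

lemma trajectory_of_cutoff:
  assumes "trajectory (cutoff R f) u x T \<xi>" "\<And>t. \<lbrakk>0 \<le> t; t \<le> T\<rbrakk> \<Longrightarrow> norm (\<xi> t) \<le> R"
  shows "trajectory f u x T \<xi>"
  using assms(1) by (rule solves_cong) (simp_all add: cutoff_eq assms(2))

lemma solves_bounded:
  assumes "solves g x T \<xi>"
  obtains R where "0 \<le> R" "\<And>t. \<lbrakk>0 \<le> t; t \<le> T\<rbrakk> \<Longrightarrow> norm (\<xi> t) \<le> R"
proof -
  have "bounded (\<xi> ` {0..T})"
    using compact_continuous_image[OF solves_continuous_on[OF assms] compact_Icc] by (rule compact_imp_bounded)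
  then obtain R where "R > 0" "\<forall>y\<in>\<xi> ` {0..T}. norm y \<le> R"
    by (auto simp: bounded_pos)
  then show ?thesis using that[of R] by auto
qed

lemma trajectory_unique:
  assumes f: "lipschitz_on_balls f" and u: "bounded_input M u"
    and \<xi>: "trajectory f u x T \<xi>" and \<zeta>: "trajectory f u x T \<zeta>" and t: "0 \<le> t" "t \<le> T"
  shows "\<xi> t = \<zeta> t"
proof -
  obtain R1 where R1: "0 \<le> R1" "\<And>t. \<lbrakk>0 \<le> t; t \<le> T\<rbrakk> \<Longrightarrow> norm (\<xi> t) \<le> R1" using solves_bounded[OF \<xi>] by blast
  obtain R2 where R2: "0 \<le> R2" "\<And>t. \<lbrakk>0 \<le> t; t \<le> T\<rbrakk> \<Longrightarrow> norm (\<zeta> t) \<le> R2" using solves_bounded[OF \<zeta>] by blast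
  have R: "0 \<le> R1 + R2" using R1 R2 by simp
  obtain L where L: "lipschitz_field (\<lambda>t x. cutoff (R1 + R2) f x (u t)) L"
    using cutoff_lipschitz_field[OF f R] u by metis
  have "trajectory (cutoff (R1 + R2) f) u x T \<xi>" "trajectory (cutoff (R1 + R2) f) u x T \<zeta>"
    using R1 R2 by (auto intro!: trajectory_cutoff[where f = f and u = u, OF \<xi>] trajectory_cutoff[where f = f and u = u, OF \<zeta>] intro: add_increasing add_increasing2)
  from lipschitz_field.solves_unique[OF L this t] show ?thesis .
qed

text \<open>The solution of the system cut off at radius \<open>R + 1\<close> exists; being within distance 1 of
  \<open>\<xi>\<close> it never meets the cutoff.\<close>

lemma trajectory_perturbation:
  assumes f: "lipschitz_on_balls f" and R: "0 \<le> R"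
  obtains L where "0 \<le> L"
    "\<And>u x y T \<xi>. \<lbrakk>bounded_input M u; 0 \<le> T; trajectory f u x T \<xi>; \<And>t. \<lbrakk>0 \<le> t; t \<le> T\<rbrakk> \<Longrightarrow> norm (\<xi> t) \<le> R;
        norm (y - x) * exp (L * T) \<le> 1\<rbrakk> \<Longrightarrow>
      \<exists>\<zeta>. trajectory f u y T \<zeta> \<and> (\<forall>t\<in>{0..T}. norm (\<zeta> t - \<xi> t) \<le> norm (y - x) * exp (L * T))"
    "\<And>u x y T \<xi>. \<lbrakk>bounded_input M u; 0 \<le> T; trajectory f u x T \<xi>; \<And>t. \<lbrakk>0 \<le> t; t \<le> T\<rbrakk> \<Longrightarrow> norm (\<xi> t) \<le> R;
        norm (y - \<xi> T) * exp (L * T) \<le> 1\<rbrakk> \<Longrightarrow>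
      \<exists>\<zeta>. trajectory f u (\<zeta> 0) T \<zeta> \<and> \<zeta> T = y \<and> (\<forall>t\<in>{0..T}. norm (\<zeta> t - \<xi> t) \<le> norm (y - \<xi> T) * exp (L * T))"
    "\<And>u x y T \<xi> \<zeta> t. \<lbrakk>bounded_input M u; trajectory f u x T \<xi>; trajectory f u y T \<zeta>;
        \<And>t. \<lbrakk>0 \<le> t; t \<le> T\<rbrakk> \<Longrightarrow> norm (\<xi> t) \<le> R; \<And>t. \<lbrakk>0 \<le> t; t \<le> T\<rbrakk> \<Longrightarrow> norm (\<zeta> t) \<le> R; 0 \<le> t; t \<le> T\<rbrakk> \<Longrightarrow>
      norm (\<xi> t - \<zeta> t) \<le> norm (x - y) * exp (L * T)"
proof -
  obtain L0 where L0: "\<And>u. bounded_input M u \<Longrightarrow> lipschitz_field (\<lambda>t x. cutoff (R + 1) f x (u t)) L0"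
    using cutoff_lipschitz_field[OF f, of "R + 1" M] R by auto
  \<comment> \<open>For \<open>M < 0\<close> there are no bounded inputs and nothing is known about
    \<open>L0\<close>. The maximum makes \<open>L\<close> nonnegative in every case, so the error
    factor grows with the time horizon.\<close>
  define L where "L = max 0 L0"
  have mono: "b * exp (L0 * t) \<le> b * exp (L * T)" if "0 \<le> t" "t \<le> T" "0 \<le> b" for t T b :: real
  proof -
    have "L0 * t \<le> L * t" using that by (intro mult_right_mono) (auto simp: L_def)
    also have "\<dots> \<le> L * T" using that by (intro mult_left_mono) (auto simp: L_def)
    finally show ?thesis using that by (intro mult_left_mono) auto
  qed
  show ?thesis
  proof (rule that[of L])
    show "0 \<le> L" by (simp add: L_def)
  next
    fix u x y T \<xi>
    assume u: "bounded_input M u" and T: "0 \<le> T" and \<xi>: "trajectory f u x T \<xi>"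
      and R: "\<And>t. \<lbrakk>0 \<le> t; t \<le> T\<rbrakk> \<Longrightarrow> norm (\<xi> t) \<le> R" and near: "norm (y - x) * exp (L * T) \<le> 1"
    interpret lipschitz_field "\<lambda>t x. cutoff (R + 1) f x (u t)" L0 by (rule L0[OF u])
    have R': "norm (\<xi> t) \<le> R + 1" if "0 \<le> t" "t \<le> T" for t using R[OF that] by simp
    have c\<xi>: "trajectory (cutoff (R + 1) f) u x T \<xi>" by (rule trajectory_cutoff[where f = f and u = u, OF \<xi>]) (rule R')
    obtain \<zeta> where \<zeta>: "trajectory (cutoff (R + 1) f) u y T \<zeta>" using solves_exists[OF T] .
    have "norm (\<zeta> t - \<xi> t) \<le> norm (y - x) * exp (L * T)" if t: "0 \<le> t" "t \<le> T" for t
      using solves_gronwall[OF \<zeta> c\<xi> t] mono[OF t norm_ge_zero] by (rule order_trans)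
    note d = this
    have "norm (\<zeta> t) \<le> R + 1" if t: "0 \<le> t" "t \<le> T" for t
      using d[OF t] near R[OF t] norm_triangle_sub[of "\<zeta> t" "\<xi> t"] by simp
    then have "trajectory f u y T \<zeta>" by (intro trajectory_of_cutoff[OF \<zeta>])
    with d show "\<exists>\<zeta>. trajectory f u y T \<zeta> \<and> (\<forall>t\<in>{0..T}. norm (\<zeta> t - \<xi> t) \<le> norm (y - x) * exp (L * T))"
      by auto
  next
    fix u x y T \<xi>
    assume u: "bounded_input M u" and T: "0 \<le> T" and \<xi>: "trajectory f u x T \<xi>"
      and R: "\<And>t. \<lbrakk>0 \<le> t; t \<le> T\<rbrakk> \<Longrightarrow> norm (\<xi> t) \<le> R" and near: "norm (y - \<xi> T) * exp (L * T) \<le> 1"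
    interpret lipschitz_field "\<lambda>t x. cutoff (R + 1) f x (u t)" L0 by (rule L0[OF u])
    have R': "norm (\<xi> t) \<le> R + 1" if "0 \<le> t" "t \<le> T" for t using R[OF that] by simp
    have c\<xi>: "trajectory (cutoff (R + 1) f) u x T \<xi>" by (rule trajectory_cutoff[where f = f and u = u, OF \<xi>]) (rule R')
    obtain \<zeta> where \<zeta>: "trajectory (cutoff (R + 1) f) u (\<zeta> 0) T \<zeta>" "\<zeta> T = y" using solves_exists_backward[OF T] .
    have "norm (\<zeta> t - \<xi> t) \<le> norm (y - \<xi> T) * exp (L * T)" if t: "0 \<le> t" "t \<le> T" for t
    proof -
      have "norm (\<zeta> t - \<xi> t) \<le> norm (\<zeta> T - \<xi> T) * exp (L0 * (T - t))"
        using solves_gronwall_backward[OF \<zeta>(1) c\<xi> t] .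
      also have "\<dots> \<le> norm (\<zeta> T - \<xi> T) * exp (L * T)" by (rule mono) (use t in auto)
      finally show ?thesis unfolding \<zeta>(2) .
    qed
    note d = this
    have "norm (\<zeta> t) \<le> R + 1" if t: "0 \<le> t" "t \<le> T" for t
      using d[OF t] near R[OF t] norm_triangle_sub[of "\<zeta> t" "\<xi> t"] by simp
    then have "trajectory f u (\<zeta> 0) T \<zeta>" by (intro trajectory_of_cutoff[OF \<zeta>(1)])
    with d \<zeta>(2) show "\<exists>\<zeta>. trajectory f u (\<zeta> 0) T \<zeta> \<and> \<zeta> T = y \<and> (\<forall>t\<in>{0..T}. norm (\<zeta> t - \<xi> t) \<le> norm (y - \<xi> T) * exp (L * T))"
      by auto
  next
    fix u x y T \<xi> \<zeta> t
    assume u: "bounded_input M u" and \<xi>: "trajectory f u x T \<xi>" and \<zeta>: "trajectory f u y T \<zeta>"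
      and R: "\<And>t. \<lbrakk>0 \<le> t; t \<le> T\<rbrakk> \<Longrightarrow> norm (\<xi> t) \<le> R" "\<And>t. \<lbrakk>0 \<le> t; t \<le> T\<rbrakk> \<Longrightarrow> norm (\<zeta> t) \<le> R"
      and t: "0 \<le> t" "t \<le> T"
    interpret lipschitz_field "\<lambda>t x. cutoff (R + 1) f x (u t)" L0 by (rule L0[OF u])
    have R': "norm (\<xi> t) \<le> R + 1" "norm (\<zeta> t) \<le> R + 1" if "0 \<le> t" "t \<le> T" for t
      using R(1,2)[OF that] by simp_all
    have c\<xi>: "trajectory (cutoff (R + 1) f) u x T \<xi>" by (rule trajectory_cutoff[where f = f and u = u, OF \<xi>]) (rule R'(1))
    have c\<zeta>: "trajectory (cutoff (R + 1) f) u y T \<zeta>" by (rule trajectory_cutoff[where f = f and u = u, OF \<zeta>]) (rule R'(2))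
    show "norm (\<xi> t - \<zeta> t) \<le> norm (x - y) * exp (L * T)"
      using solves_gronwall[OF c\<xi> c\<zeta> t] mono[OF t norm_ge_zero]
      by (rule order_trans)
  qed
qed

text \<open>The time is the infimum of the closed set where \<open>w \<le> h\<close>. Before it
  \<open>h < w\<close>, so the intermediate value theorem can attain the level \<open>w\<close> only
  at the infimum itself.\<close>

lemma first_hitting_time:
  fixes h :: "real \<Rightarrow> real"
  assumes cont: "continuous_on {0..T} h" and h: "h 0 \<le> w" "w \<le> h T" and T: "0 \<le> T"
  obtains s where "0 \<le> s" "s \<le> T" "h s = w" "\<And>t. \<lbrakk>0 \<le> t; t \<le> s\<rbrakk> \<Longrightarrow> h t \<le> w"
proof -
  define S where "S = {t\<in>{0..T}. w \<le> h t}"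
  have S: "T \<in> S" "bdd_below S" using h T by (auto simp: S_def)
  have "closed S"
    unfolding S_def using continuous_on_closed_Collect_le[OF continuous_on_const cont] by simp
  then have m: "Inf S \<in> S" using S closed_contains_Inf by blast
  have lt: "h t < w" if "0 \<le> t" "t < Inf S" for t
  proof (rule ccontr)
    assume "\<not> h t < w"
    then have "t \<in> S" using that m by (simp add: S_def)
    then show False using cInf_lower[OF _ S(2), of t] that by simp
  qed
  have "continuous_on {0..Inf S} h" by (rule continuous_on_subset[OF cont]) (use m in \<open>auto simp: S_def\<close>)
  then obtain t where t: "0 \<le> t" "t \<le> Inf S" "h t = w"
    using IVT'[of h 0 w "Inf S"] h m by (auto simp: S_def)
  then have "t = Inf S" using lt[of t] by (cases "t = Inf S") auto
  then have eq: "h (Inf S) = w" using t by simp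
  have "h r \<le> w" if "0 \<le> r" "r \<le> Inf S" for r
    using lt[of r] eq that by (cases "r = Inf S") auto
  then show ?thesis using that[of "Inf S"] m eq by (simp add: S_def)
qed

text \<open>An a priori bound excludes blow-up: the system cut off at \<open>R + 1\<close> has a
  solution, and up to its first contact with that radius it solves the original system, where the
  bound \<open>R\<close> forbids the contact.\<close>

lemma trajectory_exists_if_bounded:
  assumes f: "lipschitz_on_balls f" and u: "bounded_input M u" and T: "0 \<le> T"
    and bound: "\<And>t \<xi>. \<lbrakk>0 \<le> t; t \<le> T; trajectory f u x t \<xi>\<rbrakk> \<Longrightarrow> norm (\<xi> t) \<le> R"
  obtains \<xi> where "trajectory f u x T \<xi>"
proof -
  have "trajectory f u x 0 (\<lambda>_. x)" by (auto intro!: solvesI has_integral_refl)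
  then have x: "norm x \<le> R" using bound[of 0 "\<lambda>_. x"] T by simp
  then have R: "0 \<le> R" using norm_ge_zero order_trans by blast
  obtain L where "lipschitz_field (\<lambda>t x. cutoff (R + 1) f x (u t)) L"
    using cutoff_lipschitz_field[OF f, of "R + 1" M] R u by (metis add_nonneg_nonneg zero_le_one)
  then interpret lipschitz_field "\<lambda>t x. cutoff (R + 1) f x (u t)" L .
  obtain \<zeta> where \<zeta>: "trajectory (cutoff (R + 1) f) u x T \<zeta>" using solves_exists[OF T] .
  have "norm (\<zeta> t) \<le> R + 1" if t: "0 \<le> t" "t \<le> T" for t
  proof (rule ccontr)
    assume "\<not> norm (\<zeta> t) \<le> R + 1"
    moreover have "continuous_on {0..t} (\<lambda>t. norm (\<zeta> t))"
      using solves_continuous_on[OF \<zeta>] t by (auto intro!: continuous_intros intro: continuous_on_subset)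
    ultimately obtain s where s: "0 \<le> s" "s \<le> t" "norm (\<zeta> s) = R + 1" "\<And>r. \<lbrakk>0 \<le> r; r \<le> s\<rbrakk> \<Longrightarrow> norm (\<zeta> r) \<le> R + 1"
      using first_hitting_time[of t "\<lambda>t. norm (\<zeta> t)" "R + 1"] x t solves_initial[OF \<zeta> T] by auto
    have "trajectory (cutoff (R + 1) f) u x s \<zeta>" using solves_subinterval[OF \<zeta>] s t by simp
    then have "trajectory f u x s \<zeta>" using s(4) by (rule trajectory_of_cutoff)
    from bound[OF _ _ this] s t show False by simp
  qed
  then show ?thesis using that trajectory_of_cutoff[OF \<zeta>] by blast
qed

section \<open>Caratheodory solutions and the flow\<close>

lemma AE_lebesgue_on_iff_negligible:
  assumes "S \<in> sets lebesgue"
  shows "(AE t in lebesgue_on S. P t) \<longleftrightarrow> (\<exists>N. negligible N \<and> (\<forall>t\<in>S - N. P t))"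
proof -
  have "(AE t in lebesgue_on S. P t) \<longleftrightarrow> (AE t in lebesgue. t \<in> S \<longrightarrow> P t)"
    using assms by (simp add: AE_restrict_space_iff)
  also have "\<dots> \<longleftrightarrow> (\<exists>N. negligible N \<and> (\<forall>t\<in>S - N. P t))"
    unfolding eventually_ae_filter negligible_iff_null_sets by auto
  finally show ?thesis .
qed

lemma ess_norm_nonneg: "0 \<le> ess_norm u"
proof -
  have "emeasure lebesgue {0..1::real} \<le> emeasure lebesgue {0::real..}"
    by (rule emeasure_mono) auto
  then have "emeasure (lebesgue_on {0::real..}) (space (lebesgue_on {0::real..})) \<noteq> 0"
    by (auto simp: emeasure_restrict_space)
  then have "esssup (lebesgue_on {0::real..}) (\<lambda>t. 0::ereal) = 0"
    by (rule esssup_const)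
  moreover have "esssup (lebesgue_on {0::real..}) (\<lambda>t. 0::ereal) \<le> ess_norm u"
    unfolding ess_norm_def by (rule esssup_mono) auto
  ultimately show ?thesis by simp
qed

lemma input_norm_nonneg: "0 \<le> input_norm u"
  using ess_norm_nonneg[of u] by (simp add: input_norm_def real_of_ereal_pos)

lemma Linf_inputs_obtain_bounded_input:
  assumes u: "u \<in> Linf_inputs" and M: "input_norm u \<le> M"
  obtains v N where "bounded_input M v" "negligible N" "\<And>t. \<lbrakk>0 \<le> t; t \<notin> N\<rbrakk> \<Longrightarrow> v t = u t"
proof -
  have "ess_norm u = ereal (input_norm u)"
    using u ess_norm_nonneg[of u] by (simp add: Linf_inputs_def input_norm_def ereal_real)
  moreover have "AE t in lebesgue_on {0..}. ereal (norm (u t)) \<le> ess_norm u"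
    unfolding ess_norm_def by (rule esssup_AE)
  ultimately obtain N where N: "negligible N" "\<And>t. \<lbrakk>0 \<le> t; t \<notin> N\<rbrakk> \<Longrightarrow> norm (u t) \<le> input_norm u"
    by (auto simp: AE_lebesgue_on_iff_negligible)
  define w where "w t = (if t \<in> {0..} then u t else 0)" for t
  define v where "v t = (if norm (w t) \<le> M then w t else 0)" for t
  have w: "w \<in> borel_measurable lebesgue"
    using u unfolding w_def Linf_inputs_def by (intro borel_measurable_if_I) auto
  have "{t. norm (w t) \<le> M} \<in> sets lebesgue"
    using borel_measurable_le[of "\<lambda>t. norm (w t)" lebesgue "\<lambda>_. M"] w by simp
  then have "v \<in> borel_measurable lebesgue"
    unfolding v_def using w by (intro measurable_If) auto
  then have "bounded_input M v"
    using input_norm_nonneg[of u] M by (simp add: bounded_input_def v_def)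
  moreover have "v t = u t" if "0 \<le> t" "t \<notin> N" for t
    using N(2)[OF that] M that by (simp add: v_def w_def)
  ultimately show ?thesis using N(1) that by blast
qed

lemma bounded_input_imp_Linf_inputs:
  assumes "bounded_input M u"
  shows "u \<in> Linf_inputs" "input_norm u \<le> M"
proof -
  have m: "u \<in> borel_measurable (lebesgue_on {0..})"
    using assms by (auto simp: bounded_input_def intro: measurable_restrict_space1)
  have le: "ess_norm u \<le> ereal M"
    unfolding ess_norm_def using m assms by (intro esssup_I) (auto simp: bounded_input_def)
  then have "ess_norm u < \<infinity>" by (rule le_less_trans) simp
  with m show "u \<in> Linf_inputs" by (simp add: Linf_inputs_def)
  show "input_norm u \<le> M"
    using le ess_norm_nonneg[of u] unfolding input_norm_def by (cases "ess_norm u") auto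
qed

lemma trajectory_input_spike:
  assumes "trajectory f u x T \<xi>" "negligible N" "\<And>t. \<lbrakk>0 \<le> t; t \<le> T; t \<notin> N\<rbrakk> \<Longrightarrow> v t = u t"
  shows "trajectory f v x T \<xi>"
  using assms(1,2) by (rule solves_spike) (simp add: assms(3))

lemma trajectory_unique_Linf:
  assumes f: "lipschitz_on_balls f" and u: "u \<in> Linf_inputs"
    and \<xi>: "trajectory f u x T \<xi>" and \<zeta>: "trajectory f u x T' \<zeta>" and t: "0 \<le> t" "t \<le> T" "t \<le> T'"
  shows "\<xi> t = \<zeta> t"
proof -
  obtain v N where v: "bounded_input (input_norm u) v" "negligible N" "\<And>t. \<lbrakk>0 \<le> t; t \<notin> N\<rbrakk> \<Longrightarrow> v t = u t"
    using Linf_inputs_obtain_bounded_input[OF u order_refl] by blast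
  have "trajectory f v x t \<xi>"
    by (rule trajectory_input_spike[where f = f and u = u, OF solves_subinterval[OF \<xi> t(2)] v(2)]) (use v(3) in auto)
  moreover have "trajectory f v x t \<zeta>"
    by (rule trajectory_input_spike[where f = f and u = u, OF solves_subinterval[OF \<zeta> t(3)] v(2)]) (use v(3) in auto)
  ultimately show ?thesis using trajectory_unique[OF f v(1)] t(1) by blast
qed

lemma lipschitz_on_balls_bounded:
  assumes f: "lipschitz_on_balls f"
  obtains K where "0 \<le> K" "\<And>x u. \<lbrakk>norm x \<le> R; norm u \<le> M\<rbrakk> \<Longrightarrow> norm (f x u) \<le> K"
proof -
  have "compact ((\<lambda>(x, u). f x u) ` (cball 0 R \<times> cball 0 M))"
    by (intro compact_continuous_image compact_Times compact_cball
        continuous_on_subset[OF continuous_on_lipschitz_on_balls[OF f]]) auto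
  then obtain K where "K > 0" "\<forall>y\<in>(\<lambda>(x, u). f x u) ` (cball 0 R \<times> cball 0 M). norm y \<le> K"
    using compact_imp_bounded bounded_pos by metis
  then show ?thesis using that[of K] by force
qed

lemma trajectory_abs_continuous_on:
  assumes f: "lipschitz_on_balls f" and u: "bounded_input M u" and \<xi>: "trajectory f u x T \<xi>"
  shows "abs_continuous_on {0..T} \<xi>"
proof -
  obtain R where R: "\<And>t. \<lbrakk>0 \<le> t; t \<le> T\<rbrakk> \<Longrightarrow> norm (\<xi> t) \<le> R"
    using solves_bounded[OF \<xi>] by blast
  obtain K where K: "0 \<le> K" "\<And>x u. \<lbrakk>norm x \<le> R; norm u \<le> M\<rbrakk> \<Longrightarrow> norm (f x u) \<le> K"
    using lipschitz_on_balls_bounded[OF f] by metis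
  show ?thesis
  proof (rule lipschitz_imp_abs_continuous_on)
    fix s t assume st: "0 \<le> s" "s \<le> t" "t \<le> T"
    have "norm (\<xi> t - \<xi> s) \<le> K * measure lborel (cbox s t)"
      by (rule has_integral_bound[OF K(1)])
        (use solves_has_integral[OF \<xi> st] st R K(2) bounded_inputD[OF u] in auto)
    then show "norm (\<xi> t - \<xi> s) \<le> K * (t - s)" using st by simp
  qed
qed

text \<open>From left to right this is the fundamental theorem for absolutely continuous functions.
  Conversely, a bounded input makes the trajectory Lipschitz, hence absolutely continuous, and
  differentiation of the indefinite integral gives the equation almost everywhere.\<close>

lemma caratheodory_solution_iff_trajectory:
  assumes f: "lipschitz_on_balls f" and u: "u \<in> Linf_inputs"
  shows "caratheodory_solution f x u J \<xi> \<longleftrightarrow>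
    is_interval J \<and> J \<subseteq> {0..} \<and> 0 \<in> J \<and> (\<forall>T\<in>J. trajectory f u x T \<xi>)" (is "_ \<longleftrightarrow> ?R")
proof
  assume c: "caratheodory_solution f x u J \<xi>"
  then have J: "is_interval J" "J \<subseteq> {0..}" "0 \<in> J" and \<xi>0: "\<xi> 0 = x"
    and ac: "\<And>T. T \<in> J \<Longrightarrow> abs_continuous_on {0..T} \<xi>"
    and ae: "AE t in lebesgue_on J. (\<xi> has_vector_derivative f (\<xi> t) (u t)) (at t within J)"
    by (auto simp: caratheodory_solution_def)
  have "J \<in> sets lebesgue" using real_interval_borel_measurable[OF J(1)] by simp
  then obtain N where N: "negligible N"
    "\<And>t. \<lbrakk>t \<in> J; t \<notin> N\<rbrakk> \<Longrightarrow> (\<xi> has_vector_derivative f (\<xi> t) (u t)) (at t within J)"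
    using ae by (auto simp: AE_lebesgue_on_iff_negligible)
  have sub: "{0..T} \<subseteq> J" if "T \<in> J" for T
    using mem_is_interval_1_I[OF J(1,3) that] by auto
  have "trajectory f u x T \<xi>" if T: "T \<in> J" for T
  proof (rule solvesI)
    show "continuous_on {0..T} \<xi>" by (rule abs_continuous_on_imp_continuous_on[OF ac[OF T]])
    fix t assume t: "0 \<le> t" "t \<le> T"
    then have tJ: "t \<in> J" using sub[OF T] by auto
    show "((\<lambda>s. f (\<xi> s) (u s)) has_integral (\<xi> t - x)) {0..t}"
      unfolding \<xi>0[symmetric]
    proof (rule fundamental_theorem_of_calculus_abs_continuous[OF ac[OF tJ] t(1) N(1)])
      fix s assume s: "s \<in> {0..t} - N"
      then have "s \<in> J" using sub[OF tJ] by blast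
      with s show "(\<xi> has_vector_derivative f (\<xi> s) (u s)) (at s within {0..t})"
        by (intro has_vector_derivative_within_subset[OF N(2) sub[OF tJ]]) auto
    qed
  qed
  with J show ?R by blast
next
  assume R: ?R
  then have J: "is_interval J" "J \<subseteq> {0..}" "0 \<in> J" and tr: "\<And>T. T \<in> J \<Longrightarrow> trajectory f u x T \<xi>" by auto
  have \<xi>0: "\<xi> 0 = x" using solves_initial[OF tr[OF J(3)]] by simp
  obtain v N0 where v: "bounded_input (input_norm u) v" "negligible N0" "\<And>t. \<lbrakk>0 \<le> t; t \<notin> N0\<rbrakk> \<Longrightarrow> v t = u t"
    using Linf_inputs_obtain_bounded_input[OF u order_refl] by blast
  have ac: "abs_continuous_on {0..T} \<xi>" if "T \<in> J" for T
    by (rule trajectory_abs_continuous_on[OF f v(1) trajectory_input_spike[where f = f and u = u, OF tr[OF that] v(2)]]) (use v(3) in auto)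
  have "\<exists>N. negligible N \<and> (\<forall>t. 0 < t \<and> t < T \<and> t \<notin> N \<longrightarrow> (\<xi> has_vector_derivative f (\<xi> t) (u t)) (at t))"
    if T: "T \<in> J" for T
  proof -
    let ?g = "\<lambda>s. f (\<xi> s) (u s)"
    have hi: "(?g has_integral (\<xi> t - x)) {0..t}" if "t \<in> {0..T}" for t
      using tr[OF T] that by (simp add: solves_def)
    have "?g integrable_on {0..T}" using hi[of T] T J(2) by (auto simp: has_integral_integrable)
    then obtain N where N: "negligible N"
      "\<And>t. t \<in> {0..T} - N \<Longrightarrow> ((\<lambda>t. integral {0..t} ?g) has_vector_derivative ?g t) (at t within {0..T})"
      using indefinite_integral_has_vector_derivative_AE by blast
    have "(\<xi> has_vector_derivative ?g t) (at t)" if t: "0 < t" "t < T" "t \<notin> N" for t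
    proof -
      have "((\<lambda>t. x + integral {0..t} ?g) has_vector_derivative ?g t) (at t within {0..T})"
        using N(2)[of t] t by (auto intro!: derivative_eq_intros)
      then have "(\<xi> has_vector_derivative ?g t) (at t within {0..T})"
        by (rule has_vector_derivative_transform[rotated 2]) (use t integral_unique[OF hi] in auto)
      then show ?thesis using t by (simp add: at_within_Icc_at)
    qed
    with N(1) show ?thesis by blast
  qed
  then obtain N where N: "\<And>T. T \<in> J \<Longrightarrow> negligible (N T)"
      "\<And>T t. \<lbrakk>T \<in> J; 0 < t; t < T; t \<notin> N T\<rbrakk> \<Longrightarrow> (\<xi> has_vector_derivative f (\<xi> t) (u t)) (at t)"
    by metis
  \<comment> \<open>Differentiability is known inside each \<open>{0..T}\<close> up to a null set
    that depends on \<open>T\<close>. Rational \<open>T\<close> suffice and are countably many; the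
    end points 0 and a possible maximum of \<open>J\<close>, which no such interval has in its
    interior, are discarded.\<close>
  define E where "E = \<Union>(N ` (J \<inter> \<rat>)) \<union> {0} \<union> {t\<in>J. \<forall>s\<in>J. s \<le> t}"
  have "finite {t\<in>J. \<forall>s\<in>J. s \<le> t}"
  proof (cases "\<exists>t\<in>J. \<forall>s\<in>J. s \<le> t")
    case True
    then obtain t where "t \<in> J" "\<forall>s\<in>J. s \<le> t" by blast
    then have "{t\<in>J. \<forall>s\<in>J. s \<le> t} \<subseteq> {t}" by force
    then show ?thesis using finite_subset by blast
  next
    case False
    then have "{t\<in>J. \<forall>s\<in>J. s \<le> t} = {}" by blast
    then show ?thesis by (metis finite.emptyI)
  qed
  moreover have "negligible (\<Union>(N ` (J \<inter> \<rat>)))"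
    by (rule negligible_countable_Union) (use N(1) countable_rat in \<open>auto intro: countable_Int2\<close>)
  ultimately have E: "negligible E" unfolding E_def by (intro negligible_Un) auto
  have "(\<xi> has_vector_derivative f (\<xi> t) (u t)) (at t within J)" if t: "t \<in> J - E" for t
  proof -
    have "t > 0" using t J(2) by (auto simp: E_def less_le)
    obtain s where s: "s \<in> J" "t < s" using t by (force simp: E_def not_le)
    obtain q where q: "q \<in> \<rat>" "t < q" "q < s" using Rats_dense_in_real[OF s(2)] by blast
    have "q \<in> J" using mem_is_interval_1_I[OF J(1,3) s(1), of q] q \<open>t > 0\<close> by simp
    moreover have "t \<notin> N q" using t q \<open>q \<in> J\<close> by (auto simp: E_def)
    ultimately have "(\<xi> has_vector_derivative f (\<xi> t) (u t)) (at t)" using N(2) q \<open>t > 0\<close> by blast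
    then show ?thesis by (rule has_vector_derivative_at_within)
  qed
  moreover have "J \<in> sets lebesgue" using real_interval_borel_measurable[OF J(1)] by simp
  ultimately have "AE t in lebesgue_on J. (\<xi> has_vector_derivative f (\<xi> t) (u t)) (at t within J)"
    using E by (auto simp: AE_lebesgue_on_iff_negligible)
  with J \<xi>0 ac show "caratheodory_solution f x u J \<xi>"
    by (simp add: caratheodory_solution_def)
qed

text \<open>Uniqueness makes all trajectories from \<open>x\<close> agree where they overlap, so
  they glue to one function on the set of all times that some trajectory reaches. Maximality is then
  automatic, without any appeal to Zorn's lemma.\<close>

lemma maximal_solution_of_trajectory:
  assumes f: "lipschitz_on_balls f" and u: "u \<in> Linf_inputs" and T: "0 \<le> T" and \<xi>: "trajectory f u x T \<xi>"
  obtains J \<zeta> where "maximal_solution f x u J \<zeta>" "T \<in> J"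
proof -
  define J where "J = {t. 0 \<le> t \<and> (\<exists>\<xi>. trajectory f u x t \<xi>)}"
  define \<zeta> where "\<zeta> t = (SOME \<xi>. trajectory f u x t \<xi>) t" for t
  have \<zeta>: "\<zeta> s = \<xi> s" if "trajectory f u x t \<xi>" "0 \<le> s" "s \<le> t" for \<xi> s t
  proof -
    have "trajectory f u x s (SOME \<xi>. trajectory f u x s \<xi>)"
      using solves_subinterval[OF that(1,3)] by (rule someI[where P = "\<lambda>\<xi>. trajectory f u x s \<xi>"])
    from trajectory_unique_Linf[OF f u this that(1), of s] that show ?thesis by (simp add: \<zeta>_def)
  qed
  have tr: "trajectory f u x t \<zeta>" if t: "t \<in> J" for t
  proof -
    obtain \<xi> where \<xi>: "trajectory f u x t \<xi>" using t unfolding J_def by blast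
    then show ?thesis by (rule solves_cong) (use \<zeta>[OF \<xi>] in auto)
  qed
  have "is_interval J"
    unfolding is_interval_1 J_def using solves_subinterval order_trans by blast
  then have "caratheodory_solution f x u J \<zeta>"
    unfolding caratheodory_solution_iff_trajectory[OF f u]
    using tr T \<xi> by (auto simp: J_def intro: solves_subinterval)
  moreover have "J' = J" if "caratheodory_solution f x u J' \<xi>'" "J \<subseteq> J'" for J' \<xi>'
    using that unfolding caratheodory_solution_iff_trajectory[OF f u] by (auto simp: J_def)
  ultimately have "maximal_solution f x u J \<zeta>" by (auto simp: maximal_solution_def)
  moreover have "T \<in> J" using T \<xi> by (auto simp: J_def)
  ultimately show ?thesis using that by blast
qed

text \<open>Uniqueness gives the description operator its value, and a maximal solution restricted
  to \<open>{0..t}\<close> is a trajectory. Maximal solutions disappear from all later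
  arguments.\<close>

lemma ode_flow_eq_Some_iff:
  assumes f: "lipschitz_on_balls f" and u: "u \<in> Linf_inputs"
  shows "ode_flow f t x u = Some y \<longleftrightarrow> 0 \<le> t \<and> (\<exists>\<xi>. trajectory f u x t \<xi> \<and> \<xi> t = y)"
proof -
  have max: "0 \<le> t \<and> trajectory f u x t \<xi>" if "maximal_solution f x u J \<xi>" "t \<in> J" for J \<xi>
    using that caratheodory_solution_iff_trajectory[OF f u] by (auto simp: maximal_solution_def)
  have the: "(THE y. \<exists>J \<xi>. maximal_solution f x u J \<xi> \<and> t \<in> J \<and> y = \<xi> t) = \<xi> t"
    if "maximal_solution f x u J \<xi>" "t \<in> J" for J \<xi>
  proof (rule the_equality)
    fix y assume "\<exists>J \<xi>. maximal_solution f x u J \<xi> \<and> t \<in> J \<and> y = \<xi> t"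
    then show "y = \<xi> t" using max[OF that] max trajectory_unique_Linf[OF f u] by blast
  qed (use that in blast)
  show ?thesis
  proof
    assume "ode_flow f t x u = Some y"
    then obtain J \<xi> where "maximal_solution f x u J \<xi>" "t \<in> J"
        "y = (THE y. \<exists>J \<xi>. maximal_solution f x u J \<xi> \<and> t \<in> J \<and> y = \<xi> t)"
      unfolding ode_flow_def by (auto split: if_splits)
    then show "0 \<le> t \<and> (\<exists>\<xi>. trajectory f u x t \<xi> \<and> \<xi> t = y)" using max the by metis
  next
    assume "0 \<le> t \<and> (\<exists>\<xi>. trajectory f u x t \<xi> \<and> \<xi> t = y)"
    then obtain \<xi> where \<xi>: "0 \<le> t" "trajectory f u x t \<xi>" "\<xi> t = y" by blast
    obtain J \<zeta> where J: "maximal_solution f x u J \<zeta>" "t \<in> J"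
      using maximal_solution_of_trajectory[OF f u \<xi>(1,2)] .
    then have "ode_flow f t x u = Some (\<zeta> t)" unfolding ode_flow_def using the by auto
    moreover have "\<zeta> t = \<xi> t" using max[OF J] \<xi> trajectory_unique_Linf[OF f u] by blast
    ultimately show "ode_flow f t x u = Some y" using \<xi> by simp
  qed
qed

lemma ode_flow_trajectory:
  assumes "lipschitz_on_balls f" "u \<in> Linf_inputs" "trajectory f u x T \<xi>" "0 \<le> t" "t \<le> T"
  shows "ode_flow f t x u = Some (\<xi> t)"
  using assms ode_flow_eq_Some_iff solves_subinterval by blast

lemma forward_complete_ode_flow_iff:
  assumes f: "lipschitz_on_balls f"
  shows "forward_complete (ode_flow f) \<longleftrightarrow>
    (\<forall>M u x T. bounded_input M u \<longrightarrow> 0 \<le> T \<longrightarrow> (\<exists>\<xi>. trajectory f u x T \<xi>))"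
proof
  assume "forward_complete (ode_flow f)"
  then show "\<forall>M u x T. bounded_input M u \<longrightarrow> 0 \<le> T \<longrightarrow> (\<exists>\<xi>. trajectory f u x T \<xi>)"
    unfolding forward_complete_def using ode_flow_eq_Some_iff[OF f] bounded_input_imp_Linf_inputs(1)
    by (metis not_None_eq)
next
  assume c: "\<forall>M u x T. bounded_input M u \<longrightarrow> 0 \<le> T \<longrightarrow> (\<exists>\<xi>. trajectory f u x T \<xi>)"
  show "forward_complete (ode_flow f)"
    unfolding forward_complete_def
  proof (intro allI impI ballI)
    fix t :: real and x :: 'a and u :: "real \<Rightarrow> 'b" assume t: "0 \<le> t" and u: "u \<in> Linf_inputs"
    obtain v N where v: "bounded_input (input_norm u) v" "negligible N" "\<And>t. \<lbrakk>0 \<le> t; t \<notin> N\<rbrakk> \<Longrightarrow> v t = u t"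
      using Linf_inputs_obtain_bounded_input[OF u order_refl] by blast
    obtain \<xi> where "trajectory f v x t \<xi>" using c v(1) t by blast
    then have "trajectory f u x t \<xi>" by (rule trajectory_input_spike[where f = f and u = v, OF _ v(2)]) (use v(3) in auto)
    from ode_flow_trajectory[OF f u this t order_refl] show "ode_flow f t x u \<noteq> None" by simp
  qed
qed

section \<open>Bounded reachability of complete systems\<close>

lemma trajectory_concat:
  assumes "trajectory f u x S \<xi>" "trajectory f v (\<xi> S) T \<zeta>" "0 \<le> S" "0 \<le> T"
  shows "trajectory f (\<lambda>t. if t < S then u t else v (t - S)) x (S + T) (\<lambda>t. if t \<le> S then \<xi> t else \<zeta> (t - S))"
proof -
  have "(\<lambda>t. if t < S then (\<lambda>y. f y (u t)) else (\<lambda>y. f y (v (t - S)))) =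
      (\<lambda>t y. f y (if t < S then u t else v (t - S)))"
    by (auto simp: fun_eq_iff)
  with solves_concat[OF assms] show ?thesis by simp
qed

lemma trajectory_zero_time: "trajectory f u x 0 (\<lambda>_. x)"
  by (auto intro!: solvesI has_integral_refl)

locale complete_system =
  fixes f :: "'x::euclidean_space \<Rightarrow> 'u::euclidean_space \<Rightarrow> 'x" and M :: real
  assumes lipschitz: "lipschitz_on_balls f"
    and complete: "\<And>u x T. \<lbrakk>bounded_input M u; 0 \<le> T\<rbrakk> \<Longrightarrow> \<exists>\<xi>. trajectory f u x T \<xi>"
begin

text \<open>The horizon \<open>r\<close> is a time budget, to be spent along the iterated
  construction that rules out explosive points.\<close>

definition explosive :: "'x \<Rightarrow> real \<Rightarrow> bool" where
  "explosive z r \<longleftrightarrow> (\<forall>N. \<exists>v t \<xi>. bounded_input M v \<and> 0 \<le> t \<and> t \<le> r \<and> trajectory f v z t \<xi> \<and> N < norm (\<xi> t))"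

text \<open>A bound on the states reachable from \<open>z\<close> fixes one Lipschitz constant for
  all inputs and times involved. Initial values within \<open>exp (- (L * r))\<close> of
  \<open>z\<close> then deviate by at most 1 under the same input.\<close>

lemma not_explosive_neighbourhood:
  assumes z: "\<not> explosive z r" and r: "0 \<le> r"
  obtains \<delta> N where "\<delta> > 0" "\<And>y v t \<xi>. \<lbrakk>norm (y - z) < \<delta>; bounded_input M v; 0 \<le> t; t \<le> r; trajectory f v y t \<xi>\<rbrakk> \<Longrightarrow>
    norm (\<xi> t) \<le> N"
proof -
  obtain N where N: "\<And>v t \<xi>. \<lbrakk>bounded_input M v; 0 \<le> t; t \<le> r; trajectory f v z t \<xi>\<rbrakk> \<Longrightarrow> norm (\<xi> t) \<le> N"
    using z unfolding explosive_def by (meson not_le)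
  define R where "R = max 0 N"
  have R: "0 \<le> R" by (simp add: R_def)
  obtain L where L: "0 \<le> L" "\<And>u x y T \<xi>. \<lbrakk>bounded_input M u; 0 \<le> T; trajectory f u x T \<xi>;
      \<And>t. \<lbrakk>0 \<le> t; t \<le> T\<rbrakk> \<Longrightarrow> norm (\<xi> t) \<le> R; norm (y - x) * exp (L * T) \<le> 1\<rbrakk> \<Longrightarrow>
      \<exists>\<zeta>. trajectory f u y T \<zeta> \<and> (\<forall>t\<in>{0..T}. norm (\<zeta> t - \<xi> t) \<le> norm (y - x) * exp (L * T))"
    by (rule trajectory_perturbation[OF lipschitz R]) blast
  show ?thesis
  proof (rule that[of "exp (- (L * r))"])
    fix y v t \<xi>
    assume y: "norm (y - z) < exp (- (L * r))" and v: "bounded_input M v" and t: "0 \<le> t" "t \<le> r"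
      and \<xi>: "trajectory f v y t \<xi>"
    obtain \<zeta> where \<zeta>: "trajectory f v z t \<zeta>" using complete[OF v t(1)] by blast
    have \<zeta>R: "norm (\<zeta> s) \<le> R" if "0 \<le> s" "s \<le> t" for s
      using N[OF v that(1) _ solves_subinterval[OF \<zeta> that(2)]] that(2) t by (simp add: R_def)
    have "norm (y - z) * exp (L * t) \<le> exp (- (L * r)) * exp (L * r)"
      using y t L(1) by (intro mult_mono) (auto intro: mult_left_mono)
    also have "\<dots> = 1" by (simp add: exp_add[symmetric])
    finally have near: "norm (y - z) * exp (L * t) \<le> 1" .
    obtain \<xi>' where \<xi>': "trajectory f v y t \<xi>'" "\<forall>s\<in>{0..t}. norm (\<xi>' s - \<zeta> s) \<le> norm (y - z) * exp (L * t)"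
      using L(2)[OF v t(1) \<zeta> \<zeta>R near] by blast
    have "\<xi> t = \<xi>' t" using trajectory_unique[OF lipschitz v \<xi> \<xi>'(1)] t by simp
    moreover have "norm (\<xi>' t - \<zeta> t) \<le> 1" using \<xi>'(2) near t by force
    ultimately show "norm (\<xi> t) \<le> R + 1"
      using \<zeta>R[of t] t norm_triangle_sub[of "\<xi>' t" "\<zeta> t"] by simp
  qed simp
qed

text \<open>A limit that is not explosive would bound the states reachable from all nearby
  \<open>X n\<close> uniformly, against states of norm larger than \<open>n\<close>.\<close>

lemma explosive_limit:
  assumes lim: "X \<longlonglongrightarrow> z" and r: "0 \<le> r"
    and X: "\<forall>\<^sub>F n in sequentially. \<exists>v t \<xi>. bounded_input M v \<and> 0 \<le> t \<and> t \<le> r \<and> trajectory f v (X n) t \<xi> \<and> real n < norm (\<xi> t)"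
  shows "explosive z r"
proof (rule ccontr)
  assume "\<not> explosive z r"
  then obtain \<delta> N where \<delta>: "\<delta> > 0" "\<And>y v t \<xi>. \<lbrakk>norm (y - z) < \<delta>; bounded_input M v; 0 \<le> t; t \<le> r; trajectory f v y t \<xi>\<rbrakk> \<Longrightarrow>
    norm (\<xi> t) \<le> N"
    using not_explosive_neighbourhood[OF _ r] by blast
  have "\<forall>\<^sub>F n in sequentially. norm (X n - z) < \<delta>"
    using tendstoD[OF lim \<delta>(1)] by (simp add: dist_norm)
  moreover have "\<forall>\<^sub>F n in sequentially. N \<le> real n"
    by (rule eventually_sequentiallyI[of "nat \<lceil>N\<rceil>"]) linarith
  ultimately have "\<forall>\<^sub>F n in sequentially. False"
    using X by eventually_elim (use \<delta>(2) in force)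
  then show False by simp
qed

text \<open>The trajectories leaving \<open>\<xi> S\<close> towards infinity cross a large sphere; their crossing points
  accumulate at an explosive point \<open>y\<close>, which need not be reachable itself. Solving backwards from \<open>y\<close>
  shows that it is reached exactly from an initial value close to \<open>p\<close>.\<close>

lemma explosive_step:
  assumes S: "0 \<le> S" and r: "0 \<le> r" and w: "bounded_input M w" and \<xi>: "trajectory f w p S \<xi>"
    and ex: "explosive (\<xi> S) r" and \<epsilon>: "0 < \<epsilon>"
  obtains p' w' S' r' \<xi>' where "norm (p' - p) \<le> \<epsilon>" "S \<le> S'" "0 \<le> r'" "S' + r' \<le> S + r + \<epsilon>"
    "bounded_input M w'" "\<And>t. t < S \<Longrightarrow> w' t = w t" "trajectory f w' p' S' \<xi>'" "explosive (\<xi>' S') r'" "K \<le> norm (\<xi>' S')"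
proof -
  obtain N0 where N0: "0 \<le> N0" "\<And>t. \<lbrakk>0 \<le> t; t \<le> S\<rbrakk> \<Longrightarrow> norm (\<xi> t) \<le> N0" using solves_bounded[OF \<xi>] by blast
  \<comment> \<open>Since \<open>N0 \<le> K'\<close>, the trajectories leaving
    \<open>\<xi> S\<close> start inside the sphere, and each concatenation stays in the ball up to
    its crossing. One Lipschitz constant is thus fixed before a crossing is selected.\<close>
  define K' where "K' = max K N0 + 1"
  have K': "0 \<le> K'" "K \<le> K'" "N0 \<le> K'" using N0(1) by (auto simp: K'_def)
  define G where "G n v t \<zeta> s \<longleftrightarrow>
      bounded_input M v \<and> 0 \<le> s \<and> s \<le> t \<and> t \<le> r \<and> trajectory f v (\<xi> S) t \<zeta> \<and> norm (\<zeta> s) = K' \<and>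
      (\<forall>q. 0 \<le> q \<longrightarrow> q \<le> s \<longrightarrow> norm (\<zeta> q) \<le> K') \<and> real n < norm (\<zeta> t)" for n v t \<zeta> s
  have "\<exists>v t \<zeta> s. G n v t \<zeta> s" for n
  proof -
    obtain v t \<zeta> where v: "bounded_input M v" "0 \<le> t" "t \<le> r" "trajectory f v (\<xi> S) t \<zeta>" "max (real n) K' < norm (\<zeta> t)"
      using ex unfolding explosive_def by blast
    have "continuous_on {0..t} (\<lambda>q. norm (\<zeta> q))" using solves_continuous_on[OF v(4)] by (intro continuous_intros)
    moreover have "norm (\<zeta> 0) \<le> K'" using solves_initial[OF v(4,2)] N0(2)[of S] S K' by simp
    ultimately obtain s where "0 \<le> s" "s \<le> t" "norm (\<zeta> s) = K'" "\<And>q. \<lbrakk>0 \<le> q; q \<le> s\<rbrakk> \<Longrightarrow> norm (\<zeta> q) \<le> K'"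
      using first_hitting_time[of t "\<lambda>q. norm (\<zeta> q)" K'] v(2,5) by auto
    with v show ?thesis by (intro exI[of _ v] exI[of _ t] exI[of _ \<zeta>] exI[of _ s]) (auto simp: G_def)
  qed
  then obtain v t \<zeta> s where G: "\<And>n. G n (v n) (t n) (\<zeta> n) (s n)"
    by (metis (full_types))
  have v: "bounded_input M (v n)" and s: "0 \<le> s n" "s n \<le> t n" and t: "t n \<le> r"
    and \<zeta>: "trajectory f (v n) (\<xi> S) (t n) (\<zeta> n)" "norm (\<zeta> n (s n)) = K'"
      "\<And>q. 0 \<le> q \<Longrightarrow> q \<le> s n \<Longrightarrow> norm (\<zeta> n q) \<le> K'" "real n < norm (\<zeta> n (t n))" for n
    using G[of n] unfolding G_def by blast+
  have sr: "s n \<le> r" for n using s t order_trans by blast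
  have "seq_compact (cball (0::'x) K' \<times> {0..r})"
    by (intro compact_imp_seq_compact compact_Times compact_cball compact_Icc)
  moreover have "\<forall>n. (\<zeta> n (s n), s n) \<in> cball 0 K' \<times> {0..r}" using \<zeta>(2) s sr by simp
  ultimately obtain l k where lk: "l \<in> cball 0 K' \<times> {0..r}" "strict_mono (k :: nat \<Rightarrow> nat)"
      "((\<lambda>n. (\<zeta> n (s n), s n)) \<circ> k) \<longlonglongrightarrow> l"
    by (rule seq_compactE)
  obtain y \<sigma> where l: "l = (y, \<sigma>)" by (cases l)
  have \<sigma>: "\<sigma> \<le> r" "0 \<le> \<sigma>" using lk(1) l by auto
  have lim_y: "(\<lambda>n. \<zeta> (k n) (s (k n))) \<longlonglongrightarrow> y" using tendsto_fst[OF lk(3)] l by (simp add: o_def)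
  have lim_s: "(\<lambda>n. s (k n)) \<longlonglongrightarrow> \<sigma>" using tendsto_snd[OF lk(3)] l by (simp add: o_def)
  have "(\<lambda>n. norm (\<zeta> (k n) (s (k n)))) \<longlonglongrightarrow> norm y" using lim_y by (rule tendsto_norm)
  then have ny: "norm y = K'" using \<zeta>(2) LIMSEQ_unique[OF _ tendsto_const] by simp
  \<comment> \<open>One half of \<open>\<epsilon>\<close> enlarges the horizon left at
    \<open>y\<close>, because the crossing times only approximate \<open>\<sigma>\<close>; the other
    half absorbs the difference between the selected crossing time and
    \<open>\<sigma>\<close>.\<close>
  define e where "e = \<epsilon> / 2"
  have e: "e > 0" using \<epsilon> by (simp add: e_def)
  have ev_s: "\<forall>\<^sub>F n in sequentially. \<bar>s (k n) - \<sigma>\<bar> < e" using tendstoD[OF lim_s e] by (simp add: dist_real_def)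
  have "explosive y (r - \<sigma> + e)"
  proof (rule explosive_limit[OF lim_y])
    show "0 \<le> r - \<sigma> + e" using \<sigma> e by simp
    show "\<forall>\<^sub>F n in sequentially. \<exists>v t \<xi>. bounded_input M v \<and> 0 \<le> t \<and> t \<le> r - \<sigma> + e \<and>
        trajectory f v (\<zeta> (k n) (s (k n))) t \<xi> \<and> real n < norm (\<xi> t)"
      using ev_s
    proof eventually_elim
      case (elim n)
      have "n \<le> k n" by (rule seq_suble[OF lk(2)])
      then have "real n < norm (\<zeta> (k n) (t (k n)))" using \<zeta>(4)[of "k n"] by linarith
      then show ?case
        using bounded_input_shift[OF v] solves_shift[OF \<zeta>(1)[of "k n"] s(1) s(2)] s(2)[of "k n"] t[of "k n"] elim
        by (intro exI[of _ "\<lambda>q. v (k n) (s (k n) + q)"] exI[of _ "t (k n) - s (k n)"] exI[of _ "\<lambda>q. \<zeta> (k n) (s (k n) + q)"])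
          auto
    qed
  qed
  note ex_y = this
  obtain L where L: "0 \<le> L" "\<And>u x y T \<xi>. \<lbrakk>bounded_input M u; 0 \<le> T; trajectory f u x T \<xi>;
      \<And>t. \<lbrakk>0 \<le> t; t \<le> T\<rbrakk> \<Longrightarrow> norm (\<xi> t) \<le> K'; norm (y - \<xi> T) * exp (L * T) \<le> 1\<rbrakk> \<Longrightarrow>
      \<exists>\<zeta>. trajectory f u (\<zeta> 0) T \<zeta> \<and> \<zeta> T = y \<and> (\<forall>t\<in>{0..T}. norm (\<zeta> t - \<xi> t) \<le> norm (y - \<xi> T) * exp (L * T))"
    by (rule trajectory_perturbation[OF lipschitz K'(1)]) blast
  \<comment> \<open>\<open>E\<close> bounds the backward amplification for every crossing, since
    none occurs after time \<open>S + r\<close>. The tolerance \<open>min 1 \<epsilon> / E\<close>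
    meets the smallness condition 1 of the perturbation lemma and keeps the correction of the
    initial value below \<open>\<epsilon>\<close>.\<close>
  define E where "E = exp (L * (S + r))"
  have E: "E > 0" by (simp add: E_def)
  have "\<forall>\<^sub>F n in sequentially. norm (\<zeta> (k n) (s (k n)) - y) < min 1 \<epsilon> / E"
    using tendstoD[OF lim_y, of "min 1 \<epsilon> / E"] \<epsilon> E by (simp add: dist_norm)
  with ev_s have "\<forall>\<^sub>F n in sequentially. \<bar>s (k n) - \<sigma>\<bar> < e \<and> norm (\<zeta> (k n) (s (k n)) - y) < min 1 \<epsilon> / E"
    by (rule eventually_conj)
  then obtain n where n: "\<bar>s (k n) - \<sigma>\<bar> < e" "norm (\<zeta> (k n) (s (k n)) - y) < min 1 \<epsilon> / E"
    using eventually_happens'[OF sequentially_bot] by blast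
  define m where "m = k n"
  define S' where "S' = S + s m"
  define w' where "w' q = (if q < S then w q else v m (q - S))" for q
  define \<xi>c where "\<xi>c q = (if q \<le> S then \<xi> q else \<zeta> m (q - S))" for q
  have S': "S \<le> S'" "S' \<le> S + r" "0 \<le> S'" using s[of m] sr[of m] S by (auto simp: S'_def)
  have w': "bounded_input M w'" unfolding w'_def by (rule bounded_input_concat[OF w v])
  have \<zeta>m: "trajectory f (v m) (\<xi> S) (s m) (\<zeta> m)" by (rule solves_subinterval[OF \<zeta>(1) s(2)])
  have \<xi>c: "trajectory f w' p S' \<xi>c"
    unfolding w'_def \<xi>c_def S'_def by (rule trajectory_concat[OF \<xi> \<zeta>m S s(1)])
  have \<xi>cK: "norm (\<xi>c q) \<le> K'" if "0 \<le> q" "q \<le> S'" for q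
    using N0(2)[of q] \<zeta>(3)[of "q - S" m] K' that by (auto simp: \<xi>c_def S'_def)
  have \<xi>c_end: "\<xi>c S' = \<zeta> m (s m)"
    using solves_initial[OF \<zeta>m s(1)] s(1)[of m] by (auto simp: \<xi>c_def S'_def)
  have "norm (y - \<xi>c S') * exp (L * S') \<le> norm (y - \<xi>c S') * E"
    unfolding E_def using L(1) S' by (intro mult_left_mono) (auto intro: mult_left_mono)
  also have "\<dots> \<le> min 1 \<epsilon>"
    using n(2) E unfolding \<xi>c_end m_def by (simp add: norm_minus_commute pos_less_divide_eq less_imp_le del: min_less_iff_conj)
  finally have near: "norm (y - \<xi>c S') * exp (L * S') \<le> min 1 \<epsilon>" .
  then have near1: "norm (y - \<xi>c S') * exp (L * S') \<le> 1" by simp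
  obtain \<xi>' where \<xi>': "trajectory f w' (\<xi>' 0) S' \<xi>'" "\<xi>' S' = y"
      "\<forall>q\<in>{0..S'}. norm (\<xi>' q - \<xi>c q) \<le> norm (y - \<xi>c S') * exp (L * S')"
    using L(2)[OF w' S'(3) \<xi>c \<xi>cK near1] by blast
  show ?thesis
  proof (rule that[OF _ S'(1) _ _ w' _ \<xi>'(1)])
    show "norm (\<xi>' 0 - p) \<le> \<epsilon>"
      using bspec[OF \<xi>'(3), of 0] near S'(3) solves_initial[OF \<xi>c S'(3)] by simp
    show "0 \<le> r - \<sigma> + e" using \<sigma> e by simp
    show "S' + (r - \<sigma> + e) \<le> S + r + \<epsilon>" using n(1) unfolding S'_def m_def e_def by linarith
    show "w' q = w q" if "q < S" for q using that by (simp add: w'_def)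
    show "explosive (\<xi>' S') (r - \<sigma> + e)" using ex_y \<xi>'(2) by simp
    show "K \<le> norm (\<xi>' S')" using ny K' \<xi>'(2) by simp
  qed
qed

text \<open>Iterating the step yields a Cauchy sequence of initial values and inputs that fit together; the limit
  trajectory passes within distance 1 of points of norm at least \<open>k\<close>, for every \<open>k\<close>, in bounded time.\<close>

theorem not_explosive:
  assumes r0: "0 \<le> r0"
  shows "\<not> explosive z r0"
proof
  assume ex: "explosive z r0"
  \<comment> \<open>Step \<open>k\<close> may lengthen the total time by \<open>(1/2)^k\<close>. The
    budget starts at \<open>r0\<close> for \<open>k = 0\<close> and stays below
    \<open>r0 + 2\<close>; the same amounts bound the moves of the initial values, which makes these
    summable.\<close>
  define I where "I k p w S r \<longleftrightarrow> 0 \<le> S \<and> 0 \<le> r \<and> S + r \<le> r0 + 2 - 2 * (1/2)^k \<and> bounded_input M w \<and>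
      (\<exists>\<xi>. trajectory f w p S \<xi> \<and> explosive (\<xi> S) r \<and> real k \<le> norm (\<xi> S))"
    for k :: nat and p :: 'x and w :: "real \<Rightarrow> 'u" and S r :: real
  define Q where "Q k p w S p' w' S' \<longleftrightarrow> norm (p' - p) \<le> (1/2)^k \<and> S \<le> S' \<and> (\<forall>t<S. w' t = w t)"
    for k :: nat and p :: 'x and w :: "real \<Rightarrow> 'u" and S :: real and p' w' S'
  have start: "\<exists>w. I 0 z w 0 r0"
  proof -
    obtain v :: "real \<Rightarrow> 'u" where "bounded_input M v" using ex unfolding explosive_def by blast
    then have "I 0 z v 0 r0"
      using ex r0 trajectory_zero_time[of f v z] unfolding I_def by auto
    then show ?thesis by (rule exI[of _ v])
  qed
  have step: "\<exists>p' w' S' r'. I (Suc k) p' w' S' r' \<and> Q k p w S p' w' S'" if I: "I k p w S r" for k p w S r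
  proof -
    obtain \<xi> where \<xi>: "trajectory f w p S \<xi>" "explosive (\<xi> S) r" using I unfolding I_def by blast
    have h: "0 \<le> S" "0 \<le> r" "bounded_input M w" "(0::real) < (1/2)^k" and Sr: "S + r \<le> r0 + 2 - 2 * (1/2)^k"
      using I unfolding I_def by auto
    obtain p' w' S' r' \<xi>' where n: "norm (p' - p) \<le> (1/2)^k" "S \<le> S'" "0 \<le> r'" "S' + r' \<le> S + r + (1/2)^k"
      "bounded_input M w'" "\<And>t. t < S \<Longrightarrow> w' t = w t" "trajectory f w' p' S' \<xi>'" "explosive (\<xi>' S') r'" "real (Suc k) \<le> norm (\<xi>' S')"
      by (rule explosive_step[OF h(1,2,3) \<xi> h(4), of "real (Suc k)"]) (rule that)
    have "S' + r' \<le> r0 + 2 - 2 * (1/2)^(Suc k)" using n(4) Sr by simp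
    then have "I (Suc k) p' w' S' r'" unfolding I_def using n h(1) by auto
    moreover have "Q k p w S p' w' S'" unfolding Q_def using n by auto
    ultimately show ?thesis by blast
  qed
  define I' where "I' k st \<longleftrightarrow> I k (fst st) (fst (snd st)) (fst (snd (snd st))) (snd (snd (snd st)))" for k st
  define Q' where "Q' k st st' \<longleftrightarrow> Q k (fst st) (fst (snd st)) (fst (snd (snd st)))
    (fst st') (fst (snd st')) (fst (snd (snd st')))" for k and st :: "'x \<times> (real \<Rightarrow> 'u) \<times> real \<times> real" and st' :: "'x \<times> (real \<Rightarrow> 'u) \<times> real \<times> real"
  have "\<exists>F. \<forall>k. I' k (F k) \<and> Q' k (F k) (F (Suc k))"
  proof (rule dependent_nat_choice)
    obtain w where "I 0 z w 0 r0" using start by blast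
    then show "\<exists>st. I' 0 st" by (intro exI[of _ "(z, w, 0, r0)"]) (simp add: I'_def)
    fix st k assume "I' k st"
    then obtain p' w' S' r' where "I (Suc k) p' w' S' r'"
        "Q k (fst st) (fst (snd st)) (fst (snd (snd st))) p' w' S'"
      using step unfolding I'_def by blast
    then show "\<exists>st'. I' (Suc k) st' \<and> Q' k st st'"
      by (intro exI[of _ "(p', w', S', r')"]) (simp add: I'_def Q'_def)
  qed
  then obtain F where F: "\<And>k. I' k (F k)" "\<And>k. Q' k (F k) (F (Suc k))" by blast
  define p where "p k = fst (F k)" for k
  define w where "w k = fst (snd (F k))" for k
  define S where "S k = fst (snd (snd (F k)))" for k
  define r where "r k = snd (snd (snd (F k)))" for k
  have I: "I k (p k) (w k) (S k) (r k)" for k using F(1)[of k] by (simp add: I'_def p_def w_def S_def r_def)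
  have Q: "Q k (p k) (w k) (S k) (p (Suc k)) (w (Suc k)) (S (Suc k))" for k using F(2)[of k] by (simp add: Q'_def p_def w_def S_def)
  define T where "T = r0 + 2"
  have S: "0 \<le> S k" "S k \<le> T" for k
  proof -
    have "0 \<le> S k" "0 \<le> r k" "S k + r k \<le> r0 + 2 - 2 * (1/2)^k" using I[of k] unfolding I_def by auto
    moreover have "(0::real) \<le> 2 * (1/2)^k" by simp
    ultimately show "0 \<le> S k" "S k \<le> T" unfolding T_def by linarith+
  qed
  have T: "0 \<le> T" using r0 by (simp add: T_def)
  have mono: "S j \<le> S k" if "j \<le> k" for j k
    using lift_Suc_mono_le[of S, OF _ that] Q unfolding Q_def by blast
  have agree: "w k t = w j t" if "j \<le> k" "t < S j" for j k t
    using that(1)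
  proof (induction k rule: dec_induct)
    case (step n)
    have "t < S n" using mono[OF step(1)] that(2) by simp
    then have "w (Suc n) t = w n t" using Q[of n] unfolding Q_def by blast
    with step show ?case by simp
  qed simp
  have w: "bounded_input M (w k)" for k using I[of k] unfolding I_def by blast
  then have M: "0 \<le> M" by (rule bounded_input_nonneg)
  \<comment> \<open>The inputs extend one another, so any \<open>k\<close> with
    \<open>t < S k\<close> gives the same value; the least one serves as a choice. Later times get
    0, and \<open>u\<close> is measurable as a pointwise limit of the truncated
    \<open>w k\<close>.\<close>
  define u where "u t = (if \<exists>k. t < S k then w (LEAST k. t < S k) t else 0)" for t
  have u_eq: "u t = w k t" if "t < S k" for t k
  proof -
    have "(LEAST k. t < S k) \<le> k" "t < S (LEAST k. t < S k)" using that by (auto intro: Least_le LeastI)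
    then have "w k t = w (LEAST k. t < S k) t" by (rule agree)
    then show ?thesis using that by (auto simp: u_def)
  qed
  have "bounded_input M u"
    unfolding bounded_input_def
  proof (intro conjI allI)
    show "norm (u t) \<le> M" for t using bounded_inputD[OF w] M by (simp add: u_def)
    show "u \<in> borel_measurable lebesgue"
    proof (rule borel_measurable_LIMSEQ_metric)
      show "(\<lambda>t. if t < S k then w k t else 0) \<in> borel_measurable lebesgue" for k
        using w[of k] by (auto simp: bounded_input_def intro!: measurable_If)
      fix t
      show "(\<lambda>k. if t < S k then w k t else 0) \<longlonglongrightarrow> u t"
      proof (cases "\<exists>k. t < S k")
        case True
        then obtain k where k: "t < S k" by blast
        have "\<forall>\<^sub>F j in sequentially. (if t < S j then w j t else 0) = u t"
        proof (rule eventually_sequentiallyI[of k])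
          fix j assume "k \<le> j"
          then have "t < S j" using mono[of k j] k by simp
          then show "(if t < S j then w j t else 0) = u t" using u_eq by simp
        qed
        then show ?thesis by (rule tendsto_eventually)
      next
        case False
        then show ?thesis by (simp add: u_def)
      qed
    qed
  qed
  note u = this
  have "summable (\<lambda>k. p (Suc k) - p k)"
    by (rule summable_comparison_test'[OF summable_geometric[of "1/2::real"]]) (use Q in \<open>auto simp: Q_def\<close>)
  then have "(\<lambda>n. \<Sum>k<n. p (Suc k) - p k) \<longlonglongrightarrow> (\<Sum>k. p (Suc k) - p k)" by (rule summable_LIMSEQ)
  then have "(\<lambda>n. p n - p 0) \<longlonglongrightarrow> (\<Sum>k. p (Suc k) - p k)" by (simp add: sum_lessThan_telescope)
  from tendsto_add[OF this tendsto_const[of "p 0"]] obtain q where q: "p \<longlonglongrightarrow> q" by auto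
  obtain \<xi> where \<xi>: "trajectory f u q T \<xi>" using complete[OF u T] by blast
  obtain N where N: "0 \<le> N" "\<And>t. \<lbrakk>0 \<le> t; t \<le> T\<rbrakk> \<Longrightarrow> norm (\<xi> t) \<le> N" using solves_bounded[OF \<xi>] by blast
  obtain L where L: "0 \<le> L" "\<And>u x y T \<xi>. \<lbrakk>bounded_input M u; 0 \<le> T; trajectory f u x T \<xi>;
      \<And>t. \<lbrakk>0 \<le> t; t \<le> T\<rbrakk> \<Longrightarrow> norm (\<xi> t) \<le> N; norm (y - x) * exp (L * T) \<le> 1\<rbrakk> \<Longrightarrow>
      \<exists>\<zeta>. trajectory f u y T \<zeta> \<and> (\<forall>t\<in>{0..T}. norm (\<zeta> t - \<xi> t) \<le> norm (y - x) * exp (L * T))"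
    by (rule trajectory_perturbation[OF lipschitz N(1)]) blast
  have "\<forall>\<^sub>F k in sequentially. norm (p k - q) < exp (- (L * T))"
    using tendstoD[OF q, of "exp (- (L * T))"] by (simp add: dist_norm)
  moreover have "\<forall>\<^sub>F k in sequentially. N + 1 < real k"
    by (rule eventually_sequentiallyI[of "nat \<lceil>N + 2\<rceil>"]) linarith
  ultimately have "\<forall>\<^sub>F k in sequentially. norm (p k - q) < exp (- (L * T)) \<and> N + 1 < real k"
    by (rule eventually_conj)
  then obtain k where k: "norm (p k - q) < exp (- (L * T))" "N + 1 < real k"
    using eventually_happens'[OF sequentially_bot] by blast
  have \<xi>k: "trajectory f u q (S k) \<xi>" using solves_subinterval[OF \<xi>] S by blast
  have "norm (p k - q) * exp (L * S k) \<le> exp (- (L * T)) * exp (L * T)"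
    using k(1) S[of k] L(1) by (intro mult_mono) (auto intro: mult_left_mono)
  also have "\<dots> = 1" by (simp add: exp_add[symmetric])
  finally have near: "norm (p k - q) * exp (L * S k) \<le> 1" .
  have \<xi>N: "norm (\<xi> t) \<le> N" if "0 \<le> t" "t \<le> S k" for t using N(2)[of t] S(2)[of k] that by simp
  obtain \<zeta> where \<zeta>: "trajectory f u (p k) (S k) \<zeta>" "\<forall>t\<in>{0..S k}. norm (\<zeta> t - \<xi> t) \<le> norm (p k - q) * exp (L * S k)"
    using L(2)[OF u S(1) \<xi>k \<xi>N near] by blast
  obtain \<psi> where \<psi>: "trajectory f (w k) (p k) (S k) \<psi>" "real k \<le> norm (\<psi> (S k))"
    using I[of k] unfolding I_def by blast
  have "trajectory f u (p k) (S k) \<psi>"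
    by (rule trajectory_input_spike[where f = f and u = "w k" and N = "{S k}", OF \<psi>(1)]) (auto intro: u_eq)
  from trajectory_unique[OF lipschitz u this \<zeta>(1), of "S k"] have "\<psi> (S k) = \<zeta> (S k)" using S by simp
  moreover have "norm (\<zeta> (S k) - \<xi> (S k)) \<le> 1" using \<zeta>(2) near S(1)[of k] by force
  ultimately have "norm (\<psi> (S k)) \<le> N + 1"
    using norm_triangle_sub[of "\<zeta> (S k)" "\<xi> (S k)"] \<xi>N[of "S k"] S(1)[of k] by simp
  with \<psi>(2) k(2) show False by simp
qed

text \<open>Without a uniform bound, initial values in the closed ball reaching norm above
  \<open>n\<close> would have a convergent subsequence, whose limit would be explosive. Passing to a
  subsequence keeps the lower bound because \<open>n \<le> k n\<close>.\<close>

corollary bounded_reachability: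
  assumes T: "0 \<le> T"
  obtains B where "\<And>x v t \<xi>. \<lbrakk>norm x \<le> C; bounded_input M v; 0 \<le> t; t \<le> T; trajectory f v x t \<xi>\<rbrakk> \<Longrightarrow> norm (\<xi> t) \<le> B"
proof (rule ccontr)
  assume "\<not> thesis"
  with that have "\<And>B. \<exists>x v t \<xi>. norm x \<le> C \<and> bounded_input M v \<and> 0 \<le> t \<and> t \<le> T \<and> trajectory f v x t \<xi> \<and> B < norm (\<xi> t)"
    by (meson not_le)
  then have "\<exists>x. norm x \<le> C \<and> (\<exists>v t \<xi>. bounded_input M v \<and> 0 \<le> t \<and> t \<le> T \<and> trajectory f v x t \<xi> \<and> real n < norm (\<xi> t))" for n
    by blast
  then obtain X where X: "\<And>n. norm (X n) \<le> C"
      "\<And>n. \<exists>v t \<xi>. bounded_input M v \<and> 0 \<le> t \<and> t \<le> T \<and> trajectory f v (X n) t \<xi> \<and> real n < norm (\<xi> t)"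
    by metis
  have "seq_compact (cball (0::'x) C)" by (intro compact_imp_seq_compact compact_cball)
  moreover have "\<forall>n. X n \<in> cball 0 C" using X(1) by simp
  ultimately obtain z k where k: "strict_mono (k :: nat \<Rightarrow> nat)" "(X \<circ> k) \<longlonglongrightarrow> z"
    by (rule seq_compactE)
  have "explosive z T"
  proof (rule explosive_limit[OF k(2) T])
    have "\<exists>v t \<xi>. bounded_input M v \<and> 0 \<le> t \<and> t \<le> T \<and> trajectory f v ((X \<circ> k) n) t \<xi> \<and> real n < norm (\<xi> t)" for n
      using X(2)[of "k n"] seq_suble[OF k(1), of n] by (fastforce intro: le_less_trans)
    then show "\<forall>\<^sub>F n in sequentially. \<exists>v t \<xi>. bounded_input M v \<and> 0 \<le> t \<and> t \<le> T \<and> trajectory f v ((X \<circ> k) n) t \<xi> \<and> real n < norm (\<xi> t)"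
      by simp
  qed
  with not_explosive[OF T] show False by blast
qed

end

section \<open>Slowly growing gains\<close>

lemma class_K_inf_strict_mono: "\<gamma> \<in> class_K_inf \<Longrightarrow> 0 \<le> r \<Longrightarrow> r < s \<Longrightarrow> \<gamma> r < \<gamma> s"
  by (auto simp: class_K_inf_def strict_mono_on_def)

lemma class_K_inf_mono: "\<gamma> \<in> class_K_inf \<Longrightarrow> 0 \<le> r \<Longrightarrow> r \<le> s \<Longrightarrow> \<gamma> r \<le> \<gamma> s"
  using class_K_inf_strict_mono[of \<gamma> r s] by (cases "r = s") auto

lemma class_K_inf_zero: "\<gamma> \<in> class_K_inf \<Longrightarrow> \<gamma> 0 = 0"
  by (simp add: class_K_inf_def)

lemma class_K_inf_nonneg: "\<gamma> \<in> class_K_inf \<Longrightarrow> 0 \<le> r \<Longrightarrow> 0 \<le> \<gamma> r"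
  using class_K_inf_mono[of \<gamma> 0 r] by (simp add: class_K_inf_zero)

lemma class_K_inf_unbounded:
  assumes "\<gamma> \<in> class_K_inf"
  obtains r where "0 \<le> r" "y < \<gamma> r"
proof -
  have "\<not> bdd_above (\<gamma> ` {0..})" using assms by (simp add: class_K_inf_def)
  then obtain r where "r \<in> {0..}" "\<not> \<gamma> r \<le> y" unfolding bdd_above_def by blast
  then show ?thesis using that[of r] by simp
qed

lemma class_K_infI:
  assumes "continuous_on {0..} \<gamma>" "\<And>r s. \<lbrakk>0 \<le> r; r < s\<rbrakk> \<Longrightarrow> \<gamma> r < \<gamma> s" "\<And>y. \<exists>r\<ge>0. y < \<gamma> r" "\<gamma> 0 = 0"
  shows "\<gamma> \<in> class_K_inf"
proof -
  have "\<not> bdd_above (\<gamma> ` {0..})"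
  proof
    assume "bdd_above (\<gamma> ` {0..})"
    then obtain y where "\<And>r. 0 \<le> r \<Longrightarrow> \<gamma> r \<le> y" unfolding bdd_above_def by auto
    then show False using assms(3)[of y] by (meson not_le)
  qed
  with assms show ?thesis by (auto simp: class_K_inf_def strict_mono_on_def)
qed

lemma id_class_K_inf: "(\<lambda>r. r) \<in> class_K_inf"
proof (rule class_K_infI)
  show "\<exists>r\<ge>0. y < r" for y :: real by (rule exI[of _ "\<bar>y\<bar> + 1"]) auto
qed auto

lemma class_K_inf_scale:
  assumes "\<gamma> \<in> class_K_inf" "0 < c"
  shows "(\<lambda>r. c * \<gamma> r) \<in> class_K_inf"
proof (rule class_K_infI)
  show "continuous_on {0..} (\<lambda>r. c * \<gamma> r)"
    using assms by (auto simp: class_K_inf_def intro!: continuous_intros)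
  show "\<exists>r\<ge>0. y < c * \<gamma> r" for y
    using class_K_inf_unbounded[OF assms(1), of "y / c"] assms(2) by (metis pos_divide_less_eq mult.commute)
qed (use assms in \<open>auto simp: class_K_inf_strict_mono class_K_inf_zero\<close>)

text \<open>Extended by the identity to negative arguments, \<open>\<gamma>\<close> is a strictly
  increasing bijection of the line. Its inverse is monotone and onto, hence continuous.\<close>

lemma class_K_inf_inverse:
  assumes \<gamma>: "\<gamma> \<in> class_K_inf"
  obtains \<kappa> where "\<kappa> \<in> class_K_inf" "\<And>r. 0 \<le> r \<Longrightarrow> \<gamma> (\<kappa> r) = r"
proof -
  define h where "h r = (if 0 \<le> r then \<gamma> r else r)" for r
  have h_less: "h r < h s" if "r < s" for r s
    using that class_K_inf_strict_mono[OF \<gamma>, of r s] class_K_inf_nonneg[OF \<gamma>, of s] by (auto simp: h_def)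
  then have "strict_mono h" by (rule strict_monoI)
  then have inj: "inj h" by (rule strict_mono_imp_inj_on)
  have surj: "surj h"
    unfolding surj_def
  proof
    fix y
    show "\<exists>r. y = h r"
    proof (cases "0 \<le> y")
      case True
      obtain s where s: "0 \<le> s" "y < \<gamma> s" using class_K_inf_unbounded[OF \<gamma>] .
      have "continuous_on {0..s} \<gamma>" using \<gamma> by (auto simp: class_K_inf_def intro: continuous_on_subset)
      then obtain r where "0 \<le> r" "\<gamma> r = y"
        using IVT'[of \<gamma> 0 y s] s True class_K_inf_zero[OF \<gamma>] by auto
      then show ?thesis by (intro exI[of _ r]) (simp add: h_def)
    qed (auto simp: h_def)
  qed
  define \<kappa> where "\<kappa> = inv h"
  have h\<kappa>: "h (\<kappa> r) = r" for r using surj by (simp add: \<kappa>_def surj_f_inv_f)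
  have \<kappa>h: "\<kappa> (h r) = r" for r using inj by (simp add: \<kappa>_def)
  have less: "\<kappa> r < \<kappa> s" if "r < s" for r s
    using that h_less[of "\<kappa> s" "\<kappa> r"] h\<kappa> by (metis less_asym' linorder_neqE_linordered_idom)
  have zero: "\<kappa> 0 = 0" using \<kappa>h[of 0] class_K_inf_zero[OF \<gamma>] by (simp add: h_def)
  have nonneg: "0 \<le> \<kappa> r" if "0 \<le> r" for r using less[of 0 r] zero that by (cases "r = 0") auto
  have "range \<kappa> = UNIV" using \<kappa>h by (metis surj_def)
  then have "continuous_on UNIV \<kappa>"
    by (intro continuous_onI_mono) (auto intro: less_imp_le less simp: le_less)
  then have cont: "continuous_on {0..} \<kappa>" by (rule continuous_on_subset) simp
  have "\<kappa> \<in> class_K_inf"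
  proof (rule class_K_infI[OF cont less _ zero])
    fix y
    have "y < \<kappa> (h (\<bar>y\<bar> + 1))" unfolding \<kappa>h by linarith
    moreover have "0 \<le> h (\<bar>y\<bar> + 1)"
      using class_K_inf_nonneg[OF \<gamma>, of "\<bar>y\<bar> + 1"] by (simp add: h_def)
    ultimately show "\<exists>r\<ge>0. y < \<kappa> r" by blast
  qed
  moreover have "\<gamma> (\<kappa> r) = r" if "0 \<le> r" for r
    using h\<kappa>[of r] nonneg[OF that] by (simp add: h_def)
  ultimately show ?thesis using that by blast
qed

text \<open>The infimum of the 1-Lipschitz functions \<open>r \<mapsto> n + max 0 (r - c n)\<close> grows as slowly as
  prescribed by \<open>c\<close>; the bounded summand \<open>r / (1 + r)\<close> makes it strictly increasing.\<close>

lemma class_K_inf_slow_growth: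
  fixes c :: "nat \<Rightarrow> real"
  assumes c: "\<And>n. 0 \<le> c n"
  obtains \<eta> where "\<eta> \<in> class_K_inf" "\<And>r s. \<lbrakk>0 \<le> r; 0 \<le> s\<rbrakk> \<Longrightarrow> \<bar>\<eta> r - \<eta> s\<bar> \<le> 2 * \<bar>r - s\<bar>"
    "\<And>n r. \<lbrakk>0 \<le> r; r \<le> c n\<rbrakk> \<Longrightarrow> \<eta> r \<le> real (Suc n)"
proof -
  define A where "A n r = real n + max 0 (r - c n)" for n r
  define g where "g r = (INF n. A n r)" for r
  define b where "b r = r / (1 + r)" for r :: real
  have bdd: "bdd_below (range (\<lambda>n. A n r))" for r by (rule bdd_belowI[of _ 0]) (auto simp: A_def)
  have g_le: "g r \<le> A n r" for n r unfolding g_def by (rule cINF_lower[OF bdd]) simp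
  have g_ge: "y \<le> g r" if "\<And>n. y \<le> A n r" for y r unfolding g_def by (rule cINF_greatest) (use that in auto)
  have g_lip: "g r \<le> g s + \<bar>r - s\<bar>" for r s
  proof -
    have "g r - \<bar>r - s\<bar> \<le> g s"
    proof (rule g_ge)
      fix n
      have "A n r \<le> A n s + \<bar>r - s\<bar>" by (auto simp: A_def)
      with g_le[of r n] show "g r - \<bar>r - s\<bar> \<le> A n s" by simp
    qed
    then show ?thesis by simp
  qed
  have g_mono: "g r \<le> g s" if "r \<le> s" for r s
  proof (rule g_ge)
    fix n
    have "A n r \<le> A n s" using that by (auto simp: A_def)
    with g_le[of r n] show "g r \<le> A n s" by simp
  qed
  have g0: "g 0 = 0"
    using g_le[of 0 0] g_ge[of 0 0] c[of 0] by (auto simp: A_def)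
  \<comment> \<open>At this argument every \<open>A n\<close> is at least \<open>k\<close>: for
    \<open>n < k\<close> because the argument exceeds \<open>c n\<close> by at least
    \<open>k\<close>, for the other \<open>n\<close> because of the constant
    \<open>n\<close>.\<close>
  have g_unb: "real k \<le> g (real k + (\<Sum>n<k. c n))" for k
  proof (rule g_ge)
    fix n
    show "real k \<le> A n (real k + (\<Sum>n<k. c n))"
    proof (cases "n < k")
      case True
      then have "c n \<le> (\<Sum>n<k. c n)" using c by (intro member_le_sum) auto
      then show ?thesis by (simp add: A_def)
    qed (simp add: A_def)
  qed
  have b_diff: "b r - b s = (r - s) / ((1 + r) * (1 + s))" if "0 \<le> r" "0 \<le> s" for r s
    using that by (simp add: b_def field_simps add_nonneg_eq_0_iff)
  have b_lip: "\<bar>b r - b s\<bar> \<le> \<bar>r - s\<bar>" if "0 \<le> r" "0 \<le> s" for r s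
  proof -
    have "1 \<le> (1 + r) * (1 + s)" using that by (simp add: algebra_simps)
    then have "\<bar>r - s\<bar> / ((1 + r) * (1 + s)) \<le> \<bar>r - s\<bar> / 1" by (intro divide_left_mono) auto
    then show ?thesis using that by (simp add: b_diff abs_divide abs_mult)
  qed
  have b01: "0 \<le> b r" "b r \<le> 1" if "0 \<le> r" for r using that by (auto simp: b_def field_simps)
  \<comment> \<open>Both summands are 1-Lipschitz, which gives the constant 2. Since
    \<open>b\<close> is at most 1 and \<open>g\<close> at most \<open>n\<close> up to
    \<open>c n\<close>, the sum is at most \<open>Suc n\<close> there.\<close>
  define \<eta> where "\<eta> r = b r + g r" for r
  have lip: "\<bar>\<eta> r - \<eta> s\<bar> \<le> 2 * \<bar>r - s\<bar>" if "0 \<le> r" "0 \<le> s" for r s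
    using b_lip[OF that] g_lip[of r s] g_lip[of s r] by (simp add: \<eta>_def abs_if split: if_splits)
  have "\<eta> \<in> class_K_inf"
  proof (rule class_K_infI)
    have "2-lipschitz_on {0..} \<eta>" by (rule lipschitz_onI) (use lip in \<open>auto simp: dist_real_def\<close>)
    then show "continuous_on {0..} \<eta>" by (rule lipschitz_on_continuous_on)
    show "\<eta> r < \<eta> s" if "0 \<le> r" "r < s" for r s
    proof -
      have "0 < (s - r) / ((1 + s) * (1 + r))" using that by simp
      moreover have "b s - b r = (s - r) / ((1 + s) * (1 + r))" using b_diff[of s r] that by simp
      ultimately have "b r < b s" by linarith
      then show ?thesis using g_mono[of r s] that by (simp add: \<eta>_def)
    qed
    show "\<exists>r\<ge>0. y < \<eta> r" for y
    proof -
      obtain k :: nat where k: "y < real k" using reals_Archimedean2 by blast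
      have "0 \<le> real k + (\<Sum>n<k. c n)" using c by (intro add_nonneg_nonneg sum_nonneg) auto
      moreover from this have "y < \<eta> (real k + (\<Sum>n<k. c n))" using k g_unb[of k] b01 by (force simp: \<eta>_def)
      ultimately show ?thesis by blast
    qed
    show "\<eta> 0 = 0" by (simp add: \<eta>_def b_def g0)
  qed
  moreover have "\<eta> r \<le> real (Suc n)" if "0 \<le> r" "r \<le> c n" for n r
    using g_le[of r n] b01[OF that(1)] that(2) by (simp add: \<eta>_def A_def)
  ultimately show ?thesis using lip that by blast
qed

lemma bounded_input_zero: "0 \<le> M \<Longrightarrow> bounded_input M (\<lambda>_. 0)"
  by (simp add: bounded_input_def)

text \<open>As long as \<open>norm (\<xi> t) \<le> B n + 1\<close>, an input dominated by \<open>\<eta>\<close> is bounded by \<open>n\<close>, so that in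
  fact \<open>norm (\<xi> t) \<le> B n\<close>: the trajectory cannot cross the layer in between.\<close>

lemma dominating_gain_exists:
  fixes f :: "'x::euclidean_space \<Rightarrow> 'u::euclidean_space \<Rightarrow> 'x"
  assumes f: "lipschitz_on_balls f"
    and complete: "\<And>M u x T. \<lbrakk>bounded_input M u; 0 \<le> T\<rbrakk> \<Longrightarrow> \<exists>\<xi>. trajectory f u x T \<xi>"
  obtains \<eta> B where "\<eta> \<in> class_K_inf" "\<And>r s. \<lbrakk>0 \<le> r; 0 \<le> s\<rbrakk> \<Longrightarrow> \<bar>\<eta> r - \<eta> s\<bar> \<le> 2 * \<bar>r - s\<bar>"
    "\<And>n r. \<lbrakk>1 \<le> n; 0 \<le> r; r \<le> B n\<rbrakk> \<Longrightarrow> \<eta> r \<le> real n"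
    "\<And>n u x T \<xi> N. \<lbrakk>1 \<le> n; u \<in> borel_measurable lebesgue; 0 \<le> T; trajectory f u x T \<xi>; norm x \<le> real n; T \<le> real n;
       negligible N; \<And>t. \<lbrakk>0 \<le> t; t \<le> T; t \<notin> N\<rbrakk> \<Longrightarrow> norm (u t) \<le> \<eta> (norm (\<xi> t))\<rbrakk> \<Longrightarrow> norm (\<xi> T) \<le> B n"
proof -
  have "\<exists>b. \<forall>x v t \<xi>. norm x \<le> real n \<longrightarrow> bounded_input (real n) v \<longrightarrow> 0 \<le> t \<longrightarrow> t \<le> real n \<longrightarrow> trajectory f v x t \<xi> \<longrightarrow>
      norm (\<xi> t) \<le> b" for n
  proof -
    interpret complete_system f "real n" by unfold_locales (use f complete in auto)
    obtain b where "\<And>x v t \<xi>. \<lbrakk>norm x \<le> real n; bounded_input (real n) v; 0 \<le> t; t \<le> real n; trajectory f v x t \<xi>\<rbrakk> \<Longrightarrow> norm (\<xi> t) \<le> b"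
      using bounded_reachability[of "real n" "real n"] by (metis of_nat_0_le_iff)
    then show ?thesis by blast
  qed
  then obtain B where B: "\<And>n x v t \<xi>. \<lbrakk>norm x \<le> real n; bounded_input (real n) v; 0 \<le> t; t \<le> real n; trajectory f v x t \<xi>\<rbrakk> \<Longrightarrow>
      norm (\<xi> t) \<le> B n"
    by metis
  have xB: "norm x \<le> B n" if "norm x \<le> real n" for x :: 'x and n
    using B[of x n "\<lambda>_. 0" 0 "\<lambda>_. x"] that trajectory_zero_time[of f "\<lambda>_. 0" x] by (simp add: bounded_input_zero)
  have "0 \<le> B n" for n using xB[of 0 n] by simp
  \<comment> \<open>The growth lemma yields the value \<open>Suc n\<close> at index
    \<open>n\<close>; shifting \<open>B\<close> by one index aligns the value \<open>n\<close> with
    \<open>B n\<close> for \<open>n \<ge> 1\<close>. Index 0 is excluded, as it would ask for a gain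
    that vanishes on an interval. The added 1 is the width of the layer.\<close>
  then have "0 \<le> B (Suc n) + 1" for n by (simp add: add_nonneg_nonneg)
  then obtain \<eta> where \<eta>: "\<eta> \<in> class_K_inf" "\<And>r s. \<lbrakk>0 \<le> r; 0 \<le> s\<rbrakk> \<Longrightarrow> \<bar>\<eta> r - \<eta> s\<bar> \<le> 2 * \<bar>r - s\<bar>"
    "\<And>n r. \<lbrakk>0 \<le> r; r \<le> B (Suc n) + 1\<rbrakk> \<Longrightarrow> \<eta> r \<le> real (Suc n)"
    using class_K_inf_slow_growth[of "\<lambda>n. B (Suc n) + 1"] by metis
  have \<eta>n: "\<eta> r \<le> real n" if "1 \<le> n" "0 \<le> r" "r \<le> B n + 1" for n r
    using \<eta>(3)[of r "n - 1"] that by simp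
  show ?thesis
  proof (rule that[OF \<eta>(1,2), of B])
    fix n u x T \<xi> N
    assume n: "1 \<le> n" and u: "u \<in> borel_measurable lebesgue" and T: "0 \<le> T" and \<xi>: "trajectory f u x T \<xi>"
      and x: "norm x \<le> real n" and Tn: "T \<le> real n" and N: "negligible N"
      and dom: "\<And>t. \<lbrakk>0 \<le> t; t \<le> T; t \<notin> N\<rbrakk> \<Longrightarrow> norm (u t) \<le> \<eta> (norm (\<xi> t))"
    show "norm (\<xi> T) \<le> B n"
    proof (rule ccontr)
      assume "\<not> norm (\<xi> T) \<le> B n"
      \<comment> \<open>The level lies strictly above \<open>B n\<close>, but not above the layer
        nor above the final norm. A first contact with it therefore exists, and until then the gain
        is at most \<open>n\<close>.\<close>
      define w where "w = min (norm (\<xi> T)) (B n + 1)"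
      have w: "B n < w" "w \<le> norm (\<xi> T)" "w \<le> B n + 1" using \<open>\<not> norm (\<xi> T) \<le> B n\<close> by (auto simp: w_def)
      have "continuous_on {0..T} (\<lambda>t. norm (\<xi> t))" using solves_continuous_on[OF \<xi>] by (intro continuous_intros)
      moreover have "norm (\<xi> 0) \<le> w" using solves_initial[OF \<xi> T] xB[OF x] w(1) by simp
      ultimately obtain s where s: "0 \<le> s" "s \<le> T" "norm (\<xi> s) = w" "\<And>t. \<lbrakk>0 \<le> t; t \<le> s\<rbrakk> \<Longrightarrow> norm (\<xi> t) \<le> w"
        using first_hitting_time[of T "\<lambda>t. norm (\<xi> t)" w] w(2) T by auto
      define v where "v t = (if norm (u t) \<le> real n then u t else 0)" for t
      have "{t. norm (u t) \<le> real n} \<in> sets lebesgue"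
        using borel_measurable_le[of "\<lambda>t. norm (u t)" lebesgue "\<lambda>_. real n"] u by simp
      then have "v \<in> borel_measurable lebesgue"
        unfolding v_def using u by (intro measurable_If) auto
      then have v: "bounded_input (real n) v" by (simp add: bounded_input_def v_def)
      have "trajectory f v x s \<xi>"
      proof (rule trajectory_input_spike[where f = f and u = u, OF _ N])
        show "trajectory f u x s \<xi>" by (rule solves_subinterval[OF \<xi> s(2)])
        fix t assume t: "0 \<le> t" "t \<le> s" "t \<notin> N"
        have "norm (u t) \<le> \<eta> (norm (\<xi> t))" using dom t s(2) by simp
        also have "\<dots> \<le> real n" using s(4)[OF t(1,2)] w(3) by (intro \<eta>n[OF n]) auto
        finally show "v t = u t" by (simp add: v_def)
      qed
      from B[OF x v s(1) _ this] s(2,3) Tn w(1) show False by simp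
    qed
  next
    fix n r assume "1 \<le> n" "0 \<le> r" "r \<le> B n"
    then show "\<eta> r \<le> real n" by (intro \<eta>n) auto
  qed
qed

section \<open>The Lyapunov function\<close>

text \<open>The properties of \<open>dominating_gain_exists\<close> as assumptions. Because
  \<open>\<eta>_le\<close> and \<open>dominated_bound\<close> share the same \<open>B\<close>, they
  combine to \<open>\<eta> (norm (\<xi> T)) \<le> n\<close>, with no trace of the size of
  \<open>B n\<close>.\<close>

locale dominated_system =
  fixes f :: "'x::euclidean_space \<Rightarrow> 'u::euclidean_space \<Rightarrow> 'x" and \<eta> :: "real \<Rightarrow> real" and B :: "nat \<Rightarrow> real"
  assumes lipschitz: "lipschitz_on_balls f"
    and complete: "\<And>M u x T. \<lbrakk>bounded_input M u; 0 \<le> T\<rbrakk> \<Longrightarrow> \<exists>\<xi>. trajectory f u x T \<xi>"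
    and \<eta>: "\<eta> \<in> class_K_inf"
    and \<eta>_lipschitz: "\<And>r s. \<lbrakk>0 \<le> r; 0 \<le> s\<rbrakk> \<Longrightarrow> \<bar>\<eta> r - \<eta> s\<bar> \<le> 2 * \<bar>r - s\<bar>"
    and \<eta>_le: "\<And>n r. \<lbrakk>1 \<le> n; 0 \<le> r; r \<le> B n\<rbrakk> \<Longrightarrow> \<eta> r \<le> real n"
    and dominated_bound: "\<And>n u x T \<xi> N. \<lbrakk>1 \<le> n; u \<in> borel_measurable lebesgue; 0 \<le> T; trajectory f u x T \<xi>;
       norm x \<le> real n; T \<le> real n; negligible N; \<And>t. \<lbrakk>0 \<le> t; t \<le> T; t \<notin> N\<rbrakk> \<Longrightarrow> norm (u t) \<le> \<eta> (norm (\<xi> t))\<rbrakk> \<Longrightarrow>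
       norm (\<xi> T) \<le> B n"
begin

text \<open>Trajectories of \<open>f\<close> under dominated inputs are the trajectories of \<open>F\<close> under disturbances \<open>d\<close>
  with values in the unit ball. Unlike the set of dominated inputs, the set of disturbances does not
  depend on the initial value.\<close>

definition F :: "'x \<Rightarrow> 'u \<Rightarrow> 'x" where
  "F x d = f x (\<eta> (norm x) *\<^sub>R d)"

lemma \<eta>_nonneg: "0 \<le> \<eta> (norm x)"
  using class_K_inf_nonneg[OF \<eta>] by simp

lemma \<eta>_le_double: "\<eta> (norm x) \<le> 2 * norm x"
  using \<eta>_lipschitz[of "norm x" 0] class_K_inf_zero[OF \<eta>] by simp

lemma lipschitz_on_balls_F: "lipschitz_on_balls F"
  unfolding lipschitz_on_balls_def
proof (intro allI impI)
  fix C :: real assume C: "C > 0"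
  \<comment> \<open>For states and disturbances of norm below \<open>C\<close> the actual input
    \<open>\<eta> (norm x) *\<^sub>R d\<close> has norm below \<open>2 * C * C\<close>, so both
    arguments of \<open>f\<close> stay in the ball of radius \<open>C'\<close>.\<close>
  define C' where "C' = C + 2 * C * C"
  have C': "C' > 0" "C \<le> C'" "2 * C * C \<le> C'" using C by (auto simp: C'_def add_pos_pos)
  obtain L where L: "L > 0" "\<And>x\<^sub>1 x\<^sub>2 u\<^sub>1 u\<^sub>2. \<lbrakk>norm x\<^sub>1 < C'; norm x\<^sub>2 < C'; norm u\<^sub>1 < C'; norm u\<^sub>2 < C'\<rbrakk> \<Longrightarrow>
     norm (f x\<^sub>1 u\<^sub>1 - f x\<^sub>2 u\<^sub>2) \<le> L * (norm (x\<^sub>1 - x\<^sub>2) + norm (u\<^sub>1 - u\<^sub>2))"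
    using lipschitz C'(1) unfolding lipschitz_on_balls_def by (metis mem_ball_0)
  have "norm (F x\<^sub>1 d\<^sub>1 - F x\<^sub>2 d\<^sub>2) \<le> L * (1 + 2 * C) * (norm (x\<^sub>1 - x\<^sub>2) + norm (d\<^sub>1 - d\<^sub>2))"
    if n: "norm x\<^sub>1 < C" "norm x\<^sub>2 < C" "norm d\<^sub>1 < C" "norm d\<^sub>2 < C" for x\<^sub>1 x\<^sub>2 d\<^sub>1 d\<^sub>2
  proof -
    let ?e1 = "\<eta> (norm x\<^sub>1)" and ?e2 = "\<eta> (norm x\<^sub>2)"
    have e: "?e1 \<le> 2 * C" "?e2 \<le> 2 * C" using \<eta>_le_double[of x\<^sub>1] \<eta>_le_double[of x\<^sub>2] n by auto
    have u: "norm (\<eta> (norm x) *\<^sub>R d) < C'" if "norm x < C" "norm d < C" for x and d :: 'u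
    proof -
      have "\<eta> (norm x) * norm d \<le> (2 * C) * norm d"
        using \<eta>_le_double[of x] that by (intro mult_right_mono) auto
      also have "\<dots> < (2 * C) * C" using that C by simp
      finally show ?thesis using C'(3) \<eta>_nonneg[of x] by simp
    qed
    have "norm (?e1 *\<^sub>R d\<^sub>1 - ?e2 *\<^sub>R d\<^sub>2) = norm (?e1 *\<^sub>R (d\<^sub>1 - d\<^sub>2) + (?e1 - ?e2) *\<^sub>R d\<^sub>2)"
      by (simp add: algebra_simps)
    also have "\<dots> \<le> ?e1 * norm (d\<^sub>1 - d\<^sub>2) + \<bar>?e1 - ?e2\<bar> * norm d\<^sub>2"
      using norm_triangle_ineq[of "?e1 *\<^sub>R (d\<^sub>1 - d\<^sub>2)" "(?e1 - ?e2) *\<^sub>R d\<^sub>2"] \<eta>_nonneg[of x\<^sub>1] by simp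
    also have "\<dots> \<le> 2 * C * norm (d\<^sub>1 - d\<^sub>2) + 2 * norm (x\<^sub>1 - x\<^sub>2) * C"
    proof (intro add_mono mult_right_mono mult_mono)
      have "\<bar>?e1 - ?e2\<bar> \<le> 2 * \<bar>norm x\<^sub>1 - norm x\<^sub>2\<bar>" by (intro \<eta>_lipschitz) auto
      then show "\<bar>?e1 - ?e2\<bar> \<le> 2 * norm (x\<^sub>1 - x\<^sub>2)" 
        by (rule order_trans) (use norm_triangle_ineq3[of x\<^sub>1 x\<^sub>2] in simp)
    qed (use e n in auto)
    finally have d: "norm (?e1 *\<^sub>R d\<^sub>1 - ?e2 *\<^sub>R d\<^sub>2) \<le> 2 * C * (norm (x\<^sub>1 - x\<^sub>2) + norm (d\<^sub>1 - d\<^sub>2))"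
      by (simp add: algebra_simps)
    have "norm (F x\<^sub>1 d\<^sub>1 - F x\<^sub>2 d\<^sub>2) \<le> L * (norm (x\<^sub>1 - x\<^sub>2) + norm (?e1 *\<^sub>R d\<^sub>1 - ?e2 *\<^sub>R d\<^sub>2))"
      unfolding F_def using n C'(2) u by (intro L(2)) auto
    also have "\<dots> \<le> L * ((norm (x\<^sub>1 - x\<^sub>2) + norm (d\<^sub>1 - d\<^sub>2)) + 2 * C * (norm (x\<^sub>1 - x\<^sub>2) + norm (d\<^sub>1 - d\<^sub>2)))"
      using d L(1) by (intro mult_left_mono add_mono) auto
    finally show ?thesis by (simp add: algebra_simps)
  qed
  moreover have "L * (1 + 2 * C) > 0" using L(1) C by simp
  ultimately show "\<exists>L>0. \<forall>x\<^sub>1\<in>ball 0 C. \<forall>x\<^sub>2\<in>ball 0 C. \<forall>u\<^sub>1\<in>ball 0 C. \<forall>u\<^sub>2\<in>ball 0 C.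
      norm (F x\<^sub>1 u\<^sub>1 - F x\<^sub>2 u\<^sub>2) \<le> L * (norm (x\<^sub>1 - x\<^sub>2) + norm (u\<^sub>1 - u\<^sub>2))"
    by (intro exI[of _ "L * (1 + 2 * C)"]) auto
qed

text \<open>The feedback input \<open>\<eta> (norm (\<psi> t)) *\<^sub>R d t\<close> is dominated
  along \<open>\<psi>\<close> by construction. Setting it to 0 outside \<open>{0..T}\<close>, where
  \<open>\<psi>\<close> need not be continuous, makes it measurable on the whole line.\<close>

lemma F_trajectory_bound:
  assumes \<psi>: "trajectory F d x T \<psi>" and d: "bounded_input 1 d" and T: "0 \<le> T" "T \<le> real n"
    and n: "1 \<le> n" "norm x \<le> real n"
  shows "norm (\<psi> T) \<le> B n"
proof -
  define u where "u t = (if t \<in> {0..T} then \<eta> (norm (\<psi> t)) *\<^sub>R d t else 0)" for t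
  have "continuous_on {0..T} (\<lambda>t. \<eta> (norm (\<psi> t)))"
    by (rule continuous_on_compose2[of "{0..}" \<eta>])
      (use \<eta> solves_continuous_on[OF \<psi>] in \<open>auto simp: class_K_inf_def intro!: continuous_intros\<close>)
  then have "(\<lambda>t. \<eta> (norm (\<psi> t))) \<in> borel_measurable (lebesgue_on {0..T})"
    by (intro continuous_imp_measurable_on_sets_lebesgue) auto
  moreover have "d \<in> borel_measurable (lebesgue_on {0..T})"
    using d by (auto simp: bounded_input_def intro: measurable_restrict_space1)
  ultimately have "u \<in> borel_measurable lebesgue"
    unfolding u_def by (intro borel_measurable_if_I borel_measurable_scaleR) auto
  moreover have "trajectory f u x T \<psi>"
    using \<psi> by (rule solves_cong) (auto simp: F_def u_def)
  moreover have "norm (u t) \<le> \<eta> (norm (\<psi> t))" for t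
    using bounded_inputD[OF d, of t] \<eta>_nonneg[of "\<psi> t"] by (simp add: u_def mult_left_le)
  ultimately show ?thesis
    using dominated_bound[OF n(1) _ T(1) _ n(2) T(2), of u \<psi> "{}"] by simp
qed

text \<open>Completeness of \<open>f\<close> does not transfer directly, since the feedback input
  has no bound known in advance; the bound \<open>B n\<close> supplies the a priori estimate for
  existence.\<close>

lemma F_complete:
  assumes d: "bounded_input 1 d" and T: "0 \<le> T"
  obtains \<psi> where "trajectory F d x T \<psi>"
proof -
  define n where "n = nat \<lceil>max (norm x) T\<rceil> + 1"
  have n: "1 \<le> n" "norm x \<le> real n" "T \<le> real n" unfolding n_def by linarith+
  show ?thesis
  proof (rule trajectory_exists_if_bounded[OF lipschitz_on_balls_F d T])
    show "norm (\<psi> t) \<le> B n" if "0 \<le> t" "t \<le> T" "trajectory F d x t \<psi>" for t \<psi>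
      using F_trajectory_bound[OF that(3) d that(1) _ n(1,2)] that(2) n(3) by simp
  qed (rule that)
qed

text \<open>The values of a converse Lyapunov construction by discounted suprema. The summand 1
  keeps the supremum at least 1, so that late times, whose values are small, cannot affect Lipschitz
  estimates.\<close>

definition discounted_gains :: "'x \<Rightarrow> real set" where
  "discounted_gains x = {exp (- t) * (1 + \<eta> (norm (\<psi> t))) | t d \<psi>. 0 \<le> t \<and> bounded_input 1 d \<and> trajectory F d x t \<psi>}"

definition V :: "'x \<Rightarrow> real" where
  "V x = Sup (discounted_gains x)"

lemma value_le:
  assumes "0 \<le> t" "bounded_input 1 d" "trajectory F d x t \<psi>"
  shows "exp (- t) * (1 + \<eta> (norm (\<psi> t))) \<le> exp (- t) * (norm x + t + 3)"
proof -
  \<comment> \<open>One integer must dominate the initial norm and the time; rounding up and adding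
    1 costs at most 2, and the summand 1 in the gain completes the constant 3.\<close>
  define n where "n = nat \<lceil>max (norm x) t\<rceil> + 1"
  have n: "1 \<le> n" "norm x \<le> real n" "t \<le> real n" unfolding n_def by linarith+
  have "0 \<le> max (norm x) t" by (rule max.coboundedI1) simp
  then have "real n \<le> max (norm x) t + 2" unfolding n_def by linarith
  also have "\<dots> \<le> norm x + t + 2" using assms(1) by simp
  finally have "real n \<le> norm x + t + 2" .
  moreover have "\<eta> (norm (\<psi> t)) \<le> real n"
    using F_trajectory_bound[OF assms(3,2,1) n(3,1,2)] by (intro \<eta>_le[OF n(1)]) auto
  ultimately show ?thesis by (intro mult_left_mono) auto
qed

lemma discounted_gains_le:
  assumes "y \<in> discounted_gains x"
  shows "y \<le> norm x + 4"
proof -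
  obtain t d \<psi> where t: "0 \<le> t" "bounded_input 1 d" "trajectory F d x t \<psi>" "y = exp (- t) * (1 + \<eta> (norm (\<psi> t)))"
    using assms unfolding discounted_gains_def by blast
  \<comment> \<open>The discounted time \<open>t * exp (- t)\<close> is at most 1, which turns the
    constant 3 into 4.\<close>
  have "t \<le> exp t" using exp_ge_add_one_self[of t] by linarith
  then have "exp (- t) * t \<le> 1" by (simp add: exp_minus field_simps)
  moreover have "exp (- t) * (norm x + 3) \<le> 1 * (norm x + 3)" using t(1) by (intro mult_right_mono) auto
  moreover have "y \<le> exp (- t) * (norm x + 3) + exp (- t) * t"
    using value_le[OF t(1-3)] t(4) by (simp add: algebra_simps)
  ultimately show ?thesis by simp
qed

lemma bdd_above_discounted_gains: "bdd_above (discounted_gains x)"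
  using discounted_gains_le by (meson bdd_aboveI)

lemma initial_value: "1 + \<eta> (norm x) \<in> discounted_gains x"
proof -
  have "bounded_input 1 (\<lambda>_. 0::'u)" by (simp add: bounded_input_zero)
  moreover have "trajectory F (\<lambda>_. 0) x 0 (\<lambda>_. x)" by (rule trajectory_zero_time)
  ultimately show ?thesis unfolding discounted_gains_def
    by (intro CollectI exI[of _ 0] exI[of _ "\<lambda>_. 0"] exI[of _ "\<lambda>_. x"]) auto
qed

lemma V_ge_value:
  assumes "0 \<le> t" "bounded_input 1 d" "trajectory F d x t \<psi>"
  shows "exp (- t) * (1 + \<eta> (norm (\<psi> t))) \<le> V x"
  unfolding V_def by (rule cSup_upper[OF _ bdd_above_discounted_gains]) (use assms in \<open>auto simp: discounted_gains_def\<close>)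

lemma V_least:
  assumes "\<And>t d \<psi>. \<lbrakk>0 \<le> t; bounded_input 1 d; trajectory F d x t \<psi>\<rbrakk> \<Longrightarrow> exp (- t) * (1 + \<eta> (norm (\<psi> t))) \<le> b"
  shows "V x \<le> b"
  unfolding V_def
proof (rule cSup_least)
  show "discounted_gains x \<noteq> {}" using initial_value by blast
qed (use assms in \<open>auto simp: discounted_gains_def\<close>)

lemma V_ge: "1 + \<eta> (norm x) \<le> V x"
  unfolding V_def by (rule cSup_upper[OF initial_value bdd_above_discounted_gains])

lemma V_le: "V x \<le> norm x + 4"
  unfolding V_def using initial_value discounted_gains_le by (intro cSup_least) auto

text \<open>Dynamic programming: a trajectory from \<open>\<psi> s\<close> prolongs
  \<open>\<psi>\<close> to a trajectory from \<open>x\<close>, and its value is discounted by the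
  additional factor \<open>exp (- s)\<close>.\<close>

lemma V_growth:
  assumes s: "0 \<le> s" and d: "bounded_input 1 d" and \<psi>: "trajectory F d x s \<psi>"
  shows "V (\<psi> s) \<le> exp s * V x"
proof (rule V_least)
  fix t d' \<psi>' assume t: "0 \<le> t" and d': "bounded_input 1 d'" and \<psi>': "trajectory F d' (\<psi> s) t \<psi>'"
  have "exp (- (s + t)) * (1 + \<eta> (norm ((\<lambda>q. if q \<le> s then \<psi> q else \<psi>' (q - s)) (s + t)))) \<le> V x"
    by (rule V_ge_value[OF _ bounded_input_concat[OF d d'] trajectory_concat[OF \<psi> \<psi>' s t]]) (use s t in simp)
  moreover have "(\<lambda>q. if q \<le> s then \<psi> q else \<psi>' (q - s)) (s + t) = \<psi>' t"
    using solves_initial[OF \<psi>' t] t by auto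
  ultimately have "exp (- (s + t)) * (1 + \<eta> (norm (\<psi>' t))) \<le> V x" by simp
  then have "exp s * (exp (- (s + t)) * (1 + \<eta> (norm (\<psi>' t)))) \<le> exp s * V x" by (intro mult_left_mono) auto
  then show "exp (- t) * (1 + \<eta> (norm (\<psi>' t))) \<le> exp s * V x"
    by (simp add: mult.assoc[symmetric] exp_add[symmetric])
qed

text \<open>For \<open>x\<close> in a bounded set only trajectories on a bounded time interval matter for the supremum,
  because \<open>V x \<ge> 1\<close> while the values at later times are at most 1.\<close>

lemma V_lipschitz: "lipschitz_on_bounded_sets V"
  unfolding lipschitz_on_bounded_sets_def
proof (intro allI impI)
  fix C :: real assume C: "C > 0"
  \<comment> \<open>For \<open>t > C + 3\<close> one has \<open>C + 3 \<le> t\<^sup>2 / 2\<close>,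
    so the quadratic Taylor bound gives \<open>C + t + 3 \<le> exp t\<close>, and by
    \<open>value_le\<close> the discounted value is at most 1.\<close>
  define T where "T = C + 3"
  define n where "n = nat \<lceil>T\<rceil> + 1"
  have n: "1 \<le> n" "C \<le> real n" "T \<le> real n" unfolding n_def T_def by linarith+
  define R where "R = max 0 (B n)"
  have R: "0 \<le> R" by (simp add: R_def)
  obtain L where L: "0 \<le> L" "\<And>u x y T \<xi> \<zeta> t. \<lbrakk>bounded_input 1 u; trajectory F u x T \<xi>; trajectory F u y T \<zeta>;
        \<And>t. \<lbrakk>0 \<le> t; t \<le> T\<rbrakk> \<Longrightarrow> norm (\<xi> t) \<le> R; \<And>t. \<lbrakk>0 \<le> t; t \<le> T\<rbrakk> \<Longrightarrow> norm (\<zeta> t) \<le> R; 0 \<le> t; t \<le> T\<rbrakk> \<Longrightarrow>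
      norm (\<xi> t - \<zeta> t) \<le> norm (x - y) * exp (L * T)"
    by (rule trajectory_perturbation[OF lipschitz_on_balls_F R]) blast
  have V: "V x \<le> V y + 2 * exp (L * T) * norm (x - y)" if x: "norm x < C" and y: "norm y < C" for x y
  proof (rule V_least)
    fix t d \<psi> assume t: "0 \<le> t" and d: "bounded_input 1 d" and \<psi>: "trajectory F d x t \<psi>"
    show "exp (- t) * (1 + \<eta> (norm (\<psi> t))) \<le> V y + 2 * exp (L * T) * norm (x - y)"
    proof (cases "t \<le> T")
      case True
      have bound: "norm (\<zeta> s) \<le> R" if "norm z < C" "trajectory F d z t \<zeta>" "0 \<le> s" "s \<le> t" for z \<zeta> s
        using F_trajectory_bound[OF solves_subinterval[OF that(2,4)] d that(3) _ n(1)] that True n by (simp add: R_def)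
      obtain \<zeta> where \<zeta>: "trajectory F d y t \<zeta>" using F_complete[OF d t] .
      have "norm (\<psi> t - \<zeta> t) \<le> norm (x - y) * exp (L * t)"
        using L(2)[OF d \<psi> \<zeta> bound[OF x \<psi>] bound[OF y \<zeta>] t order_refl] by simp
      also have "\<dots> \<le> norm (x - y) * exp (L * T)" using L(1) True by (intro mult_left_mono) (auto intro: mult_left_mono)
      finally have close: "norm (\<psi> t - \<zeta> t) \<le> norm (x - y) * exp (L * T)" .
      have "\<bar>\<eta> (norm (\<psi> t)) - \<eta> (norm (\<zeta> t))\<bar> \<le> 2 * \<bar>norm (\<psi> t) - norm (\<zeta> t)\<bar>" by (intro \<eta>_lipschitz) auto
      then have "\<eta> (norm (\<psi> t)) \<le> \<eta> (norm (\<zeta> t)) + 2 * (norm (x - y) * exp (L * T))"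
        using order_trans[OF norm_triangle_ineq3 close] abs_ge_self[of "\<eta> (norm (\<psi> t)) - \<eta> (norm (\<zeta> t))"] by simp
      then have "exp (- t) * (1 + \<eta> (norm (\<psi> t))) \<le> exp (- t) * ((1 + \<eta> (norm (\<zeta> t))) + 2 * (norm (x - y) * exp (L * T)))"
        by (intro mult_left_mono) auto
      also have "\<dots> = exp (- t) * (1 + \<eta> (norm (\<zeta> t))) + exp (- t) * (2 * (norm (x - y) * exp (L * T)))"
        by (rule distrib_left)
      also have "\<dots> \<le> V y + 1 * (2 * (norm (x - y) * exp (L * T)))"
        using t by (intro add_mono V_ge_value[OF t d \<zeta>] mult_right_mono) auto
      finally show ?thesis by (simp add: algebra_simps)
    next
      case False
      have "(C + 3) * (C + 3) \<le> t * t" using False C by (intro mult_mono) (auto simp: T_def)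
      moreover have "2 * (C + 3) \<le> (C + 3) * (C + 3)" using C by (intro mult_right_mono) auto
      ultimately have "2 * (C + 3) \<le> t\<^sup>2" unfolding power2_eq_square by (rule order_trans[rotated])
      then have "C + t + 3 \<le> 1 + t + t\<^sup>2 / 2" by (simp add: field_simps)
      then have "norm x + t + 3 \<le> exp t" using exp_lower_Taylor_quadratic[OF t] x by linarith
      then have "exp (- t) * (norm x + t + 3) \<le> 1" by (simp add: exp_minus field_simps)
      then have "exp (- t) * (1 + \<eta> (norm (\<psi> t))) \<le> 1" using value_le[OF t d \<psi>] by linarith
      also have "\<dots> \<le> V y" using V_ge[of y] \<eta>_nonneg[of y] by linarith
      finally show ?thesis by (simp add: add_increasing2)
    qed
  qed
  have "\<bar>V x - V y\<bar> \<le> 2 * exp (L * T) * norm (x - y)" if "norm x < C" "norm y < C" for x y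
    using V[OF that] V[OF that(2,1)] by (simp add: norm_minus_commute abs_le_iff)
  then show "\<exists>L>0. \<forall>x\<^sub>1\<in>ball 0 C. \<forall>x\<^sub>2\<in>ball 0 C. \<bar>V x\<^sub>1 - V x\<^sub>2\<bar> \<le> L * norm (x\<^sub>1 - x\<^sub>2)"
    by (intro exI[of _ "2 * exp (L * T)"]) auto
qed

end

section \<open>The characterization of forward completeness\<close>

lemma lipschitz_on_bounded_sets_imp_continuous:
  fixes V :: "'x::euclidean_space \<Rightarrow> real"
  assumes "lipschitz_on_bounded_sets V"
  shows "continuous_on UNIV V"
proof -
  have "continuous_on (ball 0 C) V" if C: "C > 0" for C
  proof -
    obtain L where L: "L > 0" "\<forall>x\<in>ball 0 C. \<forall>y\<in>ball 0 C. \<bar>V x - V y\<bar> \<le> L * norm (x - y)"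
      using assms C unfolding lipschitz_on_bounded_sets_def by blast
    have "L-lipschitz_on (ball 0 C) V" by (rule lipschitz_onI) (use L in \<open>auto simp: dist_norm\<close>)
    then show ?thesis by (rule lipschitz_on_continuous_on)
  qed
  then have "continuous_on (\<Union>C\<in>{0<..}. ball 0 C) V"
    by (intro continuous_on_open_UN) auto
  moreover have "(\<Union>C\<in>{0<..}. ball (0::'x) C) = UNIV"
  proof -
    have "x \<in> ball 0 (norm x + 1)" "norm x + 1 > 0" for x :: 'x by (auto simp: add_nonneg_pos)
    then show ?thesis by blast
  qed
  ultimately show ?thesis by simp
qed

lemma input_norm_shift_le:
  assumes "bounded_input M u"
  shows "(\<lambda>t. u (s + t)) \<in> Linf_inputs" "input_norm (\<lambda>t. u (s + t)) \<le> M"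
  using bounded_input_imp_Linf_inputs[OF bounded_input_shift[OF assms]] by auto

section \<open>Robust completeness and the Lyapunov decay condition from the gain\<close>

context dominated_system
begin

lemma robustly_forward_complete: "robustly_forward_complete (ode_flow f)"
  unfolding robustly_forward_complete_def
proof (intro conjI bexI[OF _ \<eta>] allI impI)
  show "forward_complete (ode_flow f)"
    unfolding forward_complete_ode_flow_iff[OF lipschitz] using complete by blast
  then have fc: "ode_flow f t x u \<noteq> None" if "0 \<le> t" "u \<in> Linf_inputs" for t x u
    using that by (auto simp: forward_complete_def)
  fix C \<tau> :: real assume "C > 0" "\<tau> \<ge> 0"
  define n where "n = nat \<lceil>max C \<tau>\<rceil> + 1"
  have n: "1 \<le> n" "C \<le> real n" "\<tau> \<le> real n" unfolding n_def by linarith+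
  show "bdd_above {norm (the (ode_flow f t x u)) | t x u.
      norm x < C \<and> u \<in> dominated_inputs (ode_flow f) \<eta> x \<and> 0 \<le> t \<and> t < \<tau>}"
  proof (rule bdd_aboveI[of _ "B n"], clarify)
    fix t :: real and x :: 'x and u :: "real \<Rightarrow> 'u"
    assume x: "norm x < C" and u: "u \<in> dominated_inputs (ode_flow f) \<eta> x" and t: "0 \<le> t" "t < \<tau>"
    have uL: "u \<in> Linf_inputs" using u by (simp add: dominated_inputs_def)
    obtain \<xi> where \<xi>: "trajectory f u x t \<xi>"
      using fc[OF t(1) uL] ode_flow_eq_Some_iff[OF lipschitz uL] by blast
    have flow: "ode_flow f s x u = Some (\<xi> s)" if "0 \<le> s" "s \<le> t" for s
      using ode_flow_trajectory[OF lipschitz uL \<xi> that] .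
    have "AE \<theta> in lebesgue_on {0..}. norm (u \<theta>) \<le> \<eta> (norm (the (ode_flow f \<theta> x u)))"
      using u by (simp add: dominated_inputs_def)
    then obtain N1 where N1: "negligible N1" "\<And>\<theta>. \<lbrakk>0 \<le> \<theta>; \<theta> \<notin> N1\<rbrakk> \<Longrightarrow> norm (u \<theta>) \<le> \<eta> (norm (the (ode_flow f \<theta> x u)))"
      by (auto simp: AE_lebesgue_on_iff_negligible)
    obtain v N2 where v: "bounded_input (input_norm u) v" "negligible N2" "\<And>t. \<lbrakk>0 \<le> t; t \<notin> N2\<rbrakk> \<Longrightarrow> v t = u t"
      using Linf_inputs_obtain_bounded_input[OF uL order_refl] by blast
    have "trajectory f v x t \<xi>"
      by (rule trajectory_input_spike[where f = f and u = u, OF \<xi> v(2)]) (use v(3) in auto)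
    note tv = this
    have "norm (\<xi> t) \<le> B n"
    proof (rule dominated_bound[where u = v and N = "N1 \<union> N2" and x = x and n = n])
      show "trajectory f v x t \<xi>" by (rule tv)
      show "v \<in> borel_measurable lebesgue" using v(1) by (simp add: bounded_input_def)
      show "negligible (N1 \<union> N2)" using N1(1) v(2) by simp
      show "norm (v s) \<le> \<eta> (norm (\<xi> s))" if "0 \<le> s" "s \<le> t" "s \<notin> N1 \<union> N2" for s
        using N1(2)[of s] v(3)[of s] flow[of s] that by simp
    qed (use x t n in auto)
    then show "norm (the (ode_flow f t x u)) \<le> B n" using flow t by simp
  qed
qed

text \<open>An input bounded by the gain along its own trajectory is the gain times a disturbance in
  the unit ball, so the trajectory is one of \<open>F\<close> and the growth estimate
  applies.\<close>

lemma dominated_short_time: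
  assumes u: "bounded_input M u" and \<xi>: "trajectory f u x \<sigma> \<xi>" and \<sigma>: "0 \<le> \<sigma>"
    and M: "\<And>s. \<lbrakk>0 \<le> s; s \<le> \<sigma>\<rbrakk> \<Longrightarrow> M \<le> \<eta> (norm (\<xi> s))"
  shows "V (\<xi> \<sigma>) \<le> exp \<sigma> * V x"
proof -
  \<comment> \<open>Where the gain vanishes so does the input, and \<open>inverse 0 = 0\<close>
    gives the disturbance 0 there, which still reproduces the input.\<close>
  define d where "d t = (if t \<in> {0..\<sigma>} then inverse (\<eta> (norm (\<xi> t))) *\<^sub>R u t else 0)" for t
  have "continuous_on {0..\<sigma>} (\<lambda>t. \<eta> (norm (\<xi> t)))"
    by (rule continuous_on_compose2[of "{0..}" \<eta>])
      (use \<eta> solves_continuous_on[OF \<xi>] in \<open>auto simp: class_K_inf_def intro!: continuous_intros\<close>)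
  then have "(\<lambda>t. \<eta> (norm (\<xi> t))) \<in> borel_measurable (lebesgue_on {0..\<sigma>})"
    by (intro continuous_imp_measurable_on_sets_lebesgue) auto
  moreover have "u \<in> borel_measurable (lebesgue_on {0..\<sigma>})"
    using u by (auto simp: bounded_input_def intro: measurable_restrict_space1)
  ultimately have "d \<in> borel_measurable lebesgue"
    unfolding d_def by (intro borel_measurable_if_I borel_measurable_scaleR borel_measurable_inverse) auto
  moreover have le: "norm (u t) \<le> \<eta> (norm (\<xi> t))" if "0 \<le> t" "t \<le> \<sigma>" for t
    using bounded_inputD[OF u, of t] M[OF that] by simp
  have "norm (d t) \<le> 1" for t
  proof (cases "t \<in> {0..\<sigma>}")
    case True
    then show ?thesis
      using le[of t] \<eta>_nonneg[of "\<xi> t"] by (cases "\<eta> (norm (\<xi> t)) = 0") (auto simp: d_def field_simps)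
  next
    case False
    then have "d t = 0" by (simp only: d_def if_False)
    then show ?thesis by simp
  qed
  ultimately have d: "bounded_input 1 d" by (simp add: bounded_input_def)
  have "trajectory F d x \<sigma> \<xi>"
  proof (rule solves_cong[OF \<xi> refl])
    fix t assume t: "0 \<le> t" "t \<le> \<sigma>"
    have "\<eta> (norm (\<xi> t)) *\<^sub>R d t = u t"
      using t le[OF t] by (cases "\<eta> (norm (\<xi> t)) = 0") (auto simp: d_def)
    then show "F (\<xi> t) (d t) = f (\<xi> t) (u t)" by (simp add: F_def)
  qed
  from V_growth[OF \<sigma> d this] show ?thesis .
qed

text \<open>The growth estimate on a short interval bounds the difference quotients by
  \<open>(exp s - 1) / s * V x\<close>, which tends to \<open>V x\<close>.\<close>

lemma BRS_Lyapunov_function_V: "BRS_Lyapunov_function (ode_flow f) V"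
  unfolding BRS_Lyapunov_function_def
proof (intro conjI allI)
  show "continuous_on UNIV V" by (rule lipschitz_on_bounded_sets_imp_continuous[OF V_lipschitz])
  show "0 \<le> V x" for x using V_ge[of x] \<eta>_nonneg[of x] by linarith
  have "\<eta> (norm x) \<le> V x \<and> V x \<le> norm x + 4" for x
    using V_ge[of x] V_le[of x] by simp
  then show "\<exists>\<alpha>\<^sub>1\<in>class_K_inf. \<exists>\<alpha>\<^sub>2\<in>class_K_inf. \<exists>C\<ge>0. \<forall>x. \<alpha>\<^sub>1 (norm x) \<le> V x \<and> V x \<le> \<alpha>\<^sub>2 (norm x) + C"
    by (intro bexI[OF _ \<eta>] bexI[OF _ id_class_K_inf] exI[of _ 4]) auto
  obtain \<kappa> where \<kappa>: "\<kappa> \<in> class_K_inf" "\<And>r. 0 \<le> r \<Longrightarrow> \<eta> (\<kappa> r) = r" using class_K_inf_inverse[OF \<eta>] by blast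
  \<comment> \<open>Doubling the inverse of the gain leaves room for motion: the input is dominated
    already at norm \<open>norm x / 2\<close>, and by continuity the trajectory stays above that
    norm for a short time. For \<open>x = 0\<close> the norm condition is trivial.\<close>
  have lie: "lie_derivative (ode_flow f) V u x \<le> ereal (V x)"
    if u: "u \<in> Linf_inputs" and dom: "2 * \<kappa> (input_norm u) \<le> norm x" for x u
  proof -
    let ?M = "input_norm u"
    obtain v N where v: "bounded_input ?M v" "negligible N" "\<And>t. \<lbrakk>0 \<le> t; t \<notin> N\<rbrakk> \<Longrightarrow> v t = u t"
      using Linf_inputs_obtain_bounded_input[OF u order_refl] by blast
    obtain \<xi> where \<xi>: "trajectory f v x 1 \<xi>" using complete[OF v(1)] by (meson zero_le_one)
    have \<xi>u: "trajectory f u x 1 \<xi>"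
      by (rule trajectory_input_spike[where f = f and u = v, OF \<xi> v(2)]) (use v(3) in auto)
    have M: "?M \<le> \<eta> (norm x / 2)"
      using class_K_inf_mono[OF \<eta>, of "\<kappa> ?M" "norm x / 2"] class_K_inf_nonneg[OF \<kappa>(1) input_norm_nonneg[of u]]
        \<kappa>(2)[OF input_norm_nonneg[of u]] dom by simp
    obtain \<sigma> where \<sigma>: "0 < \<sigma>" "\<sigma> \<le> 1" "\<And>s. \<lbrakk>0 \<le> s; s \<le> \<sigma>\<rbrakk> \<Longrightarrow> norm x / 2 \<le> norm (\<xi> s)"
    proof (cases "x = 0")
      case True
      then show ?thesis using that[of 1] by simp
    next
      case False
      have x0: "\<xi> 0 = x" using solves_initial[OF \<xi>] by simp
      obtain \<delta> where \<delta>: "\<delta> > 0" "\<And>s. \<lbrakk>s \<in> {0..1}; dist s 0 < \<delta>\<rbrakk> \<Longrightarrow> dist (\<xi> s) (\<xi> 0) < norm x / 2"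
        using solves_continuous_on[OF \<xi>] False unfolding continuous_on_iff
        by (metis atLeastAtMost_iff half_gt_zero order_refl zero_le_one zero_less_norm_iff)
      show ?thesis
      proof (rule that[of "min 1 (\<delta> / 2)"])
        fix s assume s: "0 \<le> s" "s \<le> min 1 (\<delta> / 2)"
        then have "dist (\<xi> s) x < norm x / 2" using \<delta>(2)[of s] \<delta>(1) x0 by simp
        then show "norm x / 2 \<le> norm (\<xi> s)"
          using norm_triangle_sub[of x "\<xi> s"] by (simp add: dist_norm norm_minus_commute)
      qed (use \<delta>(1) in auto)
    qed
    have growth: "V (\<xi> s) \<le> exp s * V x" if s: "0 \<le> s" "s \<le> \<sigma>" for s
    proof (rule dominated_short_time[OF v(1) solves_subinterval[OF \<xi>] s(1)])
      show "s \<le> 1" using s \<sigma>(2) by simp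
      fix r assume "0 \<le> r" "r \<le> s"
      then show "?M \<le> \<eta> (norm (\<xi> r))"
        using M class_K_inf_mono[OF \<eta>, of "norm x / 2" "norm (\<xi> r)"] \<sigma>(3)[of r] s(2) by simp
    qed
    have ev: "\<forall>\<^sub>F s in at_right 0. ereal (1 / s * (V (the (ode_flow f s x u)) - V x)) \<le> ereal ((exp s - 1) / s * V x)"
      unfolding eventually_at_right_field
    proof (intro exI[of _ \<sigma>] conjI allI impI \<sigma>(1))
      fix s assume s: "0 < s" "s < \<sigma>"
      then have "the (ode_flow f s x u) = \<xi> s"
        using ode_flow_trajectory[OF lipschitz u \<xi>u, of s] \<sigma>(2) by simp
      moreover have "1 / s * (V (\<xi> s) - V x) \<le> 1 / s * (exp s * V x - V x)"
        using growth[of s] s by (intro mult_left_mono) auto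
      ultimately show "ereal (1 / s * (V (the (ode_flow f s x u)) - V x)) \<le> ereal ((exp s - 1) / s * V x)"
        by (simp add: algebra_simps diff_divide_distrib)
    qed
    have "((\<lambda>s::real. (exp s - 1) / s) \<longlongrightarrow> 1) (at 0)"
      using DERIV_exp[of "0::real"] by (simp add: has_field_derivative_iff)
    then have "((\<lambda>s::real. (exp s - 1) / s) \<longlongrightarrow> 1) (at_right 0)"
      by (rule filterlim_mono[OF _ order_refl]) (simp add: at_le)
    then have "((\<lambda>s. ereal ((exp s - 1) / s * V x)) \<longlongrightarrow> ereal (1 * V x)) (at_right 0)"
      by (intro tendsto_intros)
    then have "Limsup (at_right 0) (\<lambda>s. ereal ((exp s - 1) / s * V x)) = ereal (V x)"
      by (intro lim_imp_Limsup) (auto simp: trivial_limit_at_right_real)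
    with Limsup_mono[OF ev] show ?thesis by (simp add: lie_derivative_def)
  qed
  show "\<exists>\<kappa>\<in>class_K_inf. \<forall>x. \<forall>u\<in>Linf_inputs. \<kappa> (input_norm u) \<le> norm x \<longrightarrow>
      lie_derivative (ode_flow f) V u x \<le> ereal (V x)"
    by (rule bexI[OF _ class_K_inf_scale[OF \<kappa>(1), of 2]]) (use lie in auto)
qed

end

section \<open>From a Lyapunov function back to forward completeness\<close>

lemma real_interval_induct:
  fixes P :: "real \<Rightarrow> bool"
  assumes T: "0 \<le> T"
    and closed: "\<And>s. \<lbrakk>0 \<le> s; s \<le> T; \<And>r. \<lbrakk>0 \<le> r; r < s\<rbrakk> \<Longrightarrow> P r\<rbrakk> \<Longrightarrow> P s"
    and extend: "\<And>s. \<lbrakk>0 \<le> s; s < T; P s\<rbrakk> \<Longrightarrow> \<exists>h>0. \<forall>r. s < r \<and> r < s + h \<longrightarrow> P r"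
  shows "P T"
proof -
  define S where "S = {s\<in>{0..T}. \<forall>r\<in>{0..s}. P r}"
  \<comment> \<open>At \<open>s = 0\<close> the premise of \<open>closed\<close> about earlier times
    is vacuous, so it also provides the base case.\<close>
  have "P 0" using closed[of 0] T by auto
  then have S: "0 \<in> S" "bdd_above S" using T by (auto simp: S_def)
  define \<sigma> where "\<sigma> = Sup S"
  have \<sigma>: "0 \<le> \<sigma>" "\<sigma> \<le> T"
    using S by (auto simp: \<sigma>_def S_def intro!: cSup_upper cSup_least)
  have below: "P r" if r: "0 \<le> r" "r < \<sigma>" for r
  proof -
    obtain s where "s \<in> S" "r < s" using r S less_cSup_iff[of S r] unfolding \<sigma>_def by blast
    then show ?thesis using r(1) by (auto simp: S_def)
  qed
  then have P\<sigma>: "P \<sigma>" using closed \<sigma> by blast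
  have "\<sigma> = T"
  proof (rule ccontr)
    assume "\<sigma> \<noteq> T"
    then have "\<sigma> < T" using \<sigma> by simp
    then obtain h where h: "h > 0" "\<And>r. \<lbrakk>\<sigma> < r; r < \<sigma> + h\<rbrakk> \<Longrightarrow> P r" using extend[OF \<sigma>(1) _ P\<sigma>] by blast
    define s where "s = min T (\<sigma> + h / 2)"
    have "P r" if "0 \<le> r" "r \<le> s" for r
    proof (cases "r < \<sigma>")
      case True
      then show ?thesis using below that by blast
    next
      case False
      then show ?thesis using P\<sigma> h that by (cases "r = \<sigma>") (auto simp: s_def)
    qed
    then have "s \<in> S" using \<sigma> h(1) by (auto simp: S_def s_def)
    then have "s \<le> \<sigma>" unfolding \<sigma>_def using S by (intro cSup_upper)
    then show False using \<open>\<sigma> < T\<close> h(1) by (auto simp: s_def min_def split: if_splits)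
  qed
  with P\<sigma> show ?thesis by simp
qed

text \<open>The comparison function \<open>m * exp (2 * s)\<close> exceeds \<open>V\<close> on the ball where the decay
  condition is void, so at a first contact the Lie derivative estimate applies; it is strict there because
  the comparison function grows at twice the rate.\<close>

lemma BRS_Lyapunov_function_imp_bound:
  fixes f :: "'x::euclidean_space \<Rightarrow> 'u::euclidean_space \<Rightarrow> 'x"
  assumes f: "lipschitz_on_balls f" and V: "BRS_Lyapunov_function (ode_flow f) V"
  obtains m where "\<And>u t \<xi>. \<lbrakk>bounded_input M u; 0 \<le> t; trajectory f u x t \<xi>\<rbrakk> \<Longrightarrow> V (\<xi> t) \<le> m * exp (2 * t)"
proof -
  have cont: "continuous_on UNIV V" using V unfolding BRS_Lyapunov_function_def by blast
  have V0: "0 \<le> V x" for x using V unfolding BRS_Lyapunov_function_def by blast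
  obtain \<alpha> C where \<alpha>: "\<alpha> \<in> class_K_inf" "\<And>x. V x \<le> \<alpha> (norm x) + C"
    using V unfolding BRS_Lyapunov_function_def by blast
  obtain \<kappa> where \<kappa>: "\<kappa> \<in> class_K_inf" "\<And>x u. \<lbrakk>u \<in> Linf_inputs; \<kappa> (input_norm u) \<le> norm x\<rbrakk> \<Longrightarrow>
      lie_derivative (ode_flow f) V u x \<le> ereal (V x)"
    using V unfolding BRS_Lyapunov_function_def by blast
  \<comment> \<open>The first entry settles time 0, the second the ball of radius
    \<open>\<kappa> M\<close>; the summand 1 makes both inequalities strict and \<open>m\<close>
    positive. The constant depends on \<open>x\<close> and \<open>M\<close>, not on the individual
    input.\<close>
  define m where "m = max (V x) (\<alpha> (\<kappa> M) + C) + 1"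
  have m: "V x < m" "\<alpha> (\<kappa> M) + C < m" "0 < m" using V0[of x] by (auto simp: m_def)
  show ?thesis
  proof (rule that[of m])
    fix u :: "real \<Rightarrow> 'u" and t \<xi> assume u: "bounded_input M u" and t: "0 \<le> t" and \<xi>: "trajectory f u x t \<xi>"
    have cV: "continuous_on {0..t} (\<lambda>s. V (\<xi> s))"
      by (rule continuous_on_compose2[OF cont solves_continuous_on[OF \<xi>]]) auto
    define w where "w s = m * exp (2 * s) - V (\<xi> s)" for s
    have cw: "continuous_on {0..t} w" unfolding w_def by (intro continuous_intros cV)
    have "0 \<le> w t"
    proof (rule real_interval_induct[OF t])
      fix s assume s: "0 \<le> s" "s \<le> t" and below: "\<And>r. \<lbrakk>0 \<le> r; r < s\<rbrakk> \<Longrightarrow> 0 \<le> w r"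
      show "0 \<le> w s"
      proof (cases "s = 0")
        case True
        then show ?thesis using m solves_initial[OF \<xi> t] by (simp add: w_def)
      next
        case False
        have "continuous_on {0..s} w" using cw by (rule continuous_on_subset) (use s in auto)
        then have "(w \<longlongrightarrow> w s) (at s within {0..s})" using s by (auto simp: continuous_on_def)
        then have "(w \<longlongrightarrow> w s) (at_left s)" using False s by (simp add: at_within_Icc_at_left)
        moreover have "\<forall>\<^sub>F r in at_left s. 0 \<le> w r"
          unfolding eventually_at_left_field using below False s by (intro exI[of _ 0]) auto
        ultimately show ?thesis by (rule tendsto_lowerbound) simp
      qed
    next
      fix s assume s: "0 \<le> s" "s < t" and ws: "0 \<le> w s"
      show "\<exists>h>0. \<forall>r. s < r \<and> r < s + h \<longrightarrow> 0 \<le> w r"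
      proof (cases "w s = 0")
        case False
        have "continuous_on {s..t} w" using cw by (rule continuous_on_subset) (use s in auto)
        then have "(w \<longlongrightarrow> w s) (at s within {s..t})" using s by (auto simp: continuous_on_def)
        then have "(w \<longlongrightarrow> w s) (at_right s)" using s by (simp add: at_within_Icc_at_right)
        then have "\<forall>\<^sub>F r in at_right s. 0 < w r" by (rule order_tendstoD) (use ws False in auto)
        then obtain b where "s < b" "\<And>r. \<lbrakk>s < r; r < b\<rbrakk> \<Longrightarrow> 0 < w r" by (auto simp: eventually_at_right_field)
        then show ?thesis by (intro exI[of _ "b - s"]) (auto intro: less_imp_le)
      next
        case True
        define y where "y = V (\<xi> s)"
        have y: "y = m * exp (2 * s)" using True by (simp add: w_def y_def)
        have "m * 1 \<le> y" unfolding y using m(3) s(1) by (intro mult_left_mono) auto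
        then have ym: "m \<le> y" by simp
        have "\<kappa> M \<le> norm (\<xi> s)"
        proof (rule ccontr)
          assume "\<not> \<kappa> M \<le> norm (\<xi> s)"
          then have "\<alpha> (norm (\<xi> s)) \<le> \<alpha> (\<kappa> M)" by (intro class_K_inf_mono[OF \<alpha>(1)]) auto
          then show False using \<alpha>(2)[of "\<xi> s"] m(2) ym by (simp add: y_def)
        qed
        \<comment> \<open>The Lie derivative is evaluated along the input shifted by
          \<open>s\<close>. Its norm is again at most \<open>M\<close>, which is why
          \<open>M\<close> rather than the norm of \<open>u\<close> enters the comparison
          constant.\<close>
        let ?u = "\<lambda>r. u (s + r)"
        note u' = input_norm_shift_le[OF u, of s]
        have "\<kappa> (input_norm ?u) \<le> \<kappa> M" by (intro class_K_inf_mono[OF \<kappa>(1)] input_norm_nonneg u'(2))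
        then have "lie_derivative (ode_flow f) V ?u (\<xi> s) \<le> ereal y"
          unfolding y_def using \<open>\<kappa> M \<le> norm (\<xi> s)\<close> by (intro \<kappa>(2) u'(1)) simp
        also have "\<dots> < ereal (2 * y)" using ym m(3) by simp
        finally have "\<forall>\<^sub>F h in at_right 0. ereal (1 / h * (V (the (ode_flow f h (\<xi> s) ?u)) - V (\<xi> s))) < ereal (2 * y)"
          unfolding lie_derivative_def by (rule Limsup_lessD)
        then obtain b where b: "0 < b" "\<And>h. \<lbrakk>0 < h; h < b\<rbrakk> \<Longrightarrow> 1 / h * (V (the (ode_flow f h (\<xi> s) ?u)) - y) < 2 * y"
          unfolding eventually_at_right_field by (auto simp: y_def)
        have "0 \<le> w r" if r: "s < r" "r < s + min b (t - s)" for r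
        proof -
          define h where "h = r - s"
          have h: "0 < h" "h < b" "h \<le> t - s" using r by (auto simp: h_def)
          have "the (ode_flow f h (\<xi> s) ?u) = \<xi> r"
            using ode_flow_trajectory[OF f u'(1) solves_shift[OF \<xi> s(1) less_imp_le[OF s(2)]], of h] h by (simp add: h_def)
          then have "1 / h * (V (\<xi> r) - y) < 2 * y" using b(2)[OF h(1,2)] by simp
          then have "V (\<xi> r) \<le> y * (1 + 2 * h)" using h(1) by (simp add: field_simps)
          also have "\<dots> \<le> y * exp (2 * h)" using ym m(3) exp_ge_add_one_self[of "2 * h"] by (intro mult_left_mono) auto
          also have "\<dots> = m * exp (2 * r)" unfolding y h_def by (simp add: mult.assoc exp_add[symmetric] algebra_simps)
          finally show ?thesis by (simp add: w_def)
        qed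
        then show ?thesis using b(1) s(2) by (intro exI[of _ "min b (t - s)"]) auto
      qed
    qed
    then show "V (\<xi> t) \<le> m * exp (2 * t)" by (simp add: w_def)
  qed
qed

text \<open>The lower comparison function is unbounded, so the exponential bound on \<open>V\<close>
  becomes an a priori bound on the norm up to time \<open>T\<close>, and the solution exists up to
  there.\<close>

lemma BRS_Lyapunov_function_imp_forward_complete:
  fixes f :: "'x::euclidean_space \<Rightarrow> 'u::euclidean_space \<Rightarrow> 'x"
  assumes f: "lipschitz_on_balls f" and V: "BRS_Lyapunov_function (ode_flow f) V"
  shows "forward_complete (ode_flow f)"
  unfolding forward_complete_ode_flow_iff[OF f]
proof (intro allI impI)
  fix M :: real and u :: "real \<Rightarrow> 'u" and x :: 'x and T :: real assume u: "bounded_input M u" and T: "0 \<le> T"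
  obtain \<alpha> where \<alpha>: "\<alpha> \<in> class_K_inf" "\<And>x. \<alpha> (norm x) \<le> V x"
    using V unfolding BRS_Lyapunov_function_def by blast
  obtain m where m: "\<And>u t \<xi>. \<lbrakk>bounded_input M u; 0 \<le> t; trajectory f u x t \<xi>\<rbrakk> \<Longrightarrow> V (\<xi> t) \<le> m * exp (2 * t)"
    using BRS_Lyapunov_function_imp_bound[OF f V] by blast
  obtain R where R: "0 \<le> R" "\<bar>m\<bar> * exp (2 * T) < \<alpha> R" using class_K_inf_unbounded[OF \<alpha>(1)] .
  show "\<exists>\<xi>. trajectory f u x T \<xi>"
  proof (rule trajectory_exists_if_bounded[OF f u T])
    fix t \<xi> assume t: "0 \<le> t" "t \<le> T" and \<xi>: "trajectory f u x t \<xi>"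
    have "\<alpha> (norm (\<xi> t)) \<le> m * exp (2 * t)" using \<alpha>(2)[of "\<xi> t"] m[OF u t(1) \<xi>] by simp
    also have "\<dots> \<le> \<bar>m\<bar> * exp (2 * T)" using t by (intro mult_mono) auto
    finally have "\<alpha> (norm (\<xi> t)) < \<alpha> R" using R(2) by simp
    then show "norm (\<xi> t) \<le> R" using class_K_inf_mono[OF \<alpha>(1) R(1), of "norm (\<xi> t)"] by linarith
  qed blast
qed

section \<open>The implications between the five statements\<close>

lemma forward_complete_imp_bounded_reachability_sets:
  fixes f :: "'x::euclidean_space \<Rightarrow> 'u::euclidean_space \<Rightarrow> 'x"
  assumes f: "lipschitz_on_balls f" and fc: "forward_complete (ode_flow f)"
  shows "bounded_reachability_sets (ode_flow f)"
  unfolding bounded_reachability_sets_def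
proof (intro conjI fc allI impI)
  fix C \<tau> :: real assume "C > 0" and \<tau>: "\<tau> \<ge> 0"
  interpret complete_system f C
    by unfold_locales (use f fc forward_complete_ode_flow_iff[OF f] in auto)
  obtain B where B: "\<And>x v t \<xi>. \<lbrakk>norm x \<le> C; bounded_input C v; 0 \<le> t; t \<le> \<tau>; trajectory f v x t \<xi>\<rbrakk> \<Longrightarrow> norm (\<xi> t) \<le> B"
    using bounded_reachability[OF \<tau>] by blast
  show "bdd_above {norm (the (ode_flow f t x u)) | t x u.
      norm x < C \<and> u \<in> Linf_inputs \<and> input_norm u < C \<and> 0 \<le> t \<and> t < \<tau>}"
  proof (rule bdd_aboveI[of _ B], clarify)
    fix t :: real and x :: 'x and u :: "real \<Rightarrow> 'u"
    assume x: "norm x < C" and u: "u \<in> Linf_inputs" "input_norm u < C" and t: "0 \<le> t" "t < \<tau>"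
    obtain y where y: "ode_flow f t x u = Some y"
      using fc t(1) u(1) unfolding forward_complete_def by blast
    then obtain \<xi> where \<xi>: "trajectory f u x t \<xi>" "\<xi> t = y"
      unfolding ode_flow_eq_Some_iff[OF f u(1)] by blast
    obtain v N where v: "bounded_input C v" "negligible N" "\<And>t. \<lbrakk>0 \<le> t; t \<notin> N\<rbrakk> \<Longrightarrow> v t = u t"
      using Linf_inputs_obtain_bounded_input[OF u(1) less_imp_le[OF u(2)]] by blast
    have "trajectory f v x t \<xi>"
      by (rule trajectory_input_spike[where f = f and u = u, OF \<xi>(1) v(2)]) (use v(3) in auto)
    from B[OF less_imp_le[OF x] v(1) t(1) less_imp_le[OF t(2)] this]
    show "norm (the (ode_flow f t x u)) \<le> B" using y \<xi>(2) by simp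
  qed
qed

lemma forward_complete_imp_dominated_system:
  fixes f :: "'x::euclidean_space \<Rightarrow> 'u::euclidean_space \<Rightarrow> 'x"
  assumes f: "lipschitz_on_balls f" and fc: "forward_complete (ode_flow f)"
  obtains \<eta> B where "dominated_system f \<eta> B"
proof -
  have complete: "\<exists>\<xi>. trajectory f u x T \<xi>" if "bounded_input M u" "0 \<le> T" for M T :: real and u :: "real \<Rightarrow> 'u" and x
    using fc that unfolding forward_complete_ode_flow_iff[OF f] by blast
  show ?thesis
  proof (rule dominating_gain_exists[OF f complete])
    fix \<eta> B
    assume \<eta>: "\<eta> \<in> class_K_inf" "\<And>r s. \<lbrakk>0 \<le> r; 0 \<le> s\<rbrakk> \<Longrightarrow> \<bar>\<eta> r - \<eta> s\<bar> \<le> 2 * \<bar>r - s\<bar>"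
      "\<And>n r. \<lbrakk>1 \<le> n; 0 \<le> r; r \<le> B n\<rbrakk> \<Longrightarrow> \<eta> r \<le> real n"
      and B: "\<And>n u x T \<xi> N. \<lbrakk>1 \<le> n; u \<in> borel_measurable lebesgue; 0 \<le> T; trajectory f u x T \<xi>; norm x \<le> real n; T \<le> real n;
        negligible N; \<And>t. \<lbrakk>0 \<le> t; t \<le> T; t \<notin> N\<rbrakk> \<Longrightarrow> norm (u t) \<le> \<eta> (norm (\<xi> t))\<rbrakk> \<Longrightarrow> norm (\<xi> T) \<le> B n"
    have "dominated_system f \<eta> B"
    proof (rule dominated_system.intro[OF f complete \<eta>])
      fix n :: nat and u :: "real \<Rightarrow> 'u" and x :: 'x and T :: real and \<xi> N
      assume "1 \<le> n" "u \<in> borel_measurable lebesgue" "0 \<le> T" "trajectory f u x T \<xi>" "norm x \<le> real n" "T \<le> real n"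
        "negligible N" "\<And>t. \<lbrakk>0 \<le> t; t \<le> T; t \<notin> N\<rbrakk> \<Longrightarrow> norm (u t) \<le> \<eta> (norm (\<xi> t))"
      then show "norm (\<xi> T) \<le> B n" by (rule B[where u = u])
    qed
    then show ?thesis by (rule that)
  qed
qed

theorem mainTheorem3:
  fixes f :: "real ^ 'n \<Rightarrow> real ^ 'm \<Rightarrow> real ^ 'n"
  assumes f_lipschitz: "\<And>C::real. C > 0 \<Longrightarrow> \<exists>L>0. \<forall>x\<^sub>1\<in>ball 0 C. \<forall>x\<^sub>2\<in>ball 0 C.
      \<forall>u\<^sub>1\<in>ball 0 C. \<forall>u\<^sub>2\<in>ball 0 C.
        norm (f x\<^sub>1 u\<^sub>1 - f x\<^sub>2 u\<^sub>2) \<le> L * (norm (x\<^sub>1 - x\<^sub>2) + norm (u\<^sub>1 - u\<^sub>2))"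
  shows "(forward_complete (ode_flow f)
            \<longleftrightarrow> bounded_reachability_sets (ode_flow f))
       \<and> (bounded_reachability_sets (ode_flow f)
            \<longleftrightarrow> (\<exists>V. BRS_Lyapunov_function (ode_flow f) V))
       \<and> ((\<exists>V. BRS_Lyapunov_function (ode_flow f) V)
            \<longleftrightarrow> (\<exists>V. BRS_Lyapunov_function (ode_flow f) V \<and> lipschitz_on_bounded_sets V))
       \<and> ((\<exists>V. BRS_Lyapunov_function (ode_flow f) V \<and> lipschitz_on_bounded_sets V)
            \<longleftrightarrow> robustly_forward_complete (ode_flow f))"
proof -
  have f: "lipschitz_on_balls f" unfolding lipschitz_on_balls_def using f_lipschitz by blast
  \<comment> \<open>Forward completeness is the hub: it implies bounded reachability, a Lipschitz
    Lyapunov function and robust completeness. Bounded reachability and robust completeness contain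
    it by definition, any Lyapunov function implies it, and a Lipschitz one is in particular a
    Lyapunov function.\<close>
  have 1: "bounded_reachability_sets (ode_flow f)" if "forward_complete (ode_flow f)"
    using forward_complete_imp_bounded_reachability_sets[OF f that] .
  have 2: "\<exists>V. BRS_Lyapunov_function (ode_flow f) V \<and> lipschitz_on_bounded_sets V"
    and 3: "robustly_forward_complete (ode_flow f)" if fc: "forward_complete (ode_flow f)"
  proof -
    obtain \<eta> B where "dominated_system f \<eta> B" using forward_complete_imp_dominated_system[OF f fc] .
    then interpret dominated_system f \<eta> B .
    show "\<exists>V. BRS_Lyapunov_function (ode_flow f) V \<and> lipschitz_on_bounded_sets V"
      using BRS_Lyapunov_function_V V_lipschitz by blast
    show "robustly_forward_complete (ode_flow f)" by (rule robustly_forward_complete)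
  qed
  have 4: "forward_complete (ode_flow f)" if "\<exists>V. BRS_Lyapunov_function (ode_flow f) V"
    using that BRS_Lyapunov_function_imp_forward_complete[OF f] by blast
  have 5: "forward_complete (ode_flow f)" if "bounded_reachability_sets (ode_flow f)"
    using that by (simp add: bounded_reachability_sets_def)
  have 6: "forward_complete (ode_flow f)" if "robustly_forward_complete (ode_flow f)"
    using that by (simp add: robustly_forward_complete_def)
  show ?thesis using 1 2 3 4 5 6 by blast
qed

end
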